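(* Let $M$ and $N$ be differentiable manifolds of dimensions $m$ and $n$, and let $(u_\ell)_{\ell\in\mathbb{N}}$ be a sequence of colocally weakly differentiable maps from $M$ to $N$. If the sequence $(u_\ell)$ converges to $u\colon M\to N$ locally in measure and if the sequence of colocal weak derivatives $(Du_\ell)$ is bilocally uniformly integrable, then $u$ is colocally weakly differentiable, and for every $f\in C^1_c(N,\mathbb{R})$, every local chart $\psi\colon V\subseteq M\to\mathbb{R}^m$ and every $v\in C^1_c(\psi(V),\mathbb{R}^m)$, $$\lim_{\ell\to\infty}\int_{\psi(V)}\langle D(f\circ u_\ell\circ\psi^{-1}),v\rangle=\int_{\psi(V)}\langle D(f\circ u\circ\psi^{-1}),v\rangle.$$ If moreover the sequence $(Du_\ell)$ converges to a bundle morphism $\upsilon\colon TM\to TN$ locally in measure, then $Du=\upsilon$ (almost everywhere).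
   Context: Manifolds are Hausdorff and have a countable basis. Negligible sets, measurable maps, locally integrable functions and weakly differentiable real functions on $M$ are defined through local charts; a local chart is a diffeomorphism from an open subset onto an open subset of Euclidean space. A map $u\colon M\to N$ is colocally weakly differentiable if $u$ is measurable and $f\circ u$ is weakly differentiable for every $f\in C^1_c(N,\mathbb{R})$. Its colocal weak derivative is the (existing and almost everywhere unique) measurable bundle morphism $Du\colon TM\to TN$ covering $u$ such that for every $f\in C^1_c(N,\mathbb{R})$, $D(f\circ u)=Df\circ Du$ almost everywhere in $M$. A sequence of measurable maps $u_\ell\colon M\to N$ converges locally in measure to a measurable map $u\colon M\to N$ if for every $x\in M$ there is a local chart $\psi\colon V\subseteq M\to\mathbb{R}^m$ with $x\in V$ such that for every open set $U\subseteq N$, $\lim_{\ell\to\infty}\mathcal{L}^m\bigl(\psi((u^{-1}(U)\cap V)\setminus u_\ell^{-1}(U))\bigr)=0$. For bundle morphisms $TM\to TN$ the same definition is used, viewing them as maps from $M$ to the manifold $T^*M\otimes TN$ (the bundle over $M\times N$ with fiber $\mathcal{L}(T_xM,T_yN)$ over $(x,y)$). A sequence $(\upsilon_\ell)$ of bundle morphisms $TM\to TN$ covering maps $u_\ell\colon M\to N$ is bilocally uniformly integrable if for every $x\in M$ and $y\in N$ there exist local charts $\psi\colon V\subseteq M\to\mathbb{R}^m$ and $\varphi\colon U\subseteq N\to\mathbb{R}^n$ with $x\in V$, $y\in U$, such that for every $\varepsilon>0$ there is $\delta>0$ such that for every measurable $W\subseteq\psi(V)$ with $\mathcal{L}^m(W)\le\delta$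 and every $\ell\in\mathbb{N}$, $$\int_{W\cap\psi(V\cap u_\ell^{-1}(U))}|D\varphi\circ\upsilon_\ell\circ D(\psi^{-1})|\le\varepsilon,$$ with $|\cdot|$ the Euclidean (Hilbert–Schmidt) norm on linear maps $\mathbb{R}^m\to\mathbb{R}^n$. *)

theory Defs
  imports "HOL-Analysis.Analysis"
begin

section \<open>Manifolds of class \<open>C\<^sup>1\<close>\<close>

text \<open>
  A manifold is a type of class \<open>{t2_space, second_countable_topology}\<close> together with a
  \<open>C\<^sup>1\<close> atlas modelled on \<open>real ^ 'm\<close>.  A chart is a pair of its domain \<open>V\<close>, an open set of points,
  and a function whose values outside \<open>V\<close> are irrelevant.
\<close>

type_synonym ('a, 'm) chart = "'a set \<times> ('a \<Rightarrow> real ^ 'm)"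

abbreviation chart_dom :: "('a, 'm::finite) chart \<Rightarrow> 'a set" where
  "chart_dom \<equiv> fst"

abbreviation chart_map :: "('a, 'm::finite) chart \<Rightarrow> 'a \<Rightarrow> real ^ 'm" where
  "chart_map \<equiv> snd"

abbreviation chart_image :: "('a, 'm::finite) chart \<Rightarrow> (real ^ 'm) set" where
  "chart_image c \<equiv> chart_map c ` chart_dom c"

abbreviation chart_inv :: "('a, 'm::finite) chart \<Rightarrow> real ^ 'm \<Rightarrow> 'a" where
  "chart_inv c \<equiv> inv_into (chart_dom c) (chart_map c)"

text \<open>Continuous differentiability on an open set.\<close>

definition C1_on :: "'x::real_normed_vector set \<Rightarrow> ('x \<Rightarrow> 'y::real_normed_vector) \<Rightarrow> bool" where
  "C1_on S f \<longleftrightarrow>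
     (\<exists>f'. (\<forall>x\<in>S. (f has_derivative blinfun_apply (f' x)) (at x)) \<and> continuous_on S f')"

definition topological_chart :: "('a::topological_space, 'm::finite) chart \<Rightarrow> bool" where
  "topological_chart c \<longleftrightarrow>
     open (chart_dom c) \<and> open (chart_image c) \<and>
     homeomorphism (chart_dom c) (chart_image c) (chart_map c) (chart_inv c)"

definition C1_compatible ::
  "('a, 'm::finite) chart \<Rightarrow> ('a, 'm) chart \<Rightarrow> bool" where
  "C1_compatible c d \<longleftrightarrow>
     C1_on (chart_map c ` (chart_dom c \<inter> chart_dom d)) (chart_map d \<circ> chart_inv c) \<and>
     C1_on (chart_map d ` (chart_dom c \<inter> chart_dom d)) (chart_map c \<circ> chart_inv d)"

definition C1_atlas :: "('a::topological_space, 'm::finite) chart set \<Rightarrow> bool" where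
  "C1_atlas A \<longleftrightarrow>
     (\<forall>c\<in>A. topological_chart c) \<and> (\<Union>c\<in>A. chart_dom c) = UNIV \<and>
     (\<forall>c\<in>A. \<forall>d\<in>A. C1_compatible c d)"

text \<open>
  The local charts, that is, the \<open>C\<^sup>1\<close>-diffeomorphisms from open sets of the manifold onto open sets
  of \<open>real ^ 'm\<close>, form the maximal atlas containing \<open>A\<close>.
\<close>

definition charts :: "('a::topological_space, 'm::finite) chart set \<Rightarrow> ('a, 'm) chart set" where
  "charts A = {c. topological_chart c \<and> (\<forall>d\<in>A. C1_compatible c d)}"

definition charts_at ::
  "('a::topological_space, 'm::finite) chart set \<Rightarrow> 'a \<Rightarrow> ('a, 'm) chart set" where
  "charts_at A x = {c \<in> charts A. x \<in> chart_dom c}"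

definition C1c_manifold :: "('a::topological_space, 'm::finite) chart set \<Rightarrow> ('a \<Rightarrow> real) set" where
  "C1c_manifold A =
     {f. (\<forall>c\<in>charts A. C1_on (chart_image c) (f \<circ> chart_inv c)) \<and>
         (\<exists>K. compact K \<and> (\<forall>x. x \<notin> K \<longrightarrow> f x = 0))}"


section \<open>Measurability\<close>

definition manifold_measurable_set ::
  "('a::topological_space, 'm::finite) chart set \<Rightarrow> 'a set \<Rightarrow> bool" where
  "manifold_measurable_set A E \<longleftrightarrow>
     (\<forall>c\<in>charts A. chart_map c ` (E \<inter> chart_dom c) \<in> sets lebesgue)"

definition manifold_negligible ::
  "('a::topological_space, 'm::finite) chart set \<Rightarrow> 'a set \<Rightarrow> bool" where
  "manifold_negligible A E \<longleftrightarrow>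
     (\<forall>c\<in>charts A. negligible (chart_map c ` (E \<inter> chart_dom c)))"

definition manifold_AE ::
  "('a::topological_space, 'm::finite) chart set \<Rightarrow> ('a \<Rightarrow> bool) \<Rightarrow> bool" where
  "manifold_AE A P \<longleftrightarrow> manifold_negligible A {x. \<not> P x}"

text \<open>
  The target space is an explicit topology, since the definition is used both for maps into a
  manifold (with \<open>euclidean\<close>, the topology of the type class) and for maps into the bundle
  \<open>hom_bundle\<close> below.
\<close>

definition manifold_measurable ::
  "('a::topological_space, 'm::finite) chart set \<Rightarrow> 'y topology \<Rightarrow> ('a \<Rightarrow> 'y) \<Rightarrow> bool" where
  "manifold_measurable A Y u \<longleftrightarrow>
     range u \<subseteq> topspace Y \<and> (\<forall>U. openin Y U \<longrightarrow> manifold_measurable_set A (u -` U))"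

definition converges_locally_in_measure ::
  "('a::topological_space, 'm::finite) chart set \<Rightarrow> 'y topology \<Rightarrow>
   (nat \<Rightarrow> 'a \<Rightarrow> 'y) \<Rightarrow> ('a \<Rightarrow> 'y) \<Rightarrow> bool" where
  "converges_locally_in_measure A Y us u \<longleftrightarrow>
     (\<forall>l. manifold_measurable A Y (us l)) \<and> manifold_measurable A Y u \<and>
     (\<forall>x. \<exists>c\<in>charts_at A x. \<forall>U. openin Y U \<longrightarrow>
        (\<lambda>l. emeasure lebesgue (chart_map c ` ((u -` U \<inter> chart_dom c) - us l -` U)))
          \<longlonglongrightarrow> 0)"


section \<open>Weak derivatives\<close>

text \<open>An element of \<open>C\<^sup>1\<^sub>c(\<Omega>)\<close> is identified with its extension by zero to the whole space.\<close>

definition C1c_vector_fields :: "(real ^ 'm::finite) set \<Rightarrow> (real ^ 'm \<Rightarrow> real ^ 'm) set" where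
  "C1c_vector_fields \<Omega> =
     {v. C1_on UNIV v \<and> (\<exists>K. compact K \<and> K \<subseteq> \<Omega> \<and> (\<forall>x. x \<notin> K \<longrightarrow> v x = 0))}"

definition divergence :: "(real ^ 'm::finite \<Rightarrow> real ^ 'm) \<Rightarrow> real ^ 'm \<Rightarrow> real" where
  "divergence v x = (\<Sum>i\<in>UNIV. frechet_derivative v (at x) (axis i 1) $ i)"

definition locally_integrable ::
  "(real ^ 'm::finite) set \<Rightarrow> (real ^ 'm \<Rightarrow> 'y::euclidean_space) \<Rightarrow> bool" where
  "locally_integrable \<Omega> g \<longleftrightarrow> (\<forall>K. compact K \<and> K \<subseteq> \<Omega> \<longrightarrow> g absolutely_integrable_on K)"

text \<open>
  The weak derivative at a point is a linear form on \<open>real ^ 'm\<close>; it is represented by a vector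
  through the standard inner product.
\<close>

definition has_weak_derivative ::
  "(real ^ 'm::finite) set \<Rightarrow> (real ^ 'm \<Rightarrow> real) \<Rightarrow> (real ^ 'm \<Rightarrow> real ^ 'm) \<Rightarrow> bool" where
  "has_weak_derivative \<Omega> g h \<longleftrightarrow>
     locally_integrable \<Omega> g \<and> locally_integrable \<Omega> h \<and>
     (\<forall>v\<in>C1c_vector_fields \<Omega>.
        (LINT x:\<Omega>|lebesgue. g x * divergence v x) = - (LINT x:\<Omega>|lebesgue. h x \<bullet> v x))"

definition weakly_differentiable :: "(real ^ 'm::finite) set \<Rightarrow> (real ^ 'm \<Rightarrow> real) \<Rightarrow> bool" where
  "weakly_differentiable \<Omega> g \<longleftrightarrow> (\<exists>h. has_weak_derivative \<Omega> g h)"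

text \<open>Some representative of the almost everywhere unique weak derivative.\<close>

definition weak_derivative ::
  "(real ^ 'm::finite) set \<Rightarrow> (real ^ 'm \<Rightarrow> real) \<Rightarrow> real ^ 'm \<Rightarrow> real ^ 'm" where
  "weak_derivative \<Omega> g = (SOME h. has_weak_derivative \<Omega> g h)"

definition manifold_weakly_differentiable ::
  "('a::topological_space, 'm::finite) chart set \<Rightarrow> ('a \<Rightarrow> real) \<Rightarrow> bool" where
  "manifold_weakly_differentiable A g \<longleftrightarrow>
     (\<forall>c\<in>charts A. weakly_differentiable (chart_image c) (g \<circ> chart_inv c))"

definition colocally_weakly_differentiable ::
  "('a::topological_space, 'm::finite) chart set \<Rightarrow>
   ('b::topological_space, 'n::finite) chart set \<Rightarrow> ('a \<Rightarrow> 'b) \<Rightarrow> bool" where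
  "colocally_weakly_differentiable A B u \<longleftrightarrow>
     manifold_measurable A euclidean u \<and>
     (\<forall>f\<in>C1c_manifold B. manifold_weakly_differentiable A (f \<circ> u))"


section \<open>Tangent spaces and bundle morphisms\<close>

text \<open>
  A tangent vector at \<open>x\<close> is the family of its coordinate vectors in the charts around \<open>x\<close>; these
  are related by the derivatives of the coordinate changes.  The value at all other charts is
  normalised to \<open>0\<close>, and the vector space operations are pointwise.  Hence the differential at \<open>x\<close>
  of a chart \<open>c\<close> around \<open>x\<close> is \<open>\<lambda>t. t c\<close>, and \<open>chart_inv_deriv A c x\<close> is the differential of the
  inverse of \<open>c\<close> at the image of \<open>x\<close>.
\<close>

type_synonym ('a, 'm) tangent = "('a, 'm) chart \<Rightarrow> real ^ 'm"

definition transition_deriv ::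
  "('a, 'm::finite) chart \<Rightarrow> ('a, 'm) chart \<Rightarrow> 'a \<Rightarrow> real ^ 'm \<Rightarrow> real ^ 'm" where
  "transition_deriv c d x = frechet_derivative (chart_map d \<circ> chart_inv c) (at (chart_map c x))"

definition tangent_space ::
  "('a::topological_space, 'm::finite) chart set \<Rightarrow> 'a \<Rightarrow> ('a, 'm) tangent set" where
  "tangent_space A x =
     {t. (\<forall>c\<in>charts_at A x. \<forall>d\<in>charts_at A x. t d = transition_deriv c d x (t c)) \<and>
         (\<forall>c. c \<notin> charts_at A x \<longrightarrow> t c = 0)}"

definition chart_inv_deriv ::
  "('a::topological_space, 'm::finite) chart set \<Rightarrow> ('a, 'm) chart \<Rightarrow> 'a \<Rightarrow>
   real ^ 'm \<Rightarrow> ('a, 'm) tangent" where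
  "chart_inv_deriv A c x w = (\<lambda>d. if d \<in> charts_at A x then transition_deriv c d x w else 0)"

text \<open>The differential of a \<open>C\<^sup>1\<close> function, which does not depend on the chosen chart.\<close>

definition manifold_deriv ::
  "('a::topological_space, 'm::finite) chart set \<Rightarrow> ('a \<Rightarrow> real) \<Rightarrow> 'a \<Rightarrow>
   ('a, 'm) tangent \<Rightarrow> real" where
  "manifold_deriv A f x t =
     (let c = (SOME c. c \<in> charts_at A x)
      in frechet_derivative (f \<circ> chart_inv c) (at (chart_map c x)) (t c))"

text \<open>
  The linear maps between two tangent spaces.  They are normalised to be \<open>undefined\<close> outside of the
  tangent space, so that equality of functions is equality of linear maps.
\<close>

definition tangent_hom ::
  "('a::topological_space, 'm::finite) chart set \<Rightarrow>
   ('b::topological_space, 'n::finite) chart set \<Rightarrow> 'a \<Rightarrow> 'b \<Rightarrow>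
   (('a, 'm) tangent \<Rightarrow> ('b, 'n) tangent) set" where
  "tangent_hom A B x y =
     {L \<in> tangent_space A x \<rightarrow>\<^sub>E tangent_space B y.
        \<forall>s\<in>tangent_space A x. \<forall>t\<in>tangent_space A x. \<forall>a b.
          L (\<lambda>c. a *\<^sub>R s c + b *\<^sub>R t c) = (\<lambda>d. a *\<^sub>R L s d + b *\<^sub>R L t d)}"

text \<open>
  A map between the tangent bundles that covers \<open>u\<close> and is linear in the fibres is represented by
  the family \<open>\<upsilon>\<close> of its fibre maps; on pairs of a point and a tangent vector it is
  \<open>\<lambda>(x, t). (u x, \<upsilon> x t)\<close>.  Neither continuity nor measurability is part of the notion.
\<close>

definition bundle_morphism ::
  "('a::topological_space, 'm::finite) chart set \<Rightarrow>
   ('b::topological_space, 'n::finite) chart set \<Rightarrow> ('a \<Rightarrow> 'b) \<Rightarrow>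
   ('a \<Rightarrow> ('a, 'm) tangent \<Rightarrow> ('b, 'n) tangent) \<Rightarrow> bool" where
  "bundle_morphism A B u \<upsilon> \<longleftrightarrow> (\<forall>x. \<upsilon> x \<in> tangent_hom A B x (u x))"

text \<open>
  The bundle \<open>T\<^sup>*M \<otimes> TN\<close> over \<open>M \<times> N\<close>, whose points are the triples \<open>(x, y, L)\<close> with \<open>L\<close> a linear map
  between the tangent spaces at \<open>x\<close> and \<open>y\<close>.  Charts \<open>c\<close> of \<open>M\<close> and \<open>d\<close> of \<open>N\<close> induce a chart of
  the bundle, with inverse \<open>hom_chart_inv A B c d\<close>; a set is open when it is open in all of these.
\<close>

definition hom_chart_inv ::
  "('a::topological_space, 'm::finite) chart set \<Rightarrow>
   ('b::topological_space, 'n::finite) chart set \<Rightarrow> ('a, 'm) chart \<Rightarrow> ('b, 'n) chart \<Rightarrow>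
   (real ^ 'm) \<times> (real ^ 'n) \<times> (real ^ 'm ^ 'n) \<Rightarrow>
   'a \<times> 'b \<times> (('a, 'm) tangent \<Rightarrow> ('b, 'n) tangent)" where
  "hom_chart_inv A B c d = (\<lambda>(p, q, Q).
     (chart_inv c p, chart_inv d q,
      \<lambda>t\<in>tangent_space A (chart_inv c p). chart_inv_deriv B d (chart_inv d q) (Q *v t c)))"

definition hom_bundle_open ::
  "('a::topological_space, 'm::finite) chart set \<Rightarrow>
   ('b::topological_space, 'n::finite) chart set \<Rightarrow>
   ('a \<times> 'b \<times> (('a, 'm) tangent \<Rightarrow> ('b, 'n) tangent)) set \<Rightarrow> bool" where
  "hom_bundle_open A B W \<longleftrightarrow>
     W \<subseteq> {(x, y, L). L \<in> tangent_hom A B x y} \<and>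
     (\<forall>c\<in>charts A. \<forall>d\<in>charts B.
        open {z \<in> chart_image c \<times> chart_image d \<times> UNIV. hom_chart_inv A B c d z \<in> W})"

definition hom_bundle ::
  "('a::topological_space, 'm::finite) chart set \<Rightarrow>
   ('b::topological_space, 'n::finite) chart set \<Rightarrow>
   ('a \<times> 'b \<times> (('a, 'm) tangent \<Rightarrow> ('b, 'n) tangent)) topology" where
  "hom_bundle A B = topology (hom_bundle_open A B)"

lemma openin_hom_bundle:
  fixes A :: "('a::topological_space, 'm::finite) chart set"
    and B :: "('b::topological_space, 'n::finite) chart set"
  shows "openin (hom_bundle A B) = hom_bundle_open A B"
proof -
  have "istopology (hom_bundle_open A B)"
    unfolding istopology_def
  proof (intro conjI allI impI)
    fix S T assume S: "hom_bundle_open A B S" and T: "hom_bundle_open A B T"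
    have "{z \<in> D. F z \<in> S \<inter> T} = {z \<in> D. F z \<in> S} \<inter> {z \<in> D. F z \<in> T}"
      for D and F :: "(real ^ 'm) \<times> (real ^ 'n) \<times> (real ^ 'm ^ 'n) \<Rightarrow> _" by auto
    then show "hom_bundle_open A B (S \<inter> T)"
      using S T unfolding hom_bundle_open_def by (simp add: open_Int le_infI1)
  next
    fix \<K> assume K: "\<forall>S\<in>\<K>. hom_bundle_open A B S"
    have eq: "{z \<in> D. F z \<in> \<Union>\<K>} = (\<Union>S\<in>\<K>. {z \<in> D. F z \<in> S})"
      for D and F :: "(real ^ 'm) \<times> (real ^ 'n) \<times> (real ^ 'm ^ 'n) \<Rightarrow> _" by auto
    show "hom_bundle_open A B (\<Union>\<K>)"
      unfolding hom_bundle_open_def eq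
    proof (intro conjI ballI open_UN Sup_least)
      fix S assume "S \<in> \<K>"
      with K have "hom_bundle_open A B S" by (rule bspec)
      then show "S \<subseteq> {(x, y, L). L \<in> tangent_hom A B x y}"
        unfolding hom_bundle_open_def by (rule conjunct1)
    next
      fix c d S assume c: "c \<in> charts A" and d: "d \<in> charts B" and S: "S \<in> \<K>"
      from K S have "hom_bundle_open A B S" by (rule bspec)
      then show "open {z \<in> chart_image c \<times> chart_image d \<times> UNIV. hom_chart_inv A B c d z \<in> S}"
        unfolding hom_bundle_open_def by (rule conjunct2[THEN bspec, OF _ c, THEN bspec, OF _ d])
    qed
  qed
  then show ?thesis
    unfolding hom_bundle_def by (rule topology_inverse')
qed

text \<open>The map from \<open>M\<close> into this bundle that corresponds to a bundle morphism.\<close>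

definition hom_section ::
  "('a \<Rightarrow> 'b) \<Rightarrow> ('a \<Rightarrow> ('a, 'm::finite) tangent \<Rightarrow> ('b, 'n::finite) tangent) \<Rightarrow>
   'a \<Rightarrow> 'a \<times> 'b \<times> (('a, 'm) tangent \<Rightarrow> ('b, 'n) tangent)" where
  "hom_section u \<upsilon> x = (x, u x, \<upsilon> x)"

definition measurable_bundle_morphism ::
  "('a::topological_space, 'm::finite) chart set \<Rightarrow>
   ('b::topological_space, 'n::finite) chart set \<Rightarrow> ('a \<Rightarrow> 'b) \<Rightarrow>
   ('a \<Rightarrow> ('a, 'm) tangent \<Rightarrow> ('b, 'n) tangent) \<Rightarrow> bool" where
  "measurable_bundle_morphism A B u \<upsilon> \<longleftrightarrow>
     bundle_morphism A B u \<upsilon> \<and> manifold_measurable A (hom_bundle A B) (hom_section u \<upsilon>)"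

text \<open>
  In the last condition \<open>D(f \<circ> u) = Df \<circ> Du\<close> almost everywhere is expressed in each chart \<open>c\<close> of the
  domain, by evaluating both sides at the tangent vector with coordinate vector \<open>w\<close>.
\<close>

definition colocal_weak_derivative ::
  "('a::topological_space, 'm::finite) chart set \<Rightarrow>
   ('b::topological_space, 'n::finite) chart set \<Rightarrow> ('a \<Rightarrow> 'b) \<Rightarrow>
   ('a \<Rightarrow> ('a, 'm) tangent \<Rightarrow> ('b, 'n) tangent) \<Rightarrow> bool" where
  "colocal_weak_derivative A B u Du \<longleftrightarrow>
     colocally_weakly_differentiable A B u \<and> measurable_bundle_morphism A B u Du \<and>
     (\<forall>f\<in>C1c_manifold B. \<forall>c\<in>charts A. AE p in lebesgue_on (chart_image c).
        \<forall>w. weak_derivative (chart_image c) (f \<circ> u \<circ> chart_inv c) p \<bullet> w =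
            manifold_deriv B f (u (chart_inv c p))
              (Du (chart_inv c p) (chart_inv_deriv A c (chart_inv c p) w)))"

text \<open>
  The matrix of a fibre map in the charts \<open>c\<close> and \<open>d\<close>.  The norm of \<open>real ^ 'm ^ 'n\<close> is the
  Hilbert-Schmidt norm.
\<close>

definition local_matrix ::
  "('a::topological_space, 'm::finite) chart set \<Rightarrow> ('a, 'm) chart \<Rightarrow> ('b, 'n::finite) chart \<Rightarrow>
   ('a \<Rightarrow> ('a, 'm) tangent \<Rightarrow> ('b, 'n) tangent) \<Rightarrow> real ^ 'm \<Rightarrow> real ^ 'm ^ 'n" where
  "local_matrix A c d \<upsilon> p =
     matrix (\<lambda>w. \<upsilon> (chart_inv c p) (chart_inv_deriv A c (chart_inv c p) w) d)"

definition bilocally_uniformly_integrable ::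
  "('a::topological_space, 'm::finite) chart set \<Rightarrow>
   ('b::topological_space, 'n::finite) chart set \<Rightarrow> (nat \<Rightarrow> 'a \<Rightarrow> 'b) \<Rightarrow>
   (nat \<Rightarrow> 'a \<Rightarrow> ('a, 'm) tangent \<Rightarrow> ('b, 'n) tangent) \<Rightarrow> bool" where
  "bilocally_uniformly_integrable A B u \<upsilon> \<longleftrightarrow>
     (\<forall>l. bundle_morphism A B (u l) (\<upsilon> l)) \<and>
     (\<forall>x y. \<exists>c\<in>charts_at A x. \<exists>d\<in>charts_at B y. \<forall>\<epsilon>>0. \<exists>\<delta>>0.
        \<forall>W\<in>sets lebesgue. W \<subseteq> chart_image c \<and> emeasure lebesgue W \<le> ennreal \<delta> \<longrightarrow>
          (\<forall>l. (\<integral>\<^sup>+p\<in>W \<inter> chart_map c ` (chart_dom c \<inter> u l -` chart_dom d).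
                  ennreal (norm (local_matrix A c d (\<upsilon> l) p)) \<partial>lebesgue) \<le> ennreal \<epsilon>))"

end

theory Submission
  imports Defs
begin

text \<open>
  In a chart the functions \<open>f \<circ> u\<^sub>l\<close> are bounded and converge locally in measure, so their integrals
  against divergences of test fields converge.  Their weak derivatives \<open>Df \<circ> Du\<^sub>l\<close> are uniformly
  integrable on every compact set: the support of \<open>f\<close> is covered by finitely many charts of the
  target, and changes of charts are locally bi-Lipschitz, hence distort Lebesgue measure by bounded
  factors.  A Dunford-Pettis argument then provides a weak limit, which must be the weak derivative of
  \<open>f \<circ> u\<close>.  When \<open>Du\<^sub>l\<close> converges in measure to \<open>\<upsilon>\<close>, so does \<open>Df \<circ> Du\<^sub>l\<close> to \<open>Df \<circ> \<upsilon>\<close>, because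
  \<open>Df\<close> induces a continuous function on the bundle; a limit in measure of a uniformly integrable
  sequence coincides with its weak limit.  Finally \<open>Du\<close> is determined by \<open>Df \<circ> Du\<close> for countably many
  functions \<open>f\<close> that equal local coordinates on small sets.
\<close>


section \<open>Functions of class \<open>C\<^sup>1\<close>\<close>

text \<open>In the definition of bilocal uniform integrability the two charts depend on the pair of
  points, so it says something about a compact subset of \<open>M\<close> only after two compactness
  arguments: at a fixed point of \<open>M\<close> finitely many charts of \<open>N\<close> suffice
  because \<open>f\<close> has compact support, and then finitely many points of \<open>M\<close>
  suffice. The weak limit serves to produce a derivative and to identify it; the convergence of the
  integrals against test fields holds for the whole sequence by integration by parts, whatever
  filter produced the limit. A bundle morphism \<open>Du\<close> over \<open>u\<close> is
  constructed only at the end, out of \<open>\<upsilon>\<close>. There \<open>\<upsilon>\<close>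
  covers a map \<open>w\<close> of its own, which equals \<open>u\<close> only almost everywhere,
  since limits in measure are unique only up to null sets. Each \<open>weak_derivative\<close> is an
  arbitrary representative; uniqueness and congruence almost everywhere are what connect it with the
  pointwise expression \<open>Df \<circ> Du\<close>.\<close>

lemma C1_on_has_derivative:
  assumes "C1_on S f" "x \<in> S"
  shows "(f has_derivative frechet_derivative f (at x)) (at x)"
  using assms unfolding C1_on_def frechet_derivative_works[symmetric] differentiable_def by blast

text \<open>The derivative that \<open>C1_on\<close> asks for is forced to be the Frechet
  derivative. With this canonical choice continuity can be checked near each point and local pieces
  glue without matching choices.\<close>

lemma C1_on_iff:
  "C1_on S f \<longleftrightarrow> (\<forall>x\<in>S. f differentiable (at x)) \<and>
     continuous_on S (\<lambda>x. Blinfun (frechet_derivative f (at x)))"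
proof
  assume "C1_on S f"
  then obtain f' where f': "\<And>x. x \<in> S \<Longrightarrow> (f has_derivative blinfun_apply (f' x)) (at x)"
    and c: "continuous_on S f'" unfolding C1_on_def by blast
  have "Blinfun (frechet_derivative f (at x)) = f' x" if "x \<in> S" for x
    using frechet_derivative_at[OF f'[OF that]] by (metis blinfun_apply_inverse)
  with c have "continuous_on S (\<lambda>x. Blinfun (frechet_derivative f (at x)))"
    by (simp cong: continuous_on_cong)
  with f' show "(\<forall>x\<in>S. f differentiable (at x)) \<and>
     continuous_on S (\<lambda>x. Blinfun (frechet_derivative f (at x)))"
    by (auto simp: differentiable_def)
next
  assume r: "(\<forall>x\<in>S. f differentiable (at x)) \<and>
     continuous_on S (\<lambda>x. Blinfun (frechet_derivative f (at x)))"
  have "(f has_derivative blinfun_apply (Blinfun (frechet_derivative f (at x)))) (at x)"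
    if "x \<in> S" for x
  proof -
    have "(f has_derivative frechet_derivative f (at x)) (at x)"
      using r that frechet_derivative_works by blast
    then show ?thesis
      by (simp add: bounded_linear_Blinfun_apply has_derivative_bounded_linear)
  qed
  then show "C1_on S f" unfolding C1_on_def using r
    by (intro exI[of _ "\<lambda>x. Blinfun (frechet_derivative f (at x))"]) auto
qed

lemma C1_on_subset: "C1_on S f \<Longrightarrow> T \<subseteq> S \<Longrightarrow> C1_on T f"
  unfolding C1_on_iff by (auto elim: continuous_on_subset)

lemma C1_on_continuous_on: "C1_on S f \<Longrightarrow> continuous_on S f"
  unfolding C1_on_def
  by (blast intro: continuous_at_imp_continuous_on has_derivative_continuous)

lemma C1_on_local:
  assumes "\<And>x. x \<in> S \<Longrightarrow> \<exists>T. open T \<and> x \<in> T \<and> C1_on T f"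
  shows "C1_on S f"
  unfolding C1_on_iff
proof (intro conjI ballI)
  show "f differentiable at x" if "x \<in> S" for x
  proof -
    obtain T where "open T" "x \<in> T" "C1_on T f" using assms[OF \<open>x \<in> S\<close>] by blast
    then show ?thesis unfolding C1_on_iff by simp
  qed
  show "continuous_on S (\<lambda>x. Blinfun (frechet_derivative f (at x)))"
  proof (rule continuous_at_imp_continuous_on, rule ballI)
    fix x assume "x \<in> S"
    then obtain T where "open T" "x \<in> T" "C1_on T f" using assms by blast
    then show "isCont (\<lambda>x. Blinfun (frechet_derivative f (at x))) x"
      unfolding C1_on_iff by (simp add: continuous_on_eq_continuous_at)
  qed
qed

lemma C1_on_cong:
  assumes "C1_on S f" "open S" "\<And>x. x \<in> S \<Longrightarrow> f x = g x"
  shows "C1_on S g"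
proof -
  obtain f' where f': "\<And>x. x \<in> S \<Longrightarrow> (f has_derivative blinfun_apply (f' x)) (at x)"
    and c: "continuous_on S f'" using assms(1) unfolding C1_on_def by blast
  have "(g has_derivative blinfun_apply (f' x)) (at x)" if "x \<in> S" for x
    by (rule has_derivative_transform_within_open[OF f'[OF that] assms(2) that assms(3)])
  with c show ?thesis unfolding C1_on_def by blast
qed

lemma C1_on_compose:
  assumes "C1_on S f" "C1_on T g" "f ` S \<subseteq> T"
  shows "C1_on S (g \<circ> f)"
proof -
  obtain f' where f': "\<And>x. x \<in> S \<Longrightarrow> (f has_derivative blinfun_apply (f' x)) (at x)"
    and cf: "continuous_on S f'" using assms(1) unfolding C1_on_def by blast
  obtain g' where g': "\<And>x. x \<in> T \<Longrightarrow> (g has_derivative blinfun_apply (g' x)) (at x)"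
    and cg: "continuous_on T g'" using assms(2) unfolding C1_on_def by blast
  have "(g \<circ> f has_derivative blinfun_apply (g' (f x) o\<^sub>L f' x)) (at x)" if "x \<in> S" for x
  proof -
    have "f x \<in> T" using that assms(3) by blast
    then show ?thesis
      unfolding blinfun_compose.rep_eq by (intro diff_chain_at f'[OF that] g')
  qed
  moreover have "continuous_on S (\<lambda>x. g' (f x) o\<^sub>L f' x)"
    by (rule bounded_bilinear.continuous_on[OF bounded_bilinear_blinfun_compose
          continuous_on_compose2[OF cg C1_on_continuous_on[OF assms(1)] assms(3)] cf])
  ultimately show ?thesis unfolding C1_on_def by (intro exI[of _ "\<lambda>x. g' (f x) o\<^sub>L f' x"]) blast
qed

lemma C1_on_const: "C1_on S (\<lambda>x. k)"
proof -
  have "((\<lambda>x. k) has_derivative blinfun_apply 0) (at x)" for x :: 'a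
    using has_derivative_const[of k "at x"] by (simp add: zero_blinfun.rep_eq)
  then show ?thesis unfolding C1_on_def by (intro exI[of _ "\<lambda>x. 0"]) simp
qed

lemma C1_on_linear: "bounded_linear f \<Longrightarrow> C1_on S f"
  unfolding C1_on_def
  by (intro exI[of _ "\<lambda>x. Blinfun f"])
     (auto simp: bounded_linear_Blinfun_apply bounded_linear_imp_has_derivative)

lemma C1_on_scaleR:
  fixes f :: "'x::real_normed_vector \<Rightarrow> real" and g :: "'x \<Rightarrow> 'y::real_normed_vector"
  assumes "C1_on S f" "C1_on S g"
  shows "C1_on S (\<lambda>x. f x *\<^sub>R g x)"
proof -
  obtain f' where f': "\<And>x. x \<in> S \<Longrightarrow> (f has_derivative blinfun_apply (f' x)) (at x)"
    and cf: "continuous_on S f'" using assms(1) unfolding C1_on_def by blast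
  obtain g' where g': "\<And>x. x \<in> S \<Longrightarrow> (g has_derivative blinfun_apply (g' x)) (at x)"
    and cg: "continuous_on S g'" using assms(2) unfolding C1_on_def by blast
  let ?h = "\<lambda>x. f x *\<^sub>R g' x + (blinfun_scaleR_left (g x) o\<^sub>L f' x)"
  have "((\<lambda>x. f x *\<^sub>R g x) has_derivative blinfun_apply (?h x)) (at x)" if "x \<in> S" for x
    by (rule has_derivative_eq_rhs[OF has_derivative_scaleR[OF f'[OF that] g'[OF that]]])
       (simp add: fun_eq_iff blinfun.bilinear_simps)
  moreover have "continuous_on S ?h"
    by (intro continuous_on_add continuous_on_scaleR cg C1_on_continuous_on[OF assms(1)]
        bounded_bilinear.continuous_on[OF bounded_bilinear_blinfun_compose] cf
        bounded_linear.continuous_on[OF bounded_linear_blinfun_scaleR_left] C1_on_continuous_on[OF assms(2)])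
  ultimately show ?thesis unfolding C1_on_def by (intro exI[of _ ?h]) blast
qed

lemma C1_on_add:
  assumes "C1_on S f" "C1_on S g"
  shows "C1_on S (\<lambda>x. f x + g x)"
proof -
  obtain f' where f': "\<And>x. x \<in> S \<Longrightarrow> (f has_derivative blinfun_apply (f' x)) (at x)"
    and cf: "continuous_on S f'" using assms(1) unfolding C1_on_def by blast
  obtain g' where g': "\<And>x. x \<in> S \<Longrightarrow> (g has_derivative blinfun_apply (g' x)) (at x)"
    and cg: "continuous_on S g'" using assms(2) unfolding C1_on_def by blast
  have "((\<lambda>x. f x + g x) has_derivative blinfun_apply (f' x + g' x)) (at x)" if "x \<in> S" for x
    by (rule has_derivative_eq_rhs[OF has_derivative_add[OF f'[OF that] g'[OF that]]])
       (simp add: fun_eq_iff blinfun.bilinear_simps)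
  moreover have "continuous_on S (\<lambda>x. f' x + g' x)"
    using cf cg by (intro continuous_intros)
  ultimately show ?thesis unfolding C1_on_def by (intro exI[of _ "\<lambda>x. f' x + g' x"]) blast
qed

text \<open>By continuity the operator norm of the derivative stays below its value at
  \<open>x\<close> plus 1 on a small ball; the ball is convex, so the mean value inequality turns
  this into a Lipschitz bound. The bound on the derivative is kept as well, since covectors
  transform by it.\<close>

lemma C1_on_locally_lipschitz:
  assumes "C1_on S f" "open S" "x \<in> S"
  obtains r L where "0 < r" "0 < L" "ball x r \<subseteq> S"
    "\<And>y w. y \<in> ball x r \<Longrightarrow> norm (frechet_derivative f (at y) w) \<le> L * norm w"
    "\<And>y z. y \<in> ball x r \<Longrightarrow> z \<in> ball x r \<Longrightarrow> norm (f y - f z) \<le> L * norm (y - z)"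
proof -
  obtain f' where f': "\<And>x. x \<in> S \<Longrightarrow> (f has_derivative blinfun_apply (f' x)) (at x)"
    and cf: "continuous_on S f'" using assms(1) unfolding C1_on_def by blast
  have "continuous (at x) f'"
    using cf assms by (simp add: continuous_on_eq_continuous_at)
  then obtain d where d: "d > 0" "\<And>y. dist y x < d \<Longrightarrow> dist (f' y) (f' x) < 1"
    unfolding continuous_at_eps_delta by (meson zero_less_one)
  obtain e where e: "e > 0" "ball x e \<subseteq> S" using assms openE by blast
  define r where "r = min d e"
  define L where "L = norm (f' x) + 1"
  have fr: "frechet_derivative f (at y) = blinfun_apply (f' y)" if "y \<in> S" for y
    using frechet_derivative_at[OF f'[OF that]] by simp
  have b: "norm (f' y) \<le> L" if "y \<in> ball x r" for y
  proof -
    have "norm (f' y - f' x) < 1"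
      using that d(2)[of y] by (simp add: r_def dist_commute dist_norm[symmetric])
    then show ?thesis unfolding L_def using norm_triangle_sub[of "f' y" "f' x"] by simp
  qed
  show thesis
  proof
    show "0 < r" using d e unfolding r_def by auto
    show "0 < L" unfolding L_def by (simp add: add_nonneg_pos)
    show sub: "ball x r \<subseteq> S" using e unfolding r_def by auto
    show "norm (frechet_derivative f (at y) w) \<le> L * norm w" if "y \<in> ball x r" for y w
    proof -
      have "norm (blinfun_apply (f' y) w) \<le> norm (f' y) * norm w" by (rule norm_blinfun)
      also have "\<dots> \<le> L * norm w" by (intro mult_right_mono b[OF that]) simp
      finally show ?thesis using fr[of y] that sub by auto
    qed
    show "norm (f y - f z) \<le> L * norm (y - z)" if "y \<in> ball x r" "z \<in> ball x r" for y z
    proof (rule differentiable_bound[of "ball x r" f "\<lambda>x. blinfun_apply (f' x)"])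
      show "(f has_derivative blinfun_apply (f' a)) (at a within ball x r)" if "a \<in> ball x r" for a
        using f' that sub has_derivative_at_withinI by blast
      show "onorm (blinfun_apply (f' a)) \<le> L" if "a \<in> ball x r" for a
        using b[OF that] by (simp add: norm_blinfun.rep_eq)
    qed (use that in auto)
  qed
qed


section \<open>Lipschitz maps and Lebesgue measure\<close>

text \<open>
  A Vitali covering by balls centred in \<open>E\<close> gives the bound without determinants; the change of variables
  theorems of the library need a well-ordered index type.
\<close>

lemma lipschitz_image_lebesgue:
  fixes f :: "'x::euclidean_space \<Rightarrow> 'x"
  assumes lip: "\<And>x y. x \<in> E \<Longrightarrow> y \<in> E \<Longrightarrow> norm (f x - f y) \<le> L * norm (x - y)"
    and E: "E \<in> sets lebesgue" and L: "0 < L"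
  shows "f ` E \<in> sets lebesgue \<and> emeasure lebesgue (f ` E) \<le> ennreal (L ^ DIM('x)) * emeasure lebesgue E"
proof -
  have neg: "negligible (f ` N)" if "negligible N" "N \<subseteq> E" for N
  proof (rule negligible_locally_Lipschitz_image[OF _ that(1)])
    fix x assume x: "x \<in> N"
    have "\<forall>y\<in>N \<inter> UNIV. norm (f y - f x) \<le> L * norm (y - x)"
      using lip x that(2) by blast
    then show "\<exists>T B. open T \<and> x \<in> T \<and> (\<forall>y\<in>N \<inter> T. norm (f y - f x) \<le> B * norm (y - x))"
      using open_UNIV by blast
  qed simp
  have cont: "continuous_on E f"
  proof (rule lipschitz_on_continuous_on)
    show "L-lipschitz_on E f"
      by (rule lipschitz_onI) (use lip L in \<open>simp_all add: dist_norm\<close>)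
  qed
  have meas: "f ` E \<in> sets lebesgue"
  proof -
    \<comment> \<open>A Lipschitz image of an arbitrary measurable set is handled in two pieces: the
      countable union of compact sets has compact images, and the null remainder has a null
      image.\<close>
    obtain C T where CT: "fsigma C" "T \<in> null_sets lebesgue" "C \<union> T = E" "disjnt C T"
      by (rule lebesgue_set_almost_fsigma[OF E])
    obtain F :: "nat \<Rightarrow> _" where F: "range F \<subseteq> Collect compact" "C = \<Union>(range F)"
      using CT(1) unfolding fsigma_Union_compact by metis
    have "f ` E = (\<Union>n. f ` F n) \<union> f ` T"
      using F CT(3) by auto
    moreover have "f ` F n \<in> sets lebesgue" for n
    proof -
      have "compact (f ` F n)"
        using F CT(3) by (intro compact_continuous_image continuous_on_subset[OF cont]) auto
      then show ?thesis by (simp add: lmeasurable_compact fmeasurableD)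
    qed
    moreover have "f ` T \<in> sets lebesgue"
      using neg[of T] CT by (auto simp: negligible_iff_null_sets)
    ultimately show ?thesis by auto
  qed
  moreover have "emeasure lebesgue (f ` E) \<le> ennreal (L ^ DIM('x)) * emeasure lebesgue E"
  proof (rule ennreal_le_epsilon)
    fix e :: real assume e: "0 < e" 
    let ?d = "DIM('x)"
    define e' where "e' = e / L ^ ?d"
    have e': "e' > 0" using e L unfolding e'_def by simp
    obtain T where T: "open T" "E \<subseteq> T" "(T - E) \<in> lmeasurable" "emeasure lebesgue (T - E) < ennreal e'"
      by (rule sets_lebesgue_outer_open[OF E e'])
    define K where "K = {(x::'x, r::real). x \<in> E \<and> 0 < r \<and> ball x r \<subseteq> T}"
    have "\<exists>i. i \<in> K \<and> x \<in> ball (fst i) (snd i) \<and> snd i < d" if "x \<in> E" "0 < d" for x d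
    proof -
      obtain s where s: "s > 0" "ball x s \<subseteq> T" using T(1,2) \<open>x \<in> E\<close> by (meson openE subsetD)
      show ?thesis
        by (rule exI[of _ "(x, min s (d/2))"]) (use s that in \<open>auto simp: K_def\<close>)
    qed
    then obtain C where C: "countable C" "C \<subseteq> K"
      "pairwise (\<lambda>i j. disjnt (ball (fst i) (snd i)) (ball (fst j) (snd j))) C"
      "negligible (E - (\<Union>i\<in>C. ball (fst i) (snd i)))"
      by (rule Vitali_covering_theorem_balls[of E K fst snd])
    let ?N = "E - (\<Union>i\<in>C. ball (fst i) (snd i))"
    let ?B = "\<lambda>i. ball (f (fst i)) (L * snd i) :: 'x set"
    \<comment> \<open>Because the centre lies in \<open>E\<close>, the part of \<open>E\<close>
      inside a ball of radius \<open>r\<close> is mapped into a closed ball of radius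
      \<open>L * r\<close>, whose measure is exactly \<open>L ^ DIM('x)\<close> times that of the
      original ball.\<close>
    let ?B' = "\<lambda>i. cball (f (fst i)) (L * snd i) :: 'x set"
    have sub: "f ` E \<subseteq> f ` ?N \<union> (\<Union>i\<in>C. ?B' i)"
    proof
      fix y assume "y \<in> f ` E"
      then obtain x where x: "x \<in> E" "y = f x" by auto
      show "y \<in> f ` ?N \<union> (\<Union>i\<in>C. ?B' i)"
      proof (cases "x \<in> ?N")
        case False
        then obtain i where i: "i \<in> C" "x \<in> ball (fst i) (snd i)" using x by auto
        have "fst i \<in> E" using i C by (auto simp: K_def)
        then have "norm (f (fst i) - f x) \<le> L * norm (fst i - x)" using lip x by blast
        also have "\<dots> \<le> L * snd i" using i L by (auto simp: dist_norm)
        finally show ?thesis using i x by (auto simp: dist_norm)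
      qed (use x in auto)
    qed
    have null: "f ` ?N \<in> null_sets lebesgue"
      using neg[OF C(4)] by (auto simp: negligible_iff_null_sets)
    define I where "I = to_nat_on C ` C"
    define g where "g n = from_nat_into C n" for n
    define P where "P n = (if n \<in> I then ball (fst (g n)) (snd (g n)) else {})" for n
    define Q where "Q n = (if n \<in> I then ?B' (g n) else {})" for n
    have g: "g n \<in> C" if "n \<in> I" for n
      using that C(1) unfolding I_def g_def by auto
    have gto: "g (to_nat_on C i) = i" if "i \<in> C" for i
      using that C(1) unfolding g_def by simp
    have ginj: "n = k" if "n \<in> I" "k \<in> I" "g n = g k" for n k
      using that C(1) unfolding I_def g_def by auto
    have UB: "(\<Union>i\<in>C. ?B' i) \<subseteq> (\<Union>n. Q n)"
    proof (intro UN_least)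
      fix i assume "i \<in> C"
      then have "?B' i = Q (to_nat_on C i)" using gto by (simp add: Q_def I_def)
      then show "?B' i \<subseteq> (\<Union>n. Q n)" by blast
    qed
    have "emeasure lebesgue (f ` E) \<le> emeasure lebesgue (f ` ?N \<union> (\<Union>n. Q n))"
      by (intro emeasure_mono order_trans[OF sub] Un_mono UB order_refl sets.Un sets.countable_UN')
         (use null in \<open>auto simp: Q_def null_setsD2\<close>)
    also have "\<dots> \<le> emeasure lebesgue (\<Union>n. Q n)"
    proof -
      have "(\<Union>n. Q n) \<in> sets lebesgue" by (auto simp: Q_def)
      then show ?thesis using null by (metis emeasure_Un_null_set sup_commute order_refl)
    qed
    also have "\<dots> \<le> (\<Sum>n. emeasure lebesgue (Q n))"
      by (rule emeasure_subadditive_countably) (auto simp: Q_def)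
    also have "\<dots> = (\<Sum>n. ennreal (L ^ ?d) * emeasure lebesgue (P n))"
    proof (rule suminf_cong)
      fix n
      show "emeasure lebesgue (Q n) = ennreal (L ^ ?d) * emeasure lebesgue (P n)"
      proof (cases "n \<in> I")
        case True
        then have "0 < snd (g n)" using C g[OF True] by (auto simp: K_def)
        then show ?thesis
          using True L emeasure_cball[of "L * snd (g n)" "f (fst (g n))"] emeasure_ball[of "snd (g n)" "fst (g n)"]
          by (simp add: P_def Q_def power_mult_distrib ennreal_mult' ennreal_mult mult_ac)
      qed (simp add: P_def Q_def)
    qed
    also have "\<dots> = ennreal (L ^ ?d) * (\<Sum>n. emeasure lebesgue (P n))"
      by simp
    also have "(\<Sum>n. emeasure lebesgue (P n)) = emeasure lebesgue (\<Union>n. P n)"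
    proof (rule suminf_emeasure)
      show "disjoint_family P"
        unfolding disjoint_family_on_def
      proof (intro ballI impI)
        fix n k :: nat assume "n \<noteq> k"
        then have "disjnt (ball (fst (g n)) (snd (g n))) (ball (fst (g k)) (snd (g k)))"
          if "n \<in> I" "k \<in> I"
          using pairwiseD[OF C(3) g[OF that(1)] g[OF that(2)]] ginj[OF that] by auto
        then show "P n \<inter> P k = {}"
          by (simp add: P_def disjnt_def)
      qed
    qed (auto simp: P_def)
    also have "\<dots> \<le> emeasure lebesgue (E \<union> (T - E))"
    proof (intro emeasure_mono mult_left_mono)
      have "P n \<subseteq> T" for n
        using subsetD[OF C(2) g[of n]] by (auto simp: P_def K_def split_beta)
      then show "(\<Union>n. P n) \<subseteq> E \<union> (T - E)" by blast
      show "E \<union> (T - E) \<in> sets lebesgue" by (intro sets.Un E fmeasurableD[OF T(3)])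
    qed
    also have "\<dots> \<le> emeasure lebesgue E + emeasure lebesgue (T - E)"
      by (rule emeasure_subadditive) (use E T in \<open>auto simp: fmeasurableD\<close>)
    also have "\<dots> \<le> emeasure lebesgue E + ennreal e'"
      using T(4) by (intro add_left_mono) auto
    also have "ennreal (L ^ ?d) * (emeasure lebesgue E + ennreal e') =
       ennreal (L ^ ?d) * emeasure lebesgue E + ennreal e"
      using L e by (simp add: distrib_left e'_def ennreal_mult[symmetric])
    finally show "emeasure lebesgue (f ` E) \<le> ennreal (L ^ ?d) * emeasure lebesgue E + ennreal e"
      by (simp add: mult_left_mono)
  qed
  ultimately show ?thesis by blast
qed


text \<open>The preimage of a set \<open>E\<close> under \<open>g\<close> is its image under the
  inverse \<open>h\<close>, so the measure pushed forward by \<open>g\<close> is at most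
  \<open>L ^ DIM('x)\<close> times Lebesgue measure. Only the Lipschitz constant of the inverse
  enters the estimate; that of \<open>g\<close> yields measurability of the image of
  \<open>W\<close>.\<close>

lemma nn_integral_lipschitz_transfer:
  fixes g h :: "'x::euclidean_space \<Rightarrow> 'x"
  assumes g: "\<And>x y. x \<in> W \<Longrightarrow> y \<in> W \<Longrightarrow> norm (g x - g y) \<le> K * norm (x - y)" and K: "0 < K"
    and h: "\<And>x y. x \<in> g ` W \<Longrightarrow> y \<in> g ` W \<Longrightarrow> norm (h x - h y) \<le> L * norm (x - y)" and L: "0 < L"
    and inv: "\<And>x. x \<in> W \<Longrightarrow> h (g x) = x"
    and W: "W \<in> sets lebesgue"
    and f: "f \<in> borel_measurable (lebesgue_on (g ` W))"
  shows "(\<integral>\<^sup>+x\<in>W. f (g x) \<partial>lebesgue) \<le> ennreal (L ^ DIM('x)) * (\<integral>\<^sup>+y\<in>g ` W. f y \<partial>lebesgue)"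
proof -
  have gW: "g ` W \<in> sets lebesgue"
    using lipschitz_image_lebesgue[OF g W K] by simp
  let ?M = "lebesgue_on W" and ?N = "lebesgue_on (g ` W)"
  have vim: "g -` E \<inter> W = h ` E" if "E \<subseteq> g ` W" for E
    using that inv by force
  have im: "h ` E \<in> sets lebesgue \<and> emeasure lebesgue (h ` E) \<le> ennreal (L ^ DIM('x)) * emeasure lebesgue E"
    if "E \<in> sets lebesgue" "E \<subseteq> g ` W" for E
    using that by (intro lipschitz_image_lebesgue[OF h _ L]) auto
  have hsub: "h ` E \<subseteq> W" if "E \<subseteq> g ` W" for E using that inv by force
  have gm: "g \<in> measurable ?M ?N"
  proof (rule measurableI)
    fix E assume "E \<in> sets ?N"
    then have "E \<in> sets lebesgue" "E \<subseteq> g ` W" using gW by (auto simp: sets_restrict_space_iff)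
    then show "g -` E \<inter> space ?M \<in> sets ?M"
      using vim im hsub W by (simp add: sets_restrict_space_iff)
  qed auto
  have "(\<integral>\<^sup>+x\<in>W. f (g x) \<partial>lebesgue) = (\<integral>\<^sup>+x. f (g x) \<partial>?M)"
    using W by (simp add: nn_integral_restrict_space)
  also have "\<dots> = (\<integral>\<^sup>+y. f y \<partial>distr ?M ?N g)"
    by (rule nn_integral_distr[symmetric, OF gm]) (use f in simp)
  also have "\<dots> \<le> (\<integral>\<^sup>+y. f y \<partial>scale_measure (ennreal (L ^ DIM('x))) ?N)"
  proof (rule nn_integral_mono_measure)
    show "distr ?M ?N g \<le> scale_measure (ennreal (L ^ DIM('x))) ?N"
    proof (subst le_measure, simp, rule ballI)
      fix E assume "E \<in> sets (distr ?M ?N g)"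
      then have E: "E \<in> sets ?N" by simp
      then have E': "E \<in> sets lebesgue" "E \<subseteq> g ` W" using gW by (auto simp: sets_restrict_space_iff)
      show "emeasure (distr ?M ?N g) E \<le> emeasure (scale_measure (ennreal (L ^ DIM('x))) ?N) E"
        using im[OF E'] vim[OF E'(2)] hsub[OF E'(2)] E' W gW
        by (simp add: emeasure_distr[OF gm E] emeasure_restrict_space del: emeasure_completion)
    qed
  qed simp
  also have "\<dots> = ennreal (L ^ DIM('x)) * (\<integral>\<^sup>+y. f y \<partial>?N)"
    by (rule nn_integral_scale_measure[OF f])
  also have "(\<integral>\<^sup>+y. f y \<partial>?N) = (\<integral>\<^sup>+y\<in>g ` W. f y \<partial>lebesgue)"
    using gW by (simp add: nn_integral_restrict_space)
  finally show ?thesis .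
qed


section \<open>Weak compactness in \<open>L\<^sup>1\<close>\<close>

text \<open>
  This filter replaces the extraction of subsequences: along it the integrals over all measurable sets
  converge simultaneously.
\<close>

lemma exists_filter_all_bounded_convergent:
  "\<exists>F::nat filter. F \<le> sequentially \<and> F \<noteq> bot \<and>
     (\<forall>a::nat \<Rightarrow> real. bounded (range a) \<longrightarrow> (\<exists>L. (a \<longlongrightarrow> L) F))"
proof -
  \<comment> \<open>\<open>X n\<close> is evaluation at \<open>n\<close>, seen as a point of the
    cube with one coordinate for every real sequence. Sequences that leave [-1, 1] get coordinate 0,
    so that all \<open>X n\<close> lie in the cube, which is compact by Tychonoff.\<close>
  define X :: "nat \<Rightarrow> (nat \<Rightarrow> real) \<Rightarrow> real" where "X n a = (if \<forall>k. \<bar>a k\<bar> \<le> 1 then a n else 0)" for n a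
  let ?U = "PiE UNIV (\<lambda>_. {-1..1}) :: ((nat \<Rightarrow> real) \<Rightarrow> real) set"
  have "compactin (product_topology (\<lambda>_. euclidean) UNIV) ?U"
    by (simp add: compactin_PiE)
  then have "compact ?U"
    by (metis compactin_euclidean_iff euclidean_product_topology)
  moreover have "X n \<in> ?U" for n by (auto simp: X_def abs_le_iff minus_le_iff)
  ultimately obtain x where x: "inf (nhds x) (filtermap X sequentially) \<noteq> bot"
  proof -
    assume U: "compact ?U" "\<And>n. X n \<in> ?U"
    have "filtermap X sequentially \<noteq> bot" by (simp add: filtermap_bot_iff)
    moreover have "eventually (\<lambda>x. x \<in> ?U) (filtermap X sequentially)"
      unfolding eventually_filtermap using U(2) by (intro always_eventually allI)
    ultimately show thesis using U(1) that unfolding compact_filter by metis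
  qed
  \<comment> \<open>Along this filter \<open>X\<close> converges to the cluster point
    \<open>x\<close>; the filter is nontrivial exactly because \<open>x\<close> is a cluster point
    of the sequence. Convergence in the cube is convergence of every coordinate, that is, of every
    sequence bounded by 1.\<close>
  define F where "F = inf (filtercomap X (nhds x)) sequentially"
  have "F \<noteq> bot"
  proof
    assume "F = bot"
    then have "eventually (\<lambda>_. False) F" by simp
    then obtain P Q where P: "eventually P (filtercomap X (nhds x))" and Q: "eventually Q sequentially"
      and PQ: "\<And>n. P n \<Longrightarrow> Q n \<Longrightarrow> False"
      unfolding F_def eventually_inf by metis
    obtain R where R: "eventually R (nhds x)" "\<And>n. R (X n) \<Longrightarrow> P n"
      using P unfolding eventually_filtercomap by metis
    have "eventually (\<lambda>y. \<not> R y) (filtermap X sequentially)"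
      unfolding eventually_filtermap using Q by (rule eventually_mono) (metis R(2) PQ)
    with R(1) have "eventually (\<lambda>_. False) (inf (nhds x) (filtermap X sequentially))"
      unfolding eventually_inf by (intro exI[of _ R] exI[of _ "\<lambda>y. \<not> R y"]) simp
    with x show False by (simp add: eventually_False)
  qed
  moreover have "\<exists>L. (a \<longlongrightarrow> L) F" if "bounded (range a)" for a :: "nat \<Rightarrow> real"
  proof -
    obtain C where C: "C > 0" "\<And>n. \<bar>a n\<bar> \<le> C"
      using \<open>bounded (range a)\<close> unfolding bounded_pos by (metis rangeI real_norm_def)
    have X: "filterlim X (nhds x) F"
      unfolding F_def by (rule filterlim_mono[OF filterlim_filtercomap order_refl inf_le1])
    define b where "b n = a n / C" for n
    have "continuous_on UNIV (\<lambda>y::(nat \<Rightarrow> real) \<Rightarrow> real. y b)"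
      by (rule continuous_on_product_coordinates)
    then have "((\<lambda>y. y b) \<longlongrightarrow> x b) (nhds x)"
      unfolding continuous_on_def
      by (intro tendsto_at_iff_tendsto_nhds[of "\<lambda>y. y b" x, THEN iffD1]) simp
    from filterlim_compose[OF this X] have "((\<lambda>n. X n b) \<longlongrightarrow> x b) F" by simp
    moreover have "X n b = b n" for n
      using C by (simp add: X_def b_def)
    ultimately have "((\<lambda>n. C * b n) \<longlongrightarrow> C * x b) F"
      by (simp add: tendsto_mult_left)
    then show ?thesis using C(1) by (intro exI[of _ "C * x b"]) (simp add: b_def)
  qed
  moreover have "F \<le> sequentially" unfolding F_def by simp
  ultimately show ?thesis by blast
qed

context finite_measure
begin

text \<open>The limits of the integrals over the measurable sets form a finitely additive set
  function. Uniform integrability is what makes it continuous at the empty set, hence countably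
  additive, and the Radon-Nikodym density is the weak limit. Nonnegativity makes the set function a
  measure.\<close>

lemma uniformly_integrable_nonneg_weak_limit:
  fixes f :: "nat \<Rightarrow> 'a \<Rightarrow> real"
  assumes F: "F \<noteq> bot" "\<And>a::nat \<Rightarrow> real. bounded (range a) \<Longrightarrow> \<exists>L. (a \<longlongrightarrow> L) F"
    and f: "\<And>l. integrable M (f l)" "\<And>l x. 0 \<le> f l x"
    and B: "\<And>l. (\<integral>x. f l x \<partial>M) \<le> B"
    and ui: "\<And>e. 0 < e \<Longrightarrow> \<exists>d>0. \<forall>E\<in>sets M. measure M E \<le> d \<longrightarrow> (\<forall>l. (LINT x:E|M. f l x) \<le> e)"
  shows "\<exists>h. integrable M h \<and> (\<forall>E\<in>sets M. ((\<lambda>l. LINT x:E|M. f l x) \<longlongrightarrow> (LINT x:E|M. h x)) F)"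
proof -
  have si: "set_integrable M E (f l)" if "E \<in> sets M" for E l
    unfolding set_integrable_def
    using integrable_mult_indicator[OF that f(1)] by simp
  have nn: "0 \<le> (LINT x:E|M. f l x)" for E l
    unfolding set_lebesgue_integral_def by (rule integral_nonneg_AE) (simp add: f(2))
  have le: "(LINT x:E|M. f l x) \<le> B" if "E \<in> sets M" for E l
  proof -
    have "(LINT x:E|M. f l x) \<le> (\<integral>x. f l x \<partial>M)"
      unfolding set_lebesgue_integral_def
      using si[OF that] f by (intro integral_mono) (auto simp: set_integrable_def indicator_def)
    then show ?thesis using B[of l] by simp
  qed
  have "\<exists>L. ((\<lambda>l. LINT x:E|M. f l x) \<longlongrightarrow> L) F" if "E \<in> sets M" for E
    using nn le[OF that] by (intro F(2)) (auto simp: bounded_iff intro!: exI[of _ B])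
  then have "\<exists>\<nu>. \<forall>E\<in>sets M. ((\<lambda>l. LINT x:E|M. f l x) \<longlongrightarrow> \<nu> E) F"
    by (intro bchoice ballI)
  then obtain \<nu> where \<nu>: "\<And>E. E \<in> sets M \<Longrightarrow> ((\<lambda>l. LINT x:E|M. f l x) \<longlongrightarrow> \<nu> E) F"
    by (elim exE) (rule that, erule bspec)
  have \<nu>0: "0 \<le> \<nu> E" if "E \<in> sets M" for E
    by (rule tendsto_lowerbound[OF \<nu>[OF that]]) (use nn F(1) in auto)
  have \<nu>small: "\<nu> E \<le> e" if "E \<in> sets M" "\<And>l. (LINT x:E|M. f l x) \<le> e" for E e
    by (rule tendsto_upperbound[OF \<nu>[OF that(1)]]) (use that(2) F(1) in auto)
  define N where "N = measure_of (space M) (sets M) (\<lambda>E. ennreal (\<nu> E))"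
  have empty: "\<nu> {} = 0"
    by (rule tendsto_unique[OF F(1) \<nu>[of "{}"]]) (simp_all add: set_lebesgue_integral_def)
  have add: "\<nu> (E \<union> E') = \<nu> E + \<nu> E'" if "E \<in> sets M" "E' \<in> sets M" "E \<inter> E' = {}" for E E'
  proof (rule tendsto_unique[OF F(1) \<nu>])
    have "(LINT x:E \<union> E'|M. f l x) = (LINT x:E|M. f l x) + (LINT x:E'|M. f l x)" for l
      by (rule set_integral_Un) (use that si in auto)
    then show "((\<lambda>l. LINT x:E \<union> E'|M. f l x) \<longlongrightarrow> \<nu> E + \<nu> E') F"
      using tendsto_add[OF \<nu>[OF that(1)] \<nu>[OF that(2)]] by simp
  qed (use that in auto)
  have ca: "countably_additive (sets M) (\<lambda>E. ennreal (\<nu> E))"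
  proof (rule sets.empty_continuous_imp_countably_additive)
    show "positive (sets M) (\<lambda>E. ennreal (\<nu> E))" by (simp add: positive_def empty)
    show "additive (sets M) (\<lambda>E. ennreal (\<nu> E))"
      by (auto simp: additive_def add ennreal_plus \<nu>0)
    fix A :: "nat \<Rightarrow> 'a set" assume A: "range A \<subseteq> sets M" "decseq A" "(\<Inter>i. A i) = {}"
    \<comment> \<open>The measures of \<open>A i\<close> tend to 0, so for large \<open>i\<close>
      the integrals of all \<open>f l\<close> over \<open>A i\<close> are small at once, and the
      bound survives in the limit along \<open>F\<close>.\<close>
    have lim: "(\<lambda>i. measure M (A i)) \<longlonglongrightarrow> 0"
      using finite_Lim_measure_decseq[OF A(1,2)] A(3) by simp
    have "(\<lambda>i. \<nu> (A i)) \<longlonglongrightarrow> 0"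
    proof (rule LIMSEQ_I)
      fix r :: real assume r: "0 < r"
      obtain d where d: "d > 0" "\<And>E l. E \<in> sets M \<Longrightarrow> measure M E \<le> d \<Longrightarrow> (LINT x:E|M. f l x) \<le> r / 2"
        using ui[OF half_gt_zero[OF r]] by metis
      obtain n0 where n0: "\<And>n. n \<ge> n0 \<Longrightarrow> norm (measure M (A n) - 0) < d"
        using LIMSEQ_D[OF lim d(1)] by metis
      show "\<exists>n0. \<forall>n\<ge>n0. norm (\<nu> (A n) - 0) < r"
      proof (intro exI allI impI)
        fix n assume "n \<ge> n0"
        then have "measure M (A n) \<le> d" using n0 by fastforce
        then have "\<nu> (A n) \<le> r / 2" using A(1) d(2) by (intro \<nu>small) auto
        moreover have "0 \<le> \<nu> (A n)" using A(1) by (intro \<nu>0) auto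
        ultimately show "norm (\<nu> (A n) - 0) < r" using r by simp
      qed
    qed
    from tendsto_ennrealI[OF this] show "(\<lambda>i. ennreal (\<nu> (A i))) \<longlonglongrightarrow> 0" by simp
  qed auto
  have emN: "emeasure N E = ennreal (\<nu> E)" if "E \<in> sets M" for E
    using emeasure_measure_of_sigma[OF sets.sigma_algebra_axioms _ ca that] empty
    unfolding N_def by (simp add: positive_def)
  have setsN: "sets N = sets M" unfolding N_def by simp
  have "absolutely_continuous M N"
    unfolding absolutely_continuous_def
  proof
    fix E assume E: "E \<in> null_sets M"
    then have "AE x in M. x \<notin> E" by (rule AE_not_in)
    then have "(LINT x:E|M. f l x) = 0" for l
      unfolding set_lebesgue_integral_def
      by (intro integral_eq_zero_AE) (auto elim!: eventually_mono)
    then have "\<nu> E \<le> 0" using E by (intro \<nu>small) auto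
    then show "E \<in> null_sets N" using E emN[of E] \<nu>0[of E] by (auto simp: setsN null_sets_def)
  qed
  from Radon_Nikodym[OF this setsN] obtain g where g: "g \<in> borel_measurable M" "density M g = N" by (elim bexE)
  have gE: "(\<integral>\<^sup>+x. g x * indicator E x \<partial>M) = ennreal (\<nu> E)" if "E \<in> sets M" for E
    using emeasure_density[OF g(1) that] emN[OF that] g(2) by simp
  have "(\<integral>\<^sup>+x. g x \<partial>M) = (\<integral>\<^sup>+x. g x * indicator (space M) x \<partial>M)"
    by (rule nn_integral_cong) simp
  also have "\<dots> = ennreal (\<nu> (space M))" by (rule gE) simp
  finally have fin: "AE x in M. g x \<noteq> \<infinity>"
    using nn_integral_PInf_AE[OF g(1)] by simp
  \<comment> \<open>The density is finite almost everywhere because its total integral is the finite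
    number \<open>\<nu> (space M)\<close>; the conversion to a real function therefore changes
    nothing up to a null set.\<close>
  define h where "h x = enn2real (g x)" for x
  have hg: "AE x in M. ennreal (h x) = g x"
    using fin by (auto elim!: eventually_mono simp: h_def less_top)
  have hE: "has_bochner_integral M (\<lambda>x. indicator E x *\<^sub>R h x) (\<nu> E)" if "E \<in> sets M" for E
  proof (rule has_bochner_integral_nn_integral)
    show "(\<integral>\<^sup>+x. ennreal (indicator E x *\<^sub>R h x) \<partial>M) = ennreal (\<nu> E)"
      unfolding gE[OF that, symmetric]
      by (rule nn_integral_cong_AE) (use hg in \<open>auto elim!: eventually_mono simp: indicator_def\<close>)
  qed (use g \<nu>0[OF that] that in \<open>auto simp: h_def\<close>)
  show ?thesis
  proof (intro exI conjI ballI)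
    have "has_bochner_integral M h (\<nu> (space M))"
      by (rule has_bochner_integral_cong[THEN iffD1, OF refl _ refl hE[OF sets.top]]) simp
    then show "integrable M h" by (rule integrable.intros)
    show "((\<lambda>l. LINT x:E|M. f l x) \<longlongrightarrow> (LINT x:E|M. h x)) F" if "E \<in> sets M" for E
      using \<nu>[OF that] has_bochner_integral_integral_eq[OF hE[OF that]]
      by (simp add: set_lebesgue_integral_def)
  qed
qed

text \<open>Positive and negative parts are dominated by the absolute value, hence inherit the bound
  and the uniform integrability; \<open>s = 1\<close> and \<open>s = -1\<close> select the two
  parts. Both limits are taken along the same filter, so they can be subtracted.\<close>

lemma uniformly_integrable_weak_limit:
  fixes f :: "nat \<Rightarrow> 'a \<Rightarrow> real"
  assumes F: "F \<noteq> bot" "\<And>a::nat \<Rightarrow> real. bounded (range a) \<Longrightarrow> \<exists>L. (a \<longlongrightarrow> L) F"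
    and f: "\<And>l. integrable M (f l)"
    and B: "\<And>l. (\<integral>x. \<bar>f l x\<bar> \<partial>M) \<le> B"
    and ui: "\<And>e. 0 < e \<Longrightarrow> \<exists>d>0. \<forall>E\<in>sets M. measure M E \<le> d \<longrightarrow> (\<forall>l. (LINT x:E|M. \<bar>f l x\<bar>) \<le> e)"
  shows "\<exists>h. integrable M h \<and> (\<forall>E\<in>sets M. ((\<lambda>l. LINT x:E|M. f l x) \<longlongrightarrow> (LINT x:E|M. h x)) F)"
proof -
  have part: "\<exists>h. integrable M h \<and> (\<forall>E\<in>sets M. ((\<lambda>l. LINT x:E|M. max 0 (s * f l x)) \<longlongrightarrow> (LINT x:E|M. h x)) F)"
    if s: "\<bar>s\<bar> = 1" for s
  proof (rule uniformly_integrable_nonneg_weak_limit[OF F])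
    have int: "integrable M (\<lambda>x. max 0 (s * f l x))" for l using f by auto
    then show "integrable M (\<lambda>x. max 0 (s * f l x))" for l .
    have le: "max 0 (s * f l x) \<le> \<bar>f l x\<bar>" for l x
      using s abs_ge_self[of "s * f l x"] by (simp add: abs_mult)
    show "(\<integral>x. max 0 (s * f l x) \<partial>M) \<le> B" for l
      using integral_mono[OF int integrable_abs[OF f] le, of l] B[of l] by simp
    fix e :: real assume "0 < e"
    then obtain d where d: "d > 0" "\<And>E l. E \<in> sets M \<Longrightarrow> measure M E \<le> d \<Longrightarrow> (LINT x:E|M. \<bar>f l x\<bar>) \<le> e"
      using ui by blast
    have "(LINT x:E|M. max 0 (s * f l x)) \<le> (LINT x:E|M. \<bar>f l x\<bar>)" if "E \<in> sets M" for E l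
      unfolding set_lebesgue_integral_def real_scaleR_def
      using integrable_mult_indicator[OF that int[of l]] integrable_mult_indicator[OF that integrable_abs[OF f[of l]]]
      by (intro integral_mono mult_left_mono le) auto
    then show "\<exists>d>0. \<forall>E\<in>sets M. measure M E \<le> d \<longrightarrow> (\<forall>l. (LINT x:E|M. max 0 (s * f l x)) \<le> e)"
      using d by (intro exI[of _ d] conjI ballI impI allI) (assumption, meson order_trans)
  qed (assumption, rule max.cobounded1)
  obtain hp where hp: "integrable M hp" "\<And>E. E \<in> sets M \<Longrightarrow> ((\<lambda>l. LINT x:E|M. max 0 (f l x)) \<longlongrightarrow> (LINT x:E|M. hp x)) F"
    using part[of 1] by auto
  obtain hm where hm: "integrable M hm" "\<And>E. E \<in> sets M \<Longrightarrow> ((\<lambda>l. LINT x:E|M. max 0 (- f l x)) \<longlongrightarrow> (LINT x:E|M. hm x)) F"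
    using part[of "-1"] by auto
  have si: "set_integrable M E g" if "integrable M g" "E \<in> sets M" for g :: "'a \<Rightarrow> real" and E
    unfolding set_integrable_def using integrable_mult_indicator[OF that(2,1)] .
  show ?thesis
  proof (intro exI conjI ballI)
    show "integrable M (\<lambda>x. hp x - hm x)" using hp hm by simp
    fix E assume E: "E \<in> sets M"
    have "(LINT x:E|M. f l x) = (LINT x:E|M. max 0 (f l x)) - (LINT x:E|M. max 0 (- f l x))" for l
    proof -
      have "(LINT x:E|M. max 0 (f l x)) - (LINT x:E|M. max 0 (- f l x)) = (LINT x:E|M. max 0 (f l x) - max 0 (- f l x))"
        by (rule set_integral_diff(2)[symmetric]) (use f E in \<open>auto intro!: si\<close>)
      also have "(\<lambda>x. max 0 (f l x) - max 0 (- f l x)) = f l" by auto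
      finally show ?thesis by simp
    qed
    moreover have "(LINT x:E|M. hp x - hm x) = (LINT x:E|M. hp x) - (LINT x:E|M. hm x)"
      by (rule set_integral_diff(2)) (use hp hm E in \<open>auto intro!: si\<close>)
    ultimately show "((\<lambda>l. LINT x:E|M. f l x) \<longlongrightarrow> (LINT x:E|M. hp x - hm x)) F"
      using tendsto_diff[OF hp(2)[OF E] hm(2)[OF E]] by simp
  qed
qed

text \<open>Rounding the bounded function \<open>\<phi>\<close> down to multiples of
  \<open>\<epsilon>\<close> gives a function with finitely many values, for which convergence is a
  finite sum of convergences over level sets. The rounding costs at most \<open>\<epsilon>\<close>
  times the \<open>L1\<close> norm, uniformly in \<open>l\<close>.\<close>

lemma set_integrals_tendsto_imp_bounded_integrals_tendsto:
  fixes f :: "nat \<Rightarrow> 'a \<Rightarrow> real"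
  assumes f: "\<And>l. integrable M (f l)" and h: "integrable M h"
    and B: "\<And>l. (\<integral>x. \<bar>f l x\<bar> \<partial>M) \<le> B"
    and lim: "\<And>E. E \<in> sets M \<Longrightarrow> ((\<lambda>l. LINT x:E|M. f l x) \<longlongrightarrow> (LINT x:E|M. h x)) F"
    and \<phi>: "\<phi> \<in> borel_measurable M" "\<And>x. \<bar>\<phi> x\<bar> \<le> C"
  shows "((\<lambda>l. \<integral>x. f l x * \<phi> x \<partial>M) \<longlongrightarrow> (\<integral>x. h x * \<phi> x \<partial>M)) F"
proof (rule tendstoI)
  fix r :: real assume r: "0 < r"
  define B' where "B' = (\<integral>x. \<bar>h x\<bar> \<partial>M)"
  have B0: "0 \<le> B" 
  proof -
    have "0 \<le> (\<integral>x. \<bar>f 0 x\<bar> \<partial>M)" by simp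
    then show ?thesis using B[of 0] by linarith
  qed
  have B'0: "0 \<le> B'" unfolding B'_def by simp
  \<comment> \<open>The total error consists of \<open>\<epsilon> * B\<close> for
    \<open>f l\<close>, \<open>\<epsilon> * B'\<close> for \<open>h\<close> and
    \<open>\<epsilon>\<close> from the convergence of the rounded integrals; the sum is
    \<open>r\<close>.\<close>
  define \<epsilon> where "\<epsilon> = r / (B + B' + 1)"
  have \<epsilon>: "\<epsilon> > 0" using r B0 B'0 by (simp add: \<epsilon>_def)
  define k where "k x = \<lfloor>\<phi> x / \<epsilon>\<rfloor>" for x
  define I where "I = {- \<lceil>C / \<epsilon>\<rceil> - 1 .. \<lceil>C / \<epsilon>\<rceil> + 1}"
  define A where "A j = {x \<in> space M. k x = j}" for j
  define s where "s x = \<epsilon> * of_int (k x)" for x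
  have km: "k \<in> measurable M (count_space UNIV)" unfolding k_def using \<phi>(1) by measurable
  have A: "A j \<in> sets M" for j
    unfolding A_def using measurable_sets[OF km, of "{j}"] by (simp add: vimage_def Int_def conj_commute)
  have kI: "k x \<in> I" for x
  proof -
    have "\<phi> x / \<epsilon> \<le> C / \<epsilon>" "- (C / \<epsilon>) \<le> \<phi> x / \<epsilon>"
      using \<phi>(2)[of x] \<epsilon> by (auto simp: abs_le_iff field_simps)
    then show ?thesis unfolding k_def I_def by simp linarith
  qed
  have sm: "s \<in> borel_measurable M" unfolding s_def k_def using \<phi>(1) by measurable
  have ds: "\<bar>\<phi> x - s x\<bar> \<le> \<epsilon>" for x
  proof -
    have "of_int (k x) \<le> \<phi> x / \<epsilon>" "\<phi> x / \<epsilon> < of_int (k x) + 1" unfolding k_def by linarith+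
    then have "\<epsilon> * of_int (k x) \<le> \<phi> x" "\<phi> x < \<epsilon> * of_int (k x) + \<epsilon>"
      using \<epsilon> by (simp_all add: field_simps)
    then show ?thesis by (simp add: s_def)
  qed
  have s_b: "\<bar>s x\<bar> \<le> C + \<epsilon>" for x using ds[of x] \<phi>(2)[of x] by linarith
  have ints: "integrable M (\<lambda>x. g x * \<psi> x)"
    if "integrable M g" "\<psi> \<in> borel_measurable M" "\<And>x. \<bar>\<psi> x\<bar> \<le> D" for g \<psi> :: "'a \<Rightarrow> real" and D
  proof (rule Bochner_Integration.integrable_bound[of M "\<lambda>x. D * g x"])
    have "0 \<le> D" using that(3) abs_ge_zero order_trans by blast
    then show "AE x in M. norm (g x * \<psi> x) \<le> norm (D * g x)"
      using that(3) by (intro always_eventually allI) (simp add: abs_mult mult.commute mult_right_mono)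
  qed (use that in auto)
  have eq: "(\<integral>x. g x * s x \<partial>M) = (\<Sum>j\<in>I. \<epsilon> * of_int j * (LINT x:A j|M. g x))"
    if g: "integrable M g" for g
  proof -
    have "(\<integral>x. g x * s x \<partial>M) = (\<integral>x. (\<Sum>j\<in>I. \<epsilon> * of_int j * (indicator (A j) x *\<^sub>R g x)) \<partial>M)"
    proof (rule Bochner_Integration.integral_cong)
      fix x assume x: "x \<in> space M"
      have "(\<Sum>j\<in>I. \<epsilon> * of_int j * (indicator (A j) x *\<^sub>R g x)) = (\<Sum>j\<in>I. if j = k x then \<epsilon> * of_int j * g x else 0)"
        by (rule sum.cong) (use x in \<open>auto simp: A_def indicator_def\<close>)
      also have "\<dots> = g x * s x" using kI[of x] by (simp add: I_def s_def)
      finally show "g x * s x = (\<Sum>j\<in>I. \<epsilon> * of_int j * (indicator (A j) x *\<^sub>R g x))" by simp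
    qed simp
    also have "\<dots> = (\<Sum>j\<in>I. \<epsilon> * of_int j * (LINT x:A j|M. g x))"
      unfolding set_lebesgue_integral_def
      by (subst Bochner_Integration.integral_sum)
         (use integrable_mult_indicator[OF A g] in \<open>auto\<close>)
    finally show ?thesis .
  qed
  have err: "\<bar>(\<integral>x. g x * \<phi> x \<partial>M) - (\<integral>x. g x * s x \<partial>M)\<bar> \<le> \<epsilon> * (\<integral>x. \<bar>g x\<bar> \<partial>M)"
    if g: "integrable M g" for g
  proof -
    have "(\<integral>x. g x * \<phi> x \<partial>M) - (\<integral>x. g x * s x \<partial>M) = (\<integral>x. g x * \<phi> x - g x * s x \<partial>M)"
      by (rule Bochner_Integration.integral_diff[symmetric]) (rule ints[OF g \<phi>] ints[OF g sm s_b])+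
    also have "\<bar>\<dots>\<bar> \<le> (\<integral>x. \<bar>g x * \<phi> x - g x * s x\<bar> \<partial>M)" by (rule integral_abs_bound)
    also have "\<dots> \<le> (\<integral>x. \<epsilon> * \<bar>g x\<bar> \<partial>M)"
    proof (rule integral_mono)
      show "integrable M (\<lambda>x. \<bar>g x * \<phi> x - g x * s x\<bar>)"
        by (intro integrable_abs Bochner_Integration.integrable_diff ints[OF g \<phi>] ints[OF g sm s_b])
      show "\<bar>g x * \<phi> x - g x * s x\<bar> \<le> \<epsilon> * \<bar>g x\<bar>" for x
      proof -
        have "g x * \<phi> x - g x * s x = (\<phi> x - s x) * g x" by (simp add: algebra_simps)
        then show ?thesis using mult_right_mono[OF ds[of x], of "\<bar>g x\<bar>"] by (simp add: abs_mult)
      qed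
    qed (use g in auto)
    finally show ?thesis by simp
  qed
  have "((\<lambda>l. \<integral>x. f l x * s x \<partial>M) \<longlongrightarrow> (\<integral>x. h x * s x \<partial>M)) F"
    unfolding eq[OF f] eq[OF h] by (intro tendsto_sum tendsto_mult_left lim A)
  from tendstoD[OF this \<epsilon>]
  show "\<forall>\<^sub>F l in F. dist (\<integral>x. f l x * \<phi> x \<partial>M) (\<integral>x. h x * \<phi> x \<partial>M) < r"
  proof (rule eventually_mono)
    fix l assume l: "dist (\<integral>x. f l x * s x \<partial>M) (\<integral>x. h x * s x \<partial>M) < \<epsilon>"
    have "\<bar>(\<integral>x. f l x * \<phi> x \<partial>M) - (\<integral>x. f l x * s x \<partial>M)\<bar> \<le> \<epsilon> * B"
      using err[OF f[of l]] mult_left_mono[OF B[of l], of \<epsilon>] \<epsilon> by linarith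
    moreover have "\<bar>(\<integral>x. h x * \<phi> x \<partial>M) - (\<integral>x. h x * s x \<partial>M)\<bar> \<le> \<epsilon> * B'"
      using err[OF h] by (simp add: B'_def)
    moreover have "\<epsilon> * B + \<epsilon> * B' + \<epsilon> = r"
    proof -
      have "\<epsilon> * B + \<epsilon> * B' + \<epsilon> = \<epsilon> * (B + B' + 1)" by (simp add: algebra_simps)
      also have "\<dots> = r" using B0 B'0 by (simp add: \<epsilon>_def)
      finally show ?thesis .
    qed
    ultimately show "dist (\<integral>x. f l x * \<phi> x \<partial>M) (\<integral>x. h x * \<phi> x \<partial>M) < r"
      using l by (simp add: dist_real_def)
  qed
qed

end

section \<open>Convergence in measure on a finite measure space\<close>

context finite_measure
begin

text \<open>Countably many balls of radius \<open>e/2\<close> cover the target. If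
  \<open>g0 x\<close> and \<open>g l x\<close> lie in the same ball, their distance is less than
  \<open>e\<close>. By finiteness of the measure, \<open>g0\<close> lies in the first
  \<open>n\<close> balls up to a set of small measure, so only finitely many open sets need to be
  tested.\<close>

lemma open_set_convergence_imp_in_measure:
  fixes g :: "nat \<Rightarrow> 'a \<Rightarrow> 'y::{metric_space, second_countable_topology}"
  assumes gm: "\<And>l. g l \<in> borel_measurable M" and g0m: "g0 \<in> borel_measurable M"
    and lim: "\<And>U. open U \<Longrightarrow> (\<lambda>l. measure M {x \<in> space M. g0 x \<in> U \<and> g l x \<notin> U}) \<longlonglongrightarrow> 0"
    and e: "0 < e"
  shows "(\<lambda>l. measure M {x \<in> space M. e < dist (g l x) (g0 x)}) \<longlonglongrightarrow> 0"
proof -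
  obtain D :: "'y set" where D: "countable D" "\<And>X. open X \<Longrightarrow> X \<noteq> {} \<Longrightarrow> \<exists>d\<in>D. d \<in> X"
    by (rule countable_dense_setE) (rule that, assumption, blast)
  have D0: "D \<noteq> {}" using D(2)[OF open_UNIV] by auto
  define c where "c = from_nat_into D"
  define A where "A k = {x \<in> space M. g0 x \<in> ball (c k) (e/2)}" for k
  have pre: "{x \<in> space M. f x \<in> U} \<in> sets M" if "f \<in> borel_measurable M" "open U" for f :: "'a \<Rightarrow> 'y" and U
    using measurable_sets[OF that(1) borel_open[OF that(2)]] by (simp add: vimage_def Int_def conj_commute)
  have A: "A k \<in> sets M" for k unfolding A_def by (rule pre[OF g0m open_ball])
  have UA: "(\<Union>k. A k) = space M"
  proof -
    have "\<exists>k. g0 x \<in> ball (c k) (e/2)" for x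
    proof -
      obtain d where d: "d \<in> D" "d \<in> ball (g0 x) (e/2)"
        using D(2)[OF open_ball, of "g0 x" "e/2"] e by (metis centre_in_ball empty_iff half_gt_zero)
      obtain k where "c k = d" using from_nat_into_surj[OF D(1) d(1)] unfolding c_def by blast
      with d(2) show ?thesis by (auto simp: dist_commute)
    qed
    then show ?thesis unfolding A_def by blast
  qed
  define R where "R n = space M - (\<Union>k<n. A k)" for n
  have R: "R n \<in> sets M" for n unfolding R_def using A by auto
  have "(\<lambda>n. measure M (R n)) \<longlonglongrightarrow> measure M (\<Inter>n. R n)"
    by (rule finite_Lim_measure_decseq) (use R in \<open>auto simp: R_def decseq_def intro: less_le_trans\<close>)
  moreover have "(\<Inter>n. R n) = {}" using UA unfolding R_def by fastforce
  ultimately have Rlim: "(\<lambda>n. measure M (R n)) \<longlonglongrightarrow> 0" by simp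
  define S where "S k l = {x \<in> space M. g0 x \<in> ball (c k) (e/2) \<and> g l x \<notin> ball (c k) (e/2)}" for k l
  have S: "S k l \<in> sets M" for k l
  proof -
    have "S k l = A k - {x \<in> space M. g l x \<in> ball (c k) (e/2)}" unfolding S_def A_def by auto
    then show ?thesis using sets.Diff[OF A pre[OF gm open_ball]] by (simp only:)
  qed
  have bad: "{x \<in> space M. e < dist (g l x) (g0 x)} \<subseteq> R n \<union> (\<Union>k<n. S k l)" for n l
  proof
    fix x assume x: "x \<in> {x \<in> space M. e < dist (g l x) (g0 x)}"
    show "x \<in> R n \<union> (\<Union>k<n. S k l)"
    proof (cases "x \<in> R n")
      case False
      then obtain k where k: "k < n" "x \<in> A k" using x unfolding R_def by auto
      have "g l x \<notin> ball (c k) (e/2)"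
        using x k(2) dist_triangle_half_r[of "c k" "g l x" e "g0 x"] unfolding A_def by auto
      then have "x \<in> S k l" using k x unfolding S_def A_def by auto
      then show ?thesis using k(1) by blast
    qed simp
  qed
  show ?thesis
  proof (rule LIMSEQ_I)
    fix r :: real assume r: "0 < r"
    obtain n where n: "measure M (R n) < r/2"
      using LIMSEQ_D[OF Rlim half_gt_zero[OF r]] by fastforce
    have "(\<lambda>l. \<Sum>k<n. measure M (S k l)) \<longlonglongrightarrow> (\<Sum>k<n. 0)"
      unfolding S_def by (intro tendsto_sum lim open_ball)
    then have "(\<lambda>l. \<Sum>k<n. measure M (S k l)) \<longlonglongrightarrow> 0" by simp
    from LIMSEQ_D[OF this half_gt_zero[OF r]]
    obtain l0 where l0: "\<And>l. l \<ge> l0 \<Longrightarrow> norm ((\<Sum>k<n. measure M (S k l)) - 0) < r/2" by metis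
    have "norm (measure M {x \<in> space M. e < dist (g l x) (g0 x)} - 0) < r" if "l \<ge> l0" for l
    proof -
      have "measure M {x \<in> space M. e < dist (g l x) (g0 x)} \<le> measure M (R n \<union> (\<Union>k<n. S k l))"
        by (intro finite_measure_mono bad) (use R S in auto)
      also have "\<dots> \<le> measure M (R n) + measure M (\<Union>k<n. S k l)"
        by (intro measure_Un_le) (use R S in auto)
      also have "measure M (\<Union>k<n. S k l) \<le> (\<Sum>k<n. measure M (S k l))"
        by (intro measure_UNION_le) (use S in auto)
      finally show ?thesis using l0[OF that] n by (simp add: sum_nonneg)
    qed
    then show "\<exists>l0. \<forall>l\<ge>l0. norm (measure M {x \<in> space M. e < dist (g l x) (g0 x)} - 0) < r" by metis
  qed
qed

text \<open>This is Vitali's argument: the difference is at most \<open>e\<close> outside the set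
  where \<open>f l\<close> and \<open>\<theta>\<close> are far apart, and on that set uniform
  integrability controls \<open>f l\<close> while the bound \<open>k\<close> controls
  \<open>\<theta>\<close>.\<close>

lemma set_integral_tendsto_of_in_measure:
  fixes f :: "nat \<Rightarrow> 'a \<Rightarrow> real"
  assumes f: "\<And>l. integrable M (f l)" and \<theta>: "\<theta> \<in> borel_measurable M"
    and im: "\<And>e. 0 < e \<Longrightarrow> (\<lambda>l. measure M {x \<in> space M. e < dist (f l x) (\<theta> x)}) \<longlonglongrightarrow> 0"
    and ui: "\<And>e. 0 < e \<Longrightarrow> \<exists>d>0. \<forall>E\<in>sets M. measure M E \<le> d \<longrightarrow> (\<forall>l. (LINT x:E|M. \<bar>f l x\<bar>) \<le> e)"
    and E: "E \<in> sets M" and bd: "\<And>x. x \<in> E \<Longrightarrow> \<bar>\<theta> x\<bar> \<le> k"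
  shows "(\<lambda>l. LINT x:E|M. f l x) \<longlonglongrightarrow> (LINT x:E|M. \<theta> x)"
proof (cases "E = {}")
  case True
  then show ?thesis by (simp add: set_lebesgue_integral_def)
next
  case False
  then have k0: "0 \<le> k" using bd by (meson abs_ge_zero ex_in_conv order_trans)
  have fE: "integrable M (\<lambda>x. indicator E x *\<^sub>R f l x)" for l
    by (rule integrable_mult_indicator[OF E f])
  have ci: "integrable M (\<lambda>x. c)" for c :: real by simp
  have tE: "integrable M (\<lambda>x. indicator E x *\<^sub>R \<theta> x)"
    by (rule Bochner_Integration.integrable_bound[OF ci[of k]])
       (use bd \<theta> E k0 in \<open>auto simp: indicator_def\<close>)
  show ?thesis
  proof (rule LIMSEQ_I)
    fix r :: real assume r: "0 < r"
    define \<mu> where "\<mu> = measure M (space M)"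
    \<comment> \<open>The constants \<open>e\<close>, \<open>d\<close> and \<open>d'\<close> make
      each of the three contributions \<open>e * \<mu>\<close>, the integral of
      \<open>\<bar>f l x\<bar>\<close> over \<open>bad l\<close>, and
      \<open>k * measure M (bad l)\<close> at most \<open>r/4\<close>; the added 1 keeps the
      denominators positive.\<close>
    define e where "e = r / 4 / (\<mu> + 1)"
    have \<mu>0: "0 \<le> \<mu>" unfolding \<mu>_def by simp
    have e: "0 < e" using r \<mu>0 by (simp add: e_def)
    have e\<mu>: "e * \<mu> \<le> r/4"
    proof -
      have "e * \<mu> \<le> e * (\<mu> + 1)" using e by (simp add: mult_left_mono)
      also have "\<dots> = r/4" using \<mu>0 by (subst nonzero_eq_divide_eq[symmetric]) (auto simp: e_def)
      finally show ?thesis .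
    qed
    define bad where "bad l = {x \<in> space M. e < dist (f l x) (\<theta> x)}" for l
    have badm: "bad l \<in> sets M" for l
      unfolding bad_def using f[of l] \<theta> by measurable
    obtain d where d: "d > 0" "\<And>E l. E \<in> sets M \<Longrightarrow> measure M E \<le> d \<Longrightarrow> (LINT x:E|M. \<bar>f l x\<bar>) \<le> r/4"
      using ui[of "r/4"] r by (metis divide_pos_pos zero_less_numeral)
    define d' where "d' = min d (r / 4 / (k + 1))"
    have d': "d' > 0" using d(1) r k0 by (simp add: d'_def)
    obtain l0 where l0: "\<And>l. l \<ge> l0 \<Longrightarrow> norm (measure M (bad l) - 0) < d'"
      using LIMSEQ_D[OF im[OF e] d'] unfolding bad_def by metis
    have "norm ((LINT x:E|M. f l x) - (LINT x:E|M. \<theta> x)) < r" if l: "l \<ge> l0" for l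
    proof -
      have mb: "measure M (bad l) \<le> d" "measure M (bad l) \<le> r / 4 / (k + 1)"
        using l0[OF l] by (simp_all add: d'_def)
      have kb: "k * measure M (bad l) \<le> r/4"
      proof -
        have "k * measure M (bad l) \<le> ((k + 1) * (r / 4)) / (k + 1)"
          unfolding times_divide_eq_right[symmetric] using mb(2) k0 r by (intro mult_mono) auto
        also have "\<dots> = r/4" using k0 by (intro nonzero_mult_div_cancel_left) auto
        finally show ?thesis .
      qed
      have i1: "integrable M (\<lambda>x. indicator (bad l) x *\<^sub>R \<bar>f l x\<bar>)"
        by (rule integrable_mult_indicator[OF badm integrable_abs[OF f]])
      have i2: "integrable M (\<lambda>x. k * indicator (bad l) x)"
        using badm[of l] by (intro integrable_mult_right integrable_real_indicator) (auto simp: less_top[symmetric])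
      have "(LINT x:E|M. f l x) - (LINT x:E|M. \<theta> x) = (\<integral>x. indicator E x *\<^sub>R f l x - indicator E x *\<^sub>R \<theta> x \<partial>M)"
        unfolding set_lebesgue_integral_def by (rule Bochner_Integration.integral_diff[symmetric, OF fE tE])
      also have "norm \<dots> \<le> (\<integral>x. norm (indicator E x *\<^sub>R f l x - indicator E x *\<^sub>R \<theta> x) \<partial>M)"
        by (rule integral_norm_bound)
      also have "\<dots> \<le> (\<integral>x. e + (indicator (bad l) x *\<^sub>R \<bar>f l x\<bar> + k * indicator (bad l) x) \<partial>M)"
      proof (rule integral_mono)
        show "integrable M (\<lambda>x. norm (indicator E x *\<^sub>R f l x - indicator E x *\<^sub>R \<theta> x))"
          by (intro integrable_norm Bochner_Integration.integrable_diff fE tE)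
        show "integrable M (\<lambda>x. e + (indicator (bad l) x *\<^sub>R \<bar>f l x\<bar> + k * indicator (bad l) x))"
          by (intro Bochner_Integration.integrable_add ci i1 i2)
        fix x assume x: "x \<in> space M"
        show "norm (indicator E x *\<^sub>R f l x - indicator E x *\<^sub>R \<theta> x)
            \<le> e + (indicator (bad l) x *\<^sub>R \<bar>f l x\<bar> + k * indicator (bad l) x)"
          using bd[of x] e k0 x by (auto simp: indicator_def bad_def dist_real_def)
      qed
      also have "\<dots> = e * \<mu> + ((LINT x:bad l|M. \<bar>f l x\<bar>) + k * measure M (bad l))"
        using badm[of l] i1 i2 ci sets.sets_into_space[OF badm[of l]]
        by (simp add: set_lebesgue_integral_def \<mu>_def Int_absorb1 Int_absorb2 mult.commute)
      also have "\<dots> \<le> r/4 + (r/4 + r/4)"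
        by (intro add_mono e\<mu> kb d(2) badm mb)
      finally show ?thesis using r by simp
    qed
    then show "\<exists>l0. \<forall>l\<ge>l0. norm ((LINT x:E|M. f l x) - (LINT x:E|M. \<theta> x)) < r" by metis
  qed
qed

text \<open>Nothing is assumed about integrability of \<open>\<theta>\<close>. On the set where its
  absolute value is at most \<open>k\<close> it is integrable, and there the integrals of
  \<open>f l\<close> have both the integral of \<open>h\<close> and that of \<open>\<theta>\<close>
  as limit; these sets exhaust the space.\<close>

lemma weak_limit_eq_limit_in_measure:
  fixes f :: "nat \<Rightarrow> 'a \<Rightarrow> real"
  assumes F: "F \<noteq> bot" "F \<le> sequentially"
    and f: "\<And>l. integrable M (f l)" and \<theta>: "\<theta> \<in> borel_measurable M" and h: "integrable M h"
    and im: "\<And>e. 0 < e \<Longrightarrow> (\<lambda>l. measure M {x \<in> space M. e < dist (f l x) (\<theta> x)}) \<longlonglongrightarrow> 0"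
    and ui: "\<And>e. 0 < e \<Longrightarrow> \<exists>d>0. \<forall>E\<in>sets M. measure M E \<le> d \<longrightarrow> (\<forall>l. (LINT x:E|M. \<bar>f l x\<bar>) \<le> e)"
    and lim: "\<And>E. E \<in> sets M \<Longrightarrow> ((\<lambda>l. LINT x:E|M. f l x) \<longlongrightarrow> (LINT x:E|M. h x)) F"
  shows "AE x in M. h x = \<theta> x"
proof -
  have "AE x in M. \<bar>\<theta> x\<bar> \<le> real k \<longrightarrow> h x = \<theta> x" for k :: nat
  proof -
    define Ek where "Ek = {x \<in> space M. \<bar>\<theta> x\<bar> \<le> real k}"
    have Ek: "Ek \<in> sets M" unfolding Ek_def using \<theta> by measurable
    have hi: "integrable M (\<lambda>x. indicator Ek x *\<^sub>R h x)" by (rule integrable_mult_indicator[OF Ek h])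
    have ti: "integrable M (\<lambda>x. indicator Ek x *\<^sub>R \<theta> x)"
      by (rule integrable_const_bound[of _ "real k"]) (use \<theta> Ek in \<open>auto simp: Ek_def indicator_def\<close>)
    have "AE x in M. indicator Ek x *\<^sub>R h x - indicator Ek x *\<^sub>R \<theta> x = 0"
    proof (rule density_zero)
      show "integrable M (\<lambda>x. indicator Ek x *\<^sub>R h x - indicator Ek x *\<^sub>R \<theta> x)"
        using hi ti by (rule Bochner_Integration.integrable_diff)
      fix A assume A: "A \<in> sets M"
      have AE: "A \<inter> Ek \<in> sets M" using A Ek by blast
      have "(\<lambda>l. LINT x:A \<inter> Ek|M. f l x) \<longlonglongrightarrow> (LINT x:A \<inter> Ek|M. \<theta> x)"
        by (rule set_integral_tendsto_of_in_measure[OF f \<theta> im ui AE, of "real k"]) (auto simp: Ek_def)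
      from tendsto_mono[OF F(2) this] lim[OF AE]
      have eq: "(LINT x:A \<inter> Ek|M. \<theta> x) = (LINT x:A \<inter> Ek|M. h x)"
        by (rule tendsto_unique[OF F(1)])
      have "(LINT x:A|M. indicator Ek x *\<^sub>R h x - indicator Ek x *\<^sub>R \<theta> x) =
         (LINT x:A|M. indicator Ek x *\<^sub>R h x) - (LINT x:A|M. indicator Ek x *\<^sub>R \<theta> x)"
        by (rule set_integral_diff(2))
           (use integrable_mult_indicator[OF A hi] integrable_mult_indicator[OF A ti] in
             \<open>simp_all add: set_integrable_def\<close>)
      also have "\<dots> = 0" using eq
        by (simp add: set_lebesgue_integral_def indicator_inter_arith mult.assoc)
      finally show "(LINT x:A|M. indicator Ek x *\<^sub>R h x - indicator Ek x *\<^sub>R \<theta> x) = 0" .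
    qed
    then show ?thesis using AE_space
      by eventually_elim (auto simp: Ek_def indicator_def)
  qed
  then have "AE x in M. \<forall>k. \<bar>\<theta> x\<bar> \<le> real k \<longrightarrow> h x = \<theta> x"
    unfolding AE_all_countable by (rule allI)
  then show ?thesis by eventually_elim (metis real_arch_simple)
qed

text \<open>A uniformly bounded sequence on a finite measure space is uniformly integrable, with
  \<open>e / (B + 1)\<close> as threshold, so the convergence of integrals over sets applies and
  extends to bounded weights.\<close>

lemma bounded_in_measure_imp_integral_tendsto:
  fixes g :: "nat \<Rightarrow> 'a \<Rightarrow> real"
  assumes g: "\<And>l. g l \<in> borel_measurable M" and g0: "g0 \<in> borel_measurable M"
    and bd: "\<And>l x. \<bar>g l x\<bar> \<le> B" "\<And>x. \<bar>g0 x\<bar> \<le> B"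
    and \<phi>: "\<phi> \<in> borel_measurable M" "\<And>x. \<bar>\<phi> x\<bar> \<le> C"
    and im: "\<And>e. 0 < e \<Longrightarrow> (\<lambda>l. measure M {x \<in> space M. e < dist (g l x) (g0 x)}) \<longlonglongrightarrow> 0"
  shows "(\<lambda>l. \<integral>x. g l x * \<phi> x \<partial>M) \<longlonglongrightarrow> (\<integral>x. g0 x * \<phi> x \<partial>M)"
proof -
  have B0: "0 \<le> B" using bd(2) abs_ge_zero order_trans by blast
  have gi: "integrable M (g l)" for l
    by (rule integrable_const_bound[of _ B]) (use g bd in auto)
  have g0i: "integrable M g0"
    by (rule integrable_const_bound[of _ B]) (use g0 bd in auto)
  have ui: "\<exists>d>0. \<forall>E\<in>sets M. measure M E \<le> d \<longrightarrow> (\<forall>l. (LINT x:E|M. \<bar>g l x\<bar>) \<le> e)" if e: "0 < e" for e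
  proof (intro exI conjI ballI impI allI)
    show "0 < e / (B + 1)" using e B0 by simp
    fix E l assume E: "E \<in> sets M" "measure M E \<le> e / (B + 1)"
    have "(LINT x:E|M. \<bar>g l x\<bar>) \<le> (\<integral>x. B * indicator E x \<partial>M)"
      unfolding set_lebesgue_integral_def
    proof (rule integral_mono)
      show "integrable M (\<lambda>x. indicat_real E x *\<^sub>R \<bar>g l x\<bar>)"
        by (rule integrable_mult_indicator[OF E(1) integrable_abs[OF gi]])
      show "integrable M (\<lambda>x. B * indicator E x)"
        using E(1) by (intro integrable_mult_right integrable_real_indicator) (auto simp: less_top[symmetric])
    qed (use bd(1) in \<open>auto simp: indicator_def\<close>)
    also have "\<dots> = B * measure M E" using E(1) sets.sets_into_space[OF E(1)] by (simp add: Int_absorb2)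
    also have "\<dots> \<le> (B + 1) * (e / (B + 1))" using E(2) B0 e by (intro mult_mono) auto
    also have "\<dots> = e" using B0 by simp
    finally show "(LINT x:E|M. \<bar>g l x\<bar>) \<le> e" .
  qed
  show ?thesis
  proof (rule set_integrals_tendsto_imp_bounded_integrals_tendsto[OF gi g0i _ _ \<phi>])
    show "(\<integral>x. \<bar>g l x\<bar> \<partial>M) \<le> B * measure M (space M)" for l
      using integral_mono[of M "\<lambda>x. \<bar>g l x\<bar>" "\<lambda>x. B"] gi bd by (simp add: mult.commute)
    show "(\<lambda>l. LINT x:E|M. g l x) \<longlonglongrightarrow> (LINT x:E|M. g0 x)" if "E \<in> sets M" for E
      by (rule set_integral_tendsto_of_in_measure[OF gi g0 im ui that, of B]) (use bd in auto)
  qed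
qed

end

section \<open>Weak compactness on open subsets of Euclidean space\<close>

lemma set_integral_lebesgue_on:
  fixes f :: "_ \<Rightarrow> real"
  assumes "D \<in> sets lebesgue" "E \<subseteq> D"
  shows "(LINT x:E|lebesgue_on D. f x) = (LINT x:E|lebesgue. f x)"
proof -
  have "(\<lambda>x. indicator D x * (indicator E x * f x)) = (\<lambda>x. indicator E x * f x)"
    using assms(2) by (fastforce simp: indicator_def)
  then show ?thesis using assms(1)
    by (simp only: set_lebesgue_integral_def integral_restrict_space real_scaleR_def sets.Int_space_eq2)
qed

text \<open>The open set is cut into disjoint pieces of a compact exhaustion, and the weak limits on
  the pieces are glued. The same filter serves all pieces, which replaces a diagonal extraction. A
  compact subset meets only finitely many pieces, so integrability and convergence are finite
  sums.\<close>

lemma locally_uniformly_integrable_weak_limit_real: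
  fixes f :: "nat \<Rightarrow> 'x::euclidean_space \<Rightarrow> real"
  assumes F: "F \<noteq> bot" "\<And>a::nat \<Rightarrow> real. bounded (range a) \<Longrightarrow> \<exists>L. (a \<longlongrightarrow> L) F"
    and \<Omega>: "open \<Omega>"
    and f: "\<And>l K. compact K \<Longrightarrow> K \<subseteq> \<Omega> \<Longrightarrow> f l absolutely_integrable_on K"
    and B: "\<And>K. compact K \<Longrightarrow> K \<subseteq> \<Omega> \<Longrightarrow> \<exists>B. \<forall>l. (LINT x:K|lebesgue. \<bar>f l x\<bar>) \<le> B"
    and ui: "\<And>K e. compact K \<Longrightarrow> K \<subseteq> \<Omega> \<Longrightarrow> 0 < e \<Longrightarrow>
      \<exists>d>0. \<forall>E\<in>sets lebesgue. E \<subseteq> K \<and> measure lebesgue E \<le> d \<longrightarrow> (\<forall>l. (LINT x:E|lebesgue. \<bar>f l x\<bar>) \<le> e)"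
  shows "\<exists>h. (\<forall>K. compact K \<and> K \<subseteq> \<Omega> \<longrightarrow> h absolutely_integrable_on K) \<and>
     (\<forall>K E. compact K \<and> K \<subseteq> \<Omega> \<and> E \<in> sets lebesgue \<and> E \<subseteq> K \<longrightarrow>
        ((\<lambda>l. LINT x:E|lebesgue. f l x) \<longlongrightarrow> (LINT x:E|lebesgue. h x)) F)"
proof -
  obtain C where C: "\<And>n::nat. compact (C n)" "\<And>n. C n \<subseteq> \<Omega>" "\<Union>(range C) = \<Omega>"
     "\<And>K. compact K \<Longrightarrow> K \<subseteq> \<Omega> \<Longrightarrow> \<exists>N. \<forall>n\<ge>N. K \<subseteq> C n"
    by (rule open_Union_compact_subsets[OF \<Omega>]) (rule that)
  have Cm: "C n \<in> sets lebesgue" for n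
    using C(1) by (simp add: lmeasurable_compact fmeasurableD)
  define D where "D = disjointed C"
  have D: "D n \<in> sets lebesgue" "D n \<subseteq> C n" for n
    unfolding D_def using Cm by (auto simp: disjointed_def)
  have Dfm: "D n \<in> lmeasurable" for n
    using D C(1) by (meson bounded_subset bounded_set_imp_lmeasurable compact_imp_bounded)
  have Ddisj: "disjoint_family D" unfolding D_def by (rule disjoint_family_disjointed)
  have fC: "set_integrable lebesgue E (f l)" if "E \<in> sets lebesgue" "E \<subseteq> C n" for E l n
    using set_integrable_subset[OF f[OF C(1,2)] that] .
  have "\<exists>h. integrable (lebesgue_on (D n)) h \<and> (\<forall>E\<in>sets (lebesgue_on (D n)).
      ((\<lambda>l. LINT x:E|lebesgue_on (D n). f l x) \<longlongrightarrow> (LINT x:E|lebesgue_on (D n). h x)) F)" for n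
  proof -
    interpret finite_measure "lebesgue_on (D n)" using Dfm by (rule finite_measure_lebesgue_on)
    obtain B0 where B0: "\<And>l. (LINT x:C n|lebesgue. \<bar>f l x\<bar>) \<le> B0" using B[OF C(1,2)] by metis
    show ?thesis
    proof (rule uniformly_integrable_weak_limit[OF F(1)])
      show "\<exists>L. (a \<longlongrightarrow> L) F" if "bounded (range a)" for a :: "nat \<Rightarrow> real" using F(2) that .
      show "integrable (lebesgue_on (D n)) (f l)" for l
        using fC[OF D] D(1) by (simp add: integrable_restrict_space set_integrable_def)
      show "(\<integral>x. \<bar>f l x\<bar> \<partial>lebesgue_on (D n)) \<le> B0" for l
      proof -
        have "(\<integral>x. \<bar>f l x\<bar> \<partial>lebesgue_on (D n)) = (LINT x:D n|lebesgue. \<bar>f l x\<bar>)"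
          using D(1) by (simp add: integral_restrict_space set_lebesgue_integral_def)
        also have "\<dots> \<le> (LINT x:C n|lebesgue. \<bar>f l x\<bar>)"
          unfolding set_lebesgue_integral_def
        proof (rule integral_mono)
          show "integrable lebesgue (\<lambda>x. indicator (C n) x *\<^sub>R \<bar>f l x\<bar>)"
            using set_integrable_abs[OF fC[OF Cm order_refl, of n l]] by (simp add: set_integrable_def)
          show "integrable lebesgue (\<lambda>x. indicator (D n) x *\<^sub>R \<bar>f l x\<bar>)"
            using set_integrable_abs[OF fC[OF D, of n l]] by (simp add: set_integrable_def)
        qed (use D(2)[of n] in \<open>auto simp: indicator_def\<close>)
        finally show ?thesis using B0[of l] by simp
      qed
      fix e :: real assume "0 < e"
      from ui[OF C(1,2) this] obtain d where d: "d > 0"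
        "\<And>E l. E \<in> sets lebesgue \<Longrightarrow> E \<subseteq> C n \<Longrightarrow> measure lebesgue E \<le> d \<Longrightarrow> (LINT x:E|lebesgue. \<bar>f l x\<bar>) \<le> e"
        by metis
      show "\<exists>d>0. \<forall>E\<in>sets (lebesgue_on (D n)). measure (lebesgue_on (D n)) E \<le> d \<longrightarrow>
          (\<forall>l. (LINT x:E|lebesgue_on (D n). \<bar>f l x\<bar>) \<le> e)"
      proof (intro exI conjI ballI impI allI)
        fix E l assume E: "E \<in> sets (lebesgue_on (D n))" "measure (lebesgue_on (D n)) E \<le> d"
        then have E': "E \<in> sets lebesgue" "E \<subseteq> D n" using D(1) by (auto simp: sets_restrict_space_iff)
        then show "(LINT x:E|lebesgue_on (D n). \<bar>f l x\<bar>) \<le> e"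
          unfolding set_integral_lebesgue_on[OF D(1) E'(2)]
          using E(2) D d(2)[of E l] by (auto simp: measure_restrict_space)
      qed (rule d(1))
    qed
  qed
  then have "\<exists>h. \<forall>n. integrable (lebesgue_on (D n)) (h n) \<and> (\<forall>E\<in>sets (lebesgue_on (D n)).
      ((\<lambda>l. LINT x:E|lebesgue_on (D n). f l x) \<longlongrightarrow> (LINT x:E|lebesgue_on (D n). h n x)) F)"
    by (intro choice allI)
  then obtain h where hh: "\<forall>n. integrable (lebesgue_on (D n)) (h n) \<and> (\<forall>E\<in>sets (lebesgue_on (D n)).
      ((\<lambda>l. LINT x:E|lebesgue_on (D n). f l x) \<longlongrightarrow> (LINT x:E|lebesgue_on (D n). h n x)) F)"
    by (rule exE)
  note h = hh[THEN spec, THEN conjunct1] hh[THEN spec, THEN conjunct2, THEN bspec]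
  \<comment> \<open>The least index of an exhausting set that contains \<open>x\<close> is the index
    of the disjoint piece in which \<open>x\<close> lies.\<close>
  define g where "g x = h (LEAST n. x \<in> C n) x" for x
  have gh: "g x = h n x" if "x \<in> D n" for x n
  proof -
    have "(LEAST n. x \<in> C n) = n"
    proof (rule Least_equality)
      show "x \<in> C n" using that D(2) by blast
      show "n \<le> k" if "x \<in> C k" for k
        using \<open>x \<in> D n\<close> that unfolding D_def disjointed_def by (force simp: not_le)
    qed
    then show ?thesis by (simp add: g_def)
  qed
  have gD: "set_integrable lebesgue (D n) g" for n
  proof -
    have "set_integrable lebesgue (D n) (h n)"
      using h(1) D(1) by (simp add: integrable_restrict_space set_integrable_def)
    then show ?thesis using set_integrable_cong[of lebesgue lebesgue "D n" "D n" "h n" g] gh by simp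
  qed
  have glim: "((\<lambda>l. LINT x:E|lebesgue. f l x) \<longlongrightarrow> (LINT x:E|lebesgue. g x)) F"
    if E: "E \<in> sets lebesgue" "E \<subseteq> D n" for E n
  proof -
    have "E \<in> sets (lebesgue_on (D n))" using E D(1) by (simp add: sets_restrict_space_iff)
    from h(2)[OF this] have "((\<lambda>l. LINT x:E|lebesgue. f l x) \<longlongrightarrow> (LINT x:E|lebesgue. h n x)) F"
      unfolding set_integral_lebesgue_on[OF D(1) E(2)] .
    moreover have "(LINT x:E|lebesgue. h n x) = (LINT x:E|lebesgue. g x)"
      by (rule set_lebesgue_integral_cong) (use E gh in auto)
    ultimately show ?thesis by simp
  qed
  have UD: "(\<Union>n<N. D n) = (\<Union>n<N. C n)" for N
    using finite_UN_disjointed_eq[of C N] unfolding D_def by (simp add: atLeast0LessThan)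
  show ?thesis
  proof (intro exI conjI allI impI)
    fix K assume K: "compact K \<and> K \<subseteq> \<Omega>"
    obtain N where N: "K \<subseteq> C N" using C(4) K by (meson order_refl)
    have sub: "K \<subseteq> (\<Union>n<Suc N. D n)" unfolding UD using N by blast
    have "set_integrable lebesgue (\<Union>n<Suc N. D n) g"
      by (rule set_integrable_UN) (use gD D in auto)
    then show "g absolutely_integrable_on K"
      by (rule set_integrable_subset) (use K sub in \<open>auto simp: lmeasurable_compact fmeasurableD\<close>)
  next
    fix K E assume K: "compact K \<and> K \<subseteq> \<Omega> \<and> E \<in> sets lebesgue \<and> E \<subseteq> K"
    then obtain N where N: "K \<subseteq> C N" using C(4) by (meson order_refl)
    have eq: "E = (\<Union>n<Suc N. E \<inter> D n)"
    proof -
      have "E \<subseteq> (\<Union>n<Suc N. D n)" unfolding UD using N K by blast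
      then show ?thesis by auto
    qed
    have disj: "disjoint_family_on (\<lambda>n. E \<inter> D n) {..<Suc N}"
      using Ddisj unfolding disjoint_family_on_def by blast
    have sum: "(LINT x:E|lebesgue. k x) = (\<Sum>n<Suc N. LINT x:E \<inter> D n|lebesgue. k x)"
      if "\<And>n. set_integrable lebesgue (D n) k" for k :: "'x \<Rightarrow> real"
    proof -
      have "(LINT x:(\<Union>n<Suc N. E \<inter> D n)|lebesgue. k x) = (\<Sum>n<Suc N. LINT x:E \<inter> D n|lebesgue. k x)"
      proof (rule set_integral_finite_Union[OF _ disj])
        show "set_integrable lebesgue (E \<inter> D n) k" for n
          by (rule set_integrable_subset[OF that]) (use K D in auto)
      qed (use K D in auto)
      then show ?thesis unfolding eq[symmetric] .
    qed
    show "((\<lambda>l. LINT x:E|lebesgue. f l x) \<longlongrightarrow> (LINT x:E|lebesgue. g x)) F"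
      unfolding sum[OF fC[OF D]] sum[OF gD]
      by (intro tendsto_sum glim) (use K D in auto)
  qed
qed


section \<open>Weak derivatives and test functions\<close>

text \<open>The building block of all bump functions here: it vanishes on a half-line, and at 0 its
  difference quotient is bounded by the absolute value of the increment. Class \<open>C1\<close> is
  all that the test functions need.\<close>

lemma C1_on_max0_square: "C1_on UNIV (\<lambda>t::real. (max 0 t)\<^sup>2)"
proof -
  have "((\<lambda>t::real. (max 0 t)\<^sup>2) has_derivative (\<lambda>h. (2 * max 0 t) *\<^sub>R h)) (at t)" for t
  proof -
    consider "t < 0" | "t = 0" | "t > 0" by linarith
    then show ?thesis
    proof cases
      case 1
      have "((\<lambda>t::real. 0::real) has_derivative (\<lambda>h. 0)) (at t)" by (rule has_derivative_const)
      then have "((\<lambda>t::real. (max 0 t)\<^sup>2) has_derivative (\<lambda>h. 0)) (at t)"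
        by (rule has_derivative_transform_within_open[of _ _ _ _ "{..<0}"]) (use 1 in auto)
      then show ?thesis using 1 by simp
    next
      case 2
      have "((\<lambda>t::real. (max 0 t)\<^sup>2) has_derivative (\<lambda>h. 0)) (at 0)"
      proof (rule has_derivativeI_sandwich[of 1 _ _ _ _ "\<lambda>y. \<bar>y\<bar>"])
        show "((\<lambda>y::real. \<bar>y\<bar>) \<longlongrightarrow> 0) (at 0)"
          using tendsto_rabs_zero[OF tendsto_ident_at[of 0 UNIV]] by simp
        show "norm ((max 0 y)\<^sup>2 - (max 0 0)\<^sup>2 - 0) / norm (y - 0) \<le> \<bar>y\<bar>" if "y \<noteq> 0" for y :: real
          using that by (cases "y > 0") (simp_all add: power2_eq_square max_def)
      qed auto
      then show ?thesis using 2 by simp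
    next
      case 3
      have "((\<lambda>t::real. t\<^sup>2) has_derivative (\<lambda>h. (2 * t) *\<^sub>R h)) (at t)"
        by (auto intro!: derivative_eq_intros)
      then have "((\<lambda>t::real. (max 0 t)\<^sup>2) has_derivative (\<lambda>h. (2 * t) *\<^sub>R h)) (at t)"
        by (rule has_derivative_transform_within_open[of _ _ _ _ "{0<..}"]) (use 3 in auto)
      then show ?thesis using 3 by simp
    qed
  qed
  then have "((\<lambda>t::real. (max 0 t)\<^sup>2) has_derivative blinfun_apply ((2 * max 0 t) *\<^sub>R id_blinfun)) (at t)" for t
    by (simp add: scaleR_blinfun.rep_eq)
  moreover have "continuous_on UNIV (\<lambda>t::real. (2 * max 0 t) *\<^sub>R (id_blinfun :: real \<Rightarrow>\<^sub>L real))"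
    by (intro continuous_intros)
  ultimately show ?thesis
    unfolding C1_on_def by (intro exI[of _ "\<lambda>t. (2 * max 0 t) *\<^sub>R id_blinfun"] conjI ballI)
qed

lemma C1_on_real_polynomial_function: "real_polynomial_function p \<Longrightarrow> C1_on S p"
proof (induction rule: real_polynomial_function.induct)
  case (mult f g)
  then show ?case using C1_on_scaleR[of S f g] by simp
qed (auto intro: C1_on_linear C1_on_const C1_on_add)

lemma C1_on_dist_square:
  fixes a :: "'x::euclidean_space"
  shows "C1_on S (\<lambda>x. (dist x a)\<^sup>2)"
proof -
  have lin: "real_polynomial_function (\<lambda>x::'x. (x - a) \<bullet> i)" for i
    using real_polynomial_function.intros(3)[OF real_polynomial_function.intros(1)[OF bounded_linear_inner_left[of i]]
        real_polynomial_function.intros(2)[of "- (a \<bullet> i)"]]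
    by (simp add: inner_diff_left)
  have "real_polynomial_function (\<lambda>x::'x. \<Sum>i\<in>Basis. ((x - a) \<bullet> i) * ((x - a) \<bullet> i))"
    by (intro real_polynomial_function_sum real_polynomial_function.intros(4) lin) simp
  also have "(\<lambda>x::'x. \<Sum>i\<in>Basis. ((x - a) \<bullet> i) * ((x - a) \<bullet> i)) = (\<lambda>x. (dist x a)\<^sup>2)"
    by (rule ext) (simp add: dist_norm power2_norm_eq_inner euclidean_inner[symmetric])
  finally show ?thesis by (rule C1_on_real_polynomial_function)
qed

lemma C1_on_bump:
  fixes a :: "'x::euclidean_space"
  shows "C1_on UNIV (\<lambda>x. (max 0 (c - k * (dist x a)\<^sup>2))\<^sup>2)"
proof -
  have "C1_on UNIV (\<lambda>x. c + (- k) *\<^sub>R (dist x a)\<^sup>2)"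
    by (intro C1_on_add C1_on_const C1_on_scaleR[of _ "\<lambda>_. - k"] C1_on_dist_square)
  from C1_on_compose[OF this C1_on_max0_square] show ?thesis by (simp add: comp_def)
qed

lemma C1_cutoff_exists:
  fixes a :: "'x::euclidean_space"
  assumes "0 < r"
  obtains \<rho> :: "'x \<Rightarrow> real" where "C1_on UNIV \<rho>" "\<And>x. x \<in> ball a (r/2) \<Longrightarrow> \<rho> x = 1"
    "\<And>x. x \<notin> cball a r \<Longrightarrow> \<rho> x = 0"
proof -
  define q where "q t = (max 0 t)\<^sup>2" for t :: real
  \<comment> \<open>An affine function of the squared distance, normalised to be 1 at distance
    \<open>r/2\<close> and 0 at distance \<open>r\<close>.\<close>
  define t where "t x = 4/3 - (4/(3*r\<^sup>2)) * (dist x a)\<^sup>2" for x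
  \<comment> \<open>this combination of translates of \<open>q\<close> is \<open>0\<close> for \<open>t \<le> 0\<close> and \<open>1\<close> for \<open>t \<ge> 1\<close>\<close>
  define \<rho> where "\<rho> x = 2 * q (t x) + (-4) * q (t x - 1/2) + 2 * q (t x - 1)" for x
  show thesis
  proof
    have q: "C1_on UNIV (\<lambda>x. m * q (t x - s))" for m s
      using C1_on_scaleR[OF C1_on_const[of UNIV m] C1_on_bump[of "4/3 - s" "4/(3*r\<^sup>2)" a]]
      by (simp add: q_def t_def algebra_simps)
    show "C1_on UNIV \<rho>"
      unfolding \<rho>_def using q[of _ 0] by (intro C1_on_add q) simp
    show "\<rho> x = 1" if "x \<in> ball a (r/2)" for x
    proof -
      have "(dist x a)\<^sup>2 \<le> (r/2)\<^sup>2" using that by (intro power_mono) (auto simp: dist_commute)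
      then have "(4/(3*r\<^sup>2)) * (dist x a)\<^sup>2 \<le> (4/(3*r\<^sup>2)) * (r/2)\<^sup>2" by (intro mult_left_mono) auto
      also have "\<dots> = 1/3" using assms by (simp add: power2_eq_square)
      finally have "t x \<ge> 1" unfolding t_def by simp
      then show ?thesis unfolding \<rho>_def q_def by (simp add: power2_eq_square algebra_simps)
    qed
    show "\<rho> x = 0" if "x \<notin> cball a r" for x
    proof -
      have "r\<^sup>2 \<le> (dist x a)\<^sup>2" using that assms by (intro power_mono) (auto simp: dist_commute)
      then have "(4/(3*r\<^sup>2)) * r\<^sup>2 \<le> (4/(3*r\<^sup>2)) * (dist x a)\<^sup>2" by (intro mult_left_mono) auto
      then have "t x \<le> 0" unfolding t_def using assms by simp
      then show ?thesis unfolding \<rho>_def q_def by (simp add: max_def)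
    qed
  qed
qed

text \<open>
  On a ball, \<open>f\<close> times a bump function is orthogonal to all polynomials, hence by Stone-Weierstrass to all
  continuous functions, hence to its own sign, which is a limit of continuous functions almost everywhere.
\<close>

lemma AE_zero_if_orthogonal_to_C1c_real:
  fixes f :: "'x::euclidean_space \<Rightarrow> real"
  assumes \<Omega>: "open \<Omega>"
    and f: "\<And>K. compact K \<Longrightarrow> K \<subseteq> \<Omega> \<Longrightarrow> f absolutely_integrable_on K"
    and orth: "\<And>\<phi> K. C1_on UNIV \<phi> \<Longrightarrow> compact K \<Longrightarrow> K \<subseteq> \<Omega> \<Longrightarrow> (\<And>x. x \<notin> K \<Longrightarrow> \<phi> x = 0) \<Longrightarrow>
        (LINT x:\<Omega>|lebesgue. f x * \<phi> x) = 0"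
  shows "AE x in lebesgue. x \<in> \<Omega> \<longrightarrow> f x = 0"
proof -
  have loc: "AE x in lebesgue. x \<in> ball a r \<longrightarrow> f x = 0" if r: "0 < r" "cball a r \<subseteq> \<Omega>" for a r
  proof -
    define \<psi> where "\<psi> x = (max 0 (r\<^sup>2 - 1 * (dist x a)\<^sup>2))\<^sup>2" for x
    have \<psi>: "C1_on UNIV \<psi>" unfolding \<psi>_def by (rule C1_on_bump)
    have \<psi>0: "\<psi> x = 0" if "x \<notin> cball a r" for x
    proof -
      have "r\<^sup>2 \<le> (dist x a)\<^sup>2" using that r by (intro power_mono) (auto simp: dist_commute)
      then show ?thesis by (simp add: \<psi>_def)
    qed
    have \<psi>pos: "\<psi> x > 0" if "x \<in> ball a r" for x
    proof -
      have "(dist x a)\<^sup>2 < r\<^sup>2" using that by (intro power_strict_mono) (auto simp: dist_commute)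
      then show ?thesis by (simp add: \<psi>_def)
    qed
    have cont\<psi>: "continuous_on UNIV \<psi>" by (rule C1_on_continuous_on[OF \<psi>])
    \<comment> \<open>\<open>\<psi>\<close> vanishes outside the closed ball, so its product with
      any polynomial is an admissible test function; it is positive inside the ball, so vanishing of
      \<open>w\<close> forces vanishing of \<open>f\<close> there.\<close>
    define w where "w x = indicator (cball a r) x * (f x * \<psi> x)" for x
    obtain C where C: "\<And>x. x \<in> cball a r \<Longrightarrow> \<bar>\<psi> x\<bar> \<le> C"
    proof -
      have "bounded (\<psi> ` cball a r)"
        by (intro compact_imp_bounded compact_continuous_image continuous_on_subset[OF cont\<psi>]) auto
      then show thesis using that unfolding bounded_iff by (metis imageI real_norm_def)
    qed
    have fi: "integrable lebesgue (\<lambda>x. indicator (cball a r) x *\<^sub>R f x)"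
      using f[of "cball a r"] r(2) by (simp add: set_integrable_def)
    have \<psi>m: "\<psi> \<in> borel_measurable lebesgue"
      using borel_measurable_continuous_onI[OF cont\<psi>] by (simp add: measurable_completion)
    have wi: "integrable lebesgue w"
    proof (rule Bochner_Integration.integrable_bound)
      show "integrable lebesgue (\<lambda>x. C * (indicator (cball a r) x *\<^sub>R f x))"
        using fi by (rule integrable_mult_right)
      have "w = (\<lambda>x. (indicator (cball a r) x *\<^sub>R f x) * \<psi> x)" by (auto simp: w_def)
      then show "w \<in> borel_measurable lebesgue"
        using borel_measurable_integrable[OF fi] \<psi>m by simp
      have "norm (w x) \<le> norm (C * (indicator (cball a r) x *\<^sub>R f x))" for x
      proof (cases "x \<in> cball a r")
        case True
        have "\<bar>f x\<bar> * \<bar>\<psi> x\<bar> \<le> \<bar>f x\<bar> * \<bar>C\<bar>"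
          using C[OF True] by (intro mult_left_mono) auto
        then show ?thesis using True by (simp add: w_def abs_mult mult.commute)
      qed (simp add: w_def)
      then show "AE x in lebesgue. norm (w x) \<le> norm (C * (indicator (cball a r) x *\<^sub>R f x))" by simp
    qed
    have wg: "integrable lebesgue (\<lambda>x. w x * g x)"
      if "g \<in> borel_measurable lebesgue" "\<And>x. x \<in> cball a r \<Longrightarrow> \<bar>g x\<bar> \<le> D" for g :: "'x \<Rightarrow> real" and D
    proof (rule Bochner_Integration.integrable_bound)
      show "integrable lebesgue (\<lambda>x. D * w x)" using wi by (rule integrable_mult_right)
      show "(\<lambda>x. w x * g x) \<in> borel_measurable lebesgue"
        using borel_measurable_integrable[OF wi] that(1) by simp
      have "norm (w x * g x) \<le> norm (D * w x)" for x
      proof (cases "x \<in> cball a r")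
        case True
        have "\<bar>w x\<bar> * \<bar>g x\<bar> \<le> \<bar>w x\<bar> * \<bar>D\<bar>" using that(2)[OF True] by (intro mult_left_mono) auto
        then show ?thesis by (simp add: abs_mult mult.commute)
      qed (simp add: w_def)
      then show "AE x in lebesgue. norm (w x * g x) \<le> norm (D * w x)" by simp
    qed
    have contm: "g \<in> borel_measurable lebesgue" if "continuous_on UNIV g" for g :: "'x \<Rightarrow> real"
      using borel_measurable_continuous_onI[OF that] by (simp add: measurable_completion)
    have contb: "\<exists>D. \<forall>x\<in>cball a r. \<bar>g x\<bar> \<le> D" if "continuous_on UNIV g" for g :: "'x \<Rightarrow> real"
    proof -
      have "bounded (g ` cball a r)"
        by (intro compact_imp_bounded compact_continuous_image continuous_on_subset[OF that]) auto
      then show ?thesis unfolding bounded_iff by (metis imageI real_norm_def)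
    qed
    have poly: "(\<integral>x. w x * p x \<partial>lebesgue) = 0" if "real_polynomial_function p" for p
    proof -
      have "C1_on UNIV (\<lambda>x. p x *\<^sub>R \<psi> x)"
        by (intro C1_on_scaleR C1_on_real_polynomial_function that \<psi>)
      then have "(LINT x:\<Omega>|lebesgue. f x * (p x *\<^sub>R \<psi> x)) = 0"
        using r(2) \<psi>0 by (intro orth[of _ "cball a r"]) auto
      moreover have "(\<lambda>x. indicator \<Omega> x *\<^sub>R (f x * (p x *\<^sub>R \<psi> x))) = (\<lambda>x. w x * p x)"
      proof
        show "indicator \<Omega> x *\<^sub>R (f x * (p x *\<^sub>R \<psi> x)) = w x * p x" for x
          using r(2) \<psi>0[of x] by (auto simp: w_def indicator_def)
      qed
      ultimately show ?thesis by (simp only: set_lebesgue_integral_def)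
    qed
    have contz: "(\<integral>x. w x * g x \<partial>lebesgue) = 0" if g: "continuous_on UNIV g" for g
    proof -
      have "\<bar>\<integral>x. w x * g x \<partial>lebesgue\<bar> \<le> e * ((\<integral>x. \<bar>w x\<bar> \<partial>lebesgue) + 1)" if e: "0 < e" for e
      proof -
        obtain p where p: "real_polynomial_function p" "\<And>x. x \<in> cball a r \<Longrightarrow> \<bar>g x - p x\<bar> < e"
          using Stone_Weierstrass_real_polynomial_function[OF compact_cball continuous_on_subset[OF g subset_UNIV] e]
          by metis
        have pc: "continuous_on UNIV p"
          by (rule C1_on_continuous_on[OF C1_on_real_polynomial_function[OF p(1)]])
        obtain D D' where D: "\<forall>x\<in>cball a r. \<bar>g x\<bar> \<le> D" "\<forall>x\<in>cball a r. \<bar>p x\<bar> \<le> D'"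
          using contb[OF g] contb[OF pc] by metis
        have i: "integrable lebesgue (\<lambda>x. w x * g x)" "integrable lebesgue (\<lambda>x. w x * p x)"
          using wg[OF contm[OF g], of D] wg[OF contm[OF pc], of D'] D by auto
        have "\<bar>\<integral>x. w x * g x \<partial>lebesgue\<bar> = \<bar>\<integral>x. w x * g x - w x * p x \<partial>lebesgue\<bar>"
          using poly[OF p(1)] by (simp add: Bochner_Integration.integral_diff[OF i])
        also have "\<dots> \<le> (\<integral>x. \<bar>w x * g x - w x * p x\<bar> \<partial>lebesgue)" by (rule integral_abs_bound)
        also have "\<dots> \<le> (\<integral>x. e * \<bar>w x\<bar> \<partial>lebesgue)"
        proof (rule integral_mono)
          show "integrable lebesgue (\<lambda>x. \<bar>w x * g x - w x * p x\<bar>)"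
            by (intro integrable_abs Bochner_Integration.integrable_diff i)
          show "integrable lebesgue (\<lambda>x. e * \<bar>w x\<bar>)" by (intro integrable_mult_right integrable_abs wi)
          show "\<bar>w x * g x - w x * p x\<bar> \<le> e * \<bar>w x\<bar>" for x
          proof (cases "x \<in> cball a r")
            case True
            have "\<bar>w x\<bar> * \<bar>g x - p x\<bar> \<le> \<bar>w x\<bar> * e"
              using p(2)[OF True] by (intro mult_left_mono) auto
            then show ?thesis by (simp add: abs_mult[symmetric] right_diff_distrib mult.commute)
          qed (simp add: w_def)
        qed
        also have "\<dots> \<le> e * ((\<integral>x. \<bar>w x\<bar> \<partial>lebesgue) + 1)" using e by (simp add: algebra_simps)
        finally show ?thesis .
      qed
      note small = this
      define W where "W = (\<integral>x. \<bar>w x\<bar> \<partial>lebesgue) + 1"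
      have W: "W > 0" unfolding W_def by (simp add: add_nonneg_pos)
      have "\<bar>\<integral>x. w x * g x \<partial>lebesgue\<bar> \<le> 0"
      proof (rule field_le_epsilon)
        fix e :: real assume "0 < e"
        then show "\<bar>\<integral>x. w x * g x \<partial>lebesgue\<bar> \<le> 0 + e"
          using small[of "e / W"] W by (simp add: W_def[symmetric])
      qed
      then show ?thesis by simp
    qed
    have sgnm: "(\<lambda>x. sgn (w x)) \<in> borel_measurable lebesgue"
      using borel_measurable_integrable[OF wi] by simp
    have "(\<lambda>x. sgn (w x)) measurable_on UNIV"
      by (rule lebesgue_measurable_imp_measurable_on_real[OF sgnm]) simp
    then obtain N g where N: "negligible N" and g: "\<And>n::nat. continuous_on UNIV (g n)"
      "\<And>x. x \<notin> N \<Longrightarrow> (\<lambda>n. g n x) \<longlonglongrightarrow> sgn (w x)"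
      unfolding measurable_on_def by auto
    \<comment> \<open>Truncation to [-1, 1] preserves continuity and does not disturb the limit
      \<open>sgn (w x)\<close>, which lies in that interval; it makes the absolute value of
      \<open>w\<close> a dominating function.\<close>
    define g' where "g' n x = max (-1) (min 1 (g n x))" for n x
    have g'c: "continuous_on UNIV (g' n)" for n
      unfolding g'_def by (intro continuous_intros g(1))
    have g'b: "\<bar>g' n x\<bar> \<le> 1" for n x by (auto simp: g'_def)
    have "(\<lambda>n. \<integral>x. w x * g' n x \<partial>lebesgue) \<longlonglongrightarrow> (\<integral>x. w x * sgn (w x) \<partial>lebesgue)"
    proof (rule integral_dominated_convergence[where w = "\<lambda>x. \<bar>w x\<bar>"])
      show "(\<lambda>x. w x * sgn (w x)) \<in> borel_measurable lebesgue"
        using borel_measurable_integrable[OF wi] sgnm by simp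
      show "(\<lambda>x. w x * g' n x) \<in> borel_measurable lebesgue" for n
        using borel_measurable_integrable[OF wi] contm[OF g'c] by simp
      show "integrable lebesgue (\<lambda>x. \<bar>w x\<bar>)" using wi by simp
      have "AE x in lebesgue. x \<notin> N" using N by (intro AE_not_in) (simp add: negligible_iff_null_sets)
      then show "AE x in lebesgue. (\<lambda>n. w x * g' n x) \<longlonglongrightarrow> w x * sgn (w x)"
      proof eventually_elim
        fix x assume "x \<notin> N"
        from g(2)[OF this] have "(\<lambda>n. g' n x) \<longlonglongrightarrow> max (-1) (min 1 (sgn (w x)))"
          unfolding g'_def by (intro tendsto_intros)
        moreover have "max (-1) (min 1 (sgn (w x))) = sgn (w x)" by (simp add: sgn_if)
        ultimately show "(\<lambda>n. w x * g' n x) \<longlonglongrightarrow> w x * sgn (w x)" by (auto intro: tendsto_mult_left)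
      qed
      show "AE x in lebesgue. norm (w x * g' n x) \<le> \<bar>w x\<bar>" for n
        using g'b by (intro always_eventually allI) (simp add: abs_mult mult_left_le)
    qed
    then have "(\<integral>x. w x * sgn (w x) \<partial>lebesgue) = 0"
      unfolding contz[OF g'c] by (simp add: LIMSEQ_const_iff)
    moreover have "w x * sgn (w x) = \<bar>w x\<bar>" for x by (simp add: abs_sgn)
    ultimately have "(\<integral>x. \<bar>w x\<bar> \<partial>lebesgue) = 0" by simp
    then have "AE x in lebesgue. \<bar>w x\<bar> = 0"
      using integral_nonneg_eq_0_iff_AE[of lebesgue "\<lambda>x. \<bar>w x\<bar>"] wi by simp
    then show ?thesis
    proof eventually_elim
      fix x assume "\<bar>w x\<bar> = 0"
      then show "x \<in> ball a r \<longrightarrow> f x = 0"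
        using \<psi>pos[of x] by (auto simp: w_def indicator_def split: if_splits)
    qed
  qed
  \<comment> \<open>Each ball contributes its own exceptional null set, so the cover is reduced to a
    countable one by the Lindelof property.\<close>
  define \<B> where "\<B> = {(a, r). 0 < r \<and> cball a r \<subseteq> \<Omega>}"
  obtain \<B>' where B': "\<B>' \<subseteq> \<B>" "countable \<B>'" "(\<Union>(a, r)\<in>\<B>'. ball a r) = (\<Union>(a, r)\<in>\<B>. ball a r)"
  proof -
    obtain \<F> where F: "\<F> \<subseteq> (\<lambda>(a, r). ball a r) ` \<B>" "countable \<F>" "\<Union>\<F> = \<Union>((\<lambda>(a, r). ball a r) ` \<B>)"
      by (rule Lindelof[of "(\<lambda>(a, r). ball a r) ` \<B>"]) auto
    obtain T where "T \<subseteq> \<B>" "countable T" "\<F> = (\<lambda>(a, r). ball a r) ` T"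
      using countable_subset_image[of \<F> "\<lambda>(a, r). ball a r" \<B>] F by auto
    then show thesis using that F(3) by auto
  qed
  have cover: "\<Omega> \<subseteq> (\<Union>(a, r)\<in>\<B>'. ball a r)"
  proof
    fix x assume "x \<in> \<Omega>"
    then obtain r where "r > 0" "cball x r \<subseteq> \<Omega>" using \<Omega> open_contains_cball by blast
    then have "(x, r) \<in> \<B>" "x \<in> ball x r" by (auto simp: \<B>_def)
    then show "x \<in> (\<Union>(a, r)\<in>\<B>'. ball a r)" unfolding B'(3) by fastforce
  qed
  have "AE x in lebesgue. \<forall>(a, r)\<in>\<B>'. x \<in> ball a r \<longrightarrow> f x = 0"
    unfolding AE_ball_countable[OF B'(2)] using loc B'(1) by (auto simp: \<B>_def)
  then show ?thesis
    by eventually_elim (use cover in fastforce)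
qed

lemma scaleR_in_C1c_vector_fields:
  assumes "C1_on UNIV \<phi>" "compact K" "K \<subseteq> \<Omega>" "\<And>x. x \<notin> K \<Longrightarrow> \<phi> x = 0"
  shows "(\<lambda>x. \<phi> x *\<^sub>R w) \<in> C1c_vector_fields \<Omega>"
  unfolding C1c_vector_fields_def using assms by (auto intro!: C1_on_scaleR C1_on_const exI[of _ K])

text \<open>Test fields of the form \<open>\<phi>\<close> times a coordinate vector isolate one
  component, so the difference of two weak derivatives is orthogonal, component by component, to all
  test functions.\<close>

lemma has_weak_derivative_unique:
  assumes \<Omega>: "open \<Omega>" and h: "has_weak_derivative \<Omega> g h" and h': "has_weak_derivative \<Omega> g h'"
  shows "AE x in lebesgue. x \<in> \<Omega> \<longrightarrow> h x = h' x"
proof -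
  have int: "(\<lambda>x. k x $ i) absolutely_integrable_on K" if "has_weak_derivative \<Omega> g k" "compact K" "K \<subseteq> \<Omega>"
    for k K i
  proof -
    have "k absolutely_integrable_on K"
      using that by (simp add: has_weak_derivative_def locally_integrable_def)
    from absolutely_integrable_component[OF this, of "axis i 1"] show ?thesis by (simp add: inner_axis)
  qed
  have "AE x in lebesgue. x \<in> \<Omega> \<longrightarrow> h x $ i - h' x $ i = 0" for i
  proof (rule AE_zero_if_orthogonal_to_C1c_real[OF \<Omega>])
    show "(\<lambda>x. h x $ i - h' x $ i) absolutely_integrable_on K" if "compact K" "K \<subseteq> \<Omega>" for K
      by (rule set_integral_diff(1)[OF int[OF h that] int[OF h' that]])
    fix \<phi> :: "real ^ 'a \<Rightarrow> real" and K
    assume \<phi>: "C1_on UNIV \<phi>" and K: "compact K" "K \<subseteq> \<Omega>" and supp: "\<And>x. x \<notin> K \<Longrightarrow> \<phi> x = 0"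
    let ?v = "\<lambda>x. \<phi> x *\<^sub>R axis i (1::real)"
    have v: "?v \<in> C1c_vector_fields \<Omega>" by (rule scaleR_in_C1c_vector_fields[OF \<phi> K supp])
    have eq: "(LINT x:\<Omega>|lebesgue. h x \<bullet> ?v x) = (LINT x:\<Omega>|lebesgue. h' x \<bullet> ?v x)"
      using bspec[OF conjunct2[OF conjunct2[OF h[unfolded has_weak_derivative_def]]] v]
        bspec[OF conjunct2[OF conjunct2[OF h'[unfolded has_weak_derivative_def]]] v] by simp
    have cont: "continuous_on UNIV \<phi>" by (rule C1_on_continuous_on[OF \<phi>])
    have bnd: "bounded (\<phi> ` K)"
      by (intro compact_imp_bounded compact_continuous_image continuous_on_subset[OF cont] K) simp
    have i: "integrable lebesgue (\<lambda>x. indicator \<Omega> x *\<^sub>R (k x $ i * \<phi> x))" if "has_weak_derivative \<Omega> g k" for k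
    proof -
      have "(\<lambda>x. \<phi> x * k x $ i) absolutely_integrable_on K"
      proof (rule absolutely_integrable_bounded_measurable_product[OF bilinear_times])
        show "\<phi> \<in> borel_measurable (lebesgue_on K)"
          using K(1) by (intro continuous_imp_measurable_on_sets_lebesgue continuous_on_subset[OF cont])
            (auto simp: lmeasurable_compact fmeasurableD)
      qed (use int[OF that K] K(1) bnd in \<open>auto simp: lmeasurable_compact fmeasurableD\<close>)
      moreover have "(\<lambda>x. indicator K x *\<^sub>R (\<phi> x * k x $ i)) = (\<lambda>x. indicator \<Omega> x *\<^sub>R (k x $ i * \<phi> x))"
        using K(2) supp by (fastforce simp: indicator_def)
      ultimately show ?thesis by (simp only: set_integrable_def)
    qed
    have "(LINT x:\<Omega>|lebesgue. (h x $ i - h' x $ i) * \<phi> x) =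
        (LINT x:\<Omega>|lebesgue. h x $ i * \<phi> x) - (LINT x:\<Omega>|lebesgue. h' x $ i * \<phi> x)"
      unfolding left_diff_distrib by (rule set_integral_diff(2)) (use i h h' in \<open>auto simp: set_integrable_def\<close>)
    also have "\<dots> = 0" using eq by (simp add: inner_axis mult.commute)
    finally show "(LINT x:\<Omega>|lebesgue. (h x $ i - h' x $ i) * \<phi> x) = 0" .
  qed
  then have "AE x in lebesgue. \<forall>i. x \<in> \<Omega> \<longrightarrow> h x $ i - h' x $ i = 0"
    unfolding AE_all_countable by (rule allI)
  then show ?thesis by eventually_elim (simp add: vec_eq_iff)
qed

lemma weak_derivative_works:
  "weakly_differentiable \<Omega> g \<Longrightarrow> has_weak_derivative \<Omega> g (weak_derivative \<Omega> g)"
  unfolding weakly_differentiable_def weak_derivative_def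
  by (erule exE) (rule someI[of "has_weak_derivative \<Omega> g"])

text \<open>Makes the divergence of a test field a weight against which bounded functions converging
  in measure can be integrated.\<close>

lemma divergence_C1c:
  fixes v :: "real ^ 'm::finite \<Rightarrow> real ^ 'm"
  assumes v: "C1_on UNIV v" and K: "compact K" "\<And>x. x \<notin> K \<Longrightarrow> v x = 0"
  shows "continuous_on UNIV (divergence v)" and "x \<notin> K \<Longrightarrow> divergence v x = 0"
proof -
  obtain v' where v': "\<And>x. (v has_derivative blinfun_apply (v' x)) (at x)" and c: "continuous_on UNIV v'"
    using v unfolding C1_on_def by auto
  have fr: "frechet_derivative v (at x) = blinfun_apply (v' x)" for x
    using frechet_derivative_at[OF v'[of x]] by simp
  have "continuous_on UNIV (\<lambda>x. \<Sum>i\<in>UNIV. blinfun_apply (v' x) (axis i 1) $ i)"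
    by (intro continuous_on_sum bounded_linear.continuous_on[OF bounded_linear_vec_nth]
        bounded_bilinear.continuous_on[OF bounded_bilinear_blinfun_apply] c continuous_on_const)
  then show "continuous_on UNIV (divergence v)"
    unfolding divergence_def[abs_def] fr .
  show "divergence v x = 0" if "x \<notin> K"
  proof -
    have "((\<lambda>x. 0) has_derivative (\<lambda>h. 0)) (at x)" by (rule has_derivative_const)
    then have "(v has_derivative (\<lambda>h. 0)) (at x)"
      by (rule has_derivative_transform_within_open[of _ _ _ _ "- K"])
         (use that K in \<open>auto simp: compact_imp_closed\<close>)
    from frechet_derivative_at[OF this, symmetric] show ?thesis by (simp add: divergence_def)
  qed
qed


section \<open>Local uniform integrability\<close>

text \<open>Nonnegative extended integrals are used so that the notion makes sense before
  integrability of the functions is known, and it matches the form of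
  \<open>bilocally_uniformly_integrable\<close>.\<close>

definition locally_uniformly_integrable ::
  "'x::euclidean_space set \<Rightarrow> (nat \<Rightarrow> 'x \<Rightarrow> 'y::real_normed_vector) \<Rightarrow> bool" where
  "locally_uniformly_integrable \<Omega> \<theta> \<longleftrightarrow>
     (\<forall>K. compact K \<and> K \<subseteq> \<Omega> \<longrightarrow> (\<forall>e>0. \<exists>d>0. \<forall>E\<in>sets lebesgue. E \<subseteq> K \<and> emeasure lebesgue E \<le> ennreal d \<longrightarrow>
        (\<forall>l. (\<integral>\<^sup>+x\<in>E. ennreal (norm (\<theta> l x)) \<partial>lebesgue) \<le> ennreal e)))"

lemma small_balls_emeasure:
  assumes "0 < d"
  obtains r where "0 < r" "\<And>x::'x::euclidean_space. emeasure lebesgue (ball x r) \<le> ennreal d"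
proof -
  define c where "c = unit_ball_vol (real (DIM('x)))"
  have c: "0 \<le> c" unfolding c_def by (rule unit_ball_vol_nonneg) simp
  \<comment> \<open>With \<open>r\<close> at most 1 the volume \<open>c * r ^ DIM('x)\<close> is at
    most \<open>c * r\<close>, which is at most \<open>d\<close> by the second bound.\<close>
  define r where "r = min 1 (d / (c + 1))"
  have r: "0 < r" "r \<le> 1" "r \<le> d / (c + 1)" using assms c by (auto simp: r_def)
  have "c * r ^ DIM('x) \<le> c * r"
    using r c power_decreasing[of 1 "DIM('x)" r] by (intro mult_left_mono) auto
  also have "\<dots> \<le> (c + 1) * (d / (c + 1))" using r c by (intro mult_mono) auto
  also have "\<dots> = d" using c by simp
  finally have *: "c * r ^ DIM('x) \<le> d" .
  have "emeasure lebesgue (ball x r) \<le> ennreal d" for x :: 'x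
    using r(1) * by (simp add: emeasure_ball c_def[symmetric] ennreal_leI)
  with r(1) that show thesis by blast
qed

text \<open>The definition contains no bound on the integrals. It follows since Lebesgue measure has
  no atoms: a compact set splits into finitely many pieces of measure at most \<open>d\<close>, each
  contributing at most 1.\<close>

lemma locally_uniformly_integrable_imp_bounded:
  fixes \<theta> :: "nat \<Rightarrow> 'x::euclidean_space \<Rightarrow> 'y::real_normed_vector"
  assumes ui: "locally_uniformly_integrable \<Omega> \<theta>" and K: "compact K" "K \<subseteq> \<Omega>"
    and m: "\<And>l. (\<lambda>x. norm (\<theta> l x)) \<in> borel_measurable (lebesgue_on K)"
  shows "\<exists>B\<ge>0. \<forall>l. (\<integral>\<^sup>+x\<in>K. ennreal (norm (\<theta> l x)) \<partial>lebesgue) \<le> ennreal B"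
proof -
  have "\<exists>d>0. \<forall>E\<in>sets lebesgue. E \<subseteq> K \<and> emeasure lebesgue E \<le> ennreal d \<longrightarrow>
        (\<forall>l. (\<integral>\<^sup>+x\<in>E. ennreal (norm (\<theta> l x)) \<partial>lebesgue) \<le> ennreal 1)"
    by (rule ui[unfolded locally_uniformly_integrable_def, rule_format, OF conjI[OF K]]) simp
  then obtain d where d: "0 < d" "\<And>E l. E \<in> sets lebesgue \<Longrightarrow> E \<subseteq> K \<Longrightarrow> emeasure lebesgue E \<le> ennreal d \<Longrightarrow>
     (\<integral>\<^sup>+x\<in>E. ennreal (norm (\<theta> l x)) \<partial>lebesgue) \<le> ennreal 1" by metis
  obtain r where r: "0 < r" "\<And>x::'x. emeasure lebesgue (ball x r) \<le> ennreal d"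
    using small_balls_emeasure[OF d(1)] by metis
  have Km: "K \<in> sets lebesgue" using K(1) by (simp add: lmeasurable_compact fmeasurableD)
  obtain T where T: "finite T" "T \<subseteq> K" "K \<subseteq> (\<Union>x\<in>T. ball x r)"
  proof (rule compactE_image[OF K(1), of K "\<lambda>x. ball x r"])
    show "K \<subseteq> (\<Union>x\<in>K. ball x r)" using r(1) by auto
  qed (use that in auto)
  have nm: "(\<lambda>x. ennreal (norm (\<theta> l x)) * indicator (K \<inter> ball t r) x) \<in> borel_measurable lebesgue" for l t
  proof -
    have "(\<lambda>x. ennreal (norm (\<theta> l x))) \<in> borel_measurable (lebesgue_on (K \<inter> ball t r))"
      by (rule measurable_restrict_mono[of _ _ K]) (use m[of l] in auto)
    then show ?thesis using Km
      by (subst (asm) borel_measurable_restrict_space_iff_ennreal) auto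
  qed
  have "(\<integral>\<^sup>+x\<in>K. ennreal (norm (\<theta> l x)) \<partial>lebesgue) \<le> ennreal (real (card T))" for l
  proof -
    have "(\<integral>\<^sup>+x\<in>K. ennreal (norm (\<theta> l x)) \<partial>lebesgue) \<le>
        (\<integral>\<^sup>+x. (\<Sum>t\<in>T. ennreal (norm (\<theta> l x)) * indicator (K \<inter> ball t r) x) \<partial>lebesgue)"
    proof (rule nn_integral_mono)
      fix x
      show "ennreal (norm (\<theta> l x)) * indicator K x \<le> (\<Sum>t\<in>T. ennreal (norm (\<theta> l x)) * indicator (K \<inter> ball t r) x)"
      proof (cases "x \<in> K")
        case True
        then obtain t where t: "t \<in> T" "x \<in> ball t r" using T(3) by blast
        have "ennreal (norm (\<theta> l x)) * indicator K x = ennreal (norm (\<theta> l x)) * indicator (K \<inter> ball t r) x"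
          using True t(2) by simp
        also have "\<dots> \<le> (\<Sum>t\<in>T. ennreal (norm (\<theta> l x)) * indicator (K \<inter> ball t r) x)"
          using T(1) t(1) by (intro member_le_sum) auto
        finally show ?thesis .
      qed simp
    qed
    also have "\<dots> = (\<Sum>t\<in>T. \<integral>\<^sup>+x\<in>K \<inter> ball t r. ennreal (norm (\<theta> l x)) \<partial>lebesgue)"
      by (rule nn_integral_sum[OF nm])
    also have "\<dots> \<le> (\<Sum>t\<in>T. ennreal 1)"
    proof (rule sum_mono, rule d(2))
      fix t
      show "K \<inter> ball t r \<in> sets lebesgue" using Km by auto
      then have "emeasure lebesgue (K \<inter> ball t r) \<le> emeasure lebesgue (ball t r)"
        by (intro emeasure_mono) auto
      also have "\<dots> \<le> ennreal d" by (rule r(2))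
      finally show "emeasure lebesgue (K \<inter> ball t r) \<le> ennreal d" .
    qed simp
    also have "\<dots> = ennreal (real (card T))" by (simp add: ennreal_of_nat_eq_real_of_nat)
    finally show ?thesis .
  qed
  then show ?thesis by (intro exI[of _ "real (card T)"]) simp
qed

lemma set_integral_abs_le_of_nn_integral:
  fixes f :: "'x::euclidean_space \<Rightarrow> real"
  assumes "set_integrable lebesgue E f" "\<And>x. \<bar>f x\<bar> \<le> g x"
    "(\<integral>\<^sup>+x\<in>E. ennreal (g x) \<partial>lebesgue) \<le> ennreal e" "0 \<le> e"
  shows "(LINT x:E|lebesgue. \<bar>f x\<bar>) \<le> e"
proof -
  have i: "integrable lebesgue (\<lambda>x. indicator E x *\<^sub>R \<bar>f x\<bar>)"
    using set_integrable_abs[OF assms(1)] by (simp add: set_integrable_def)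
  have "ennreal (LINT x:E|lebesgue. \<bar>f x\<bar>) = (\<integral>\<^sup>+x. ennreal (indicator E x *\<^sub>R \<bar>f x\<bar>) \<partial>lebesgue)"
    unfolding set_lebesgue_integral_def by (rule nn_integral_eq_integral[OF i, symmetric]) auto
  also have "\<dots> \<le> (\<integral>\<^sup>+x\<in>E. ennreal (g x) \<partial>lebesgue)"
    by (rule nn_integral_mono) (use assms(2) in \<open>auto simp: indicator_def intro!: ennreal_leI\<close>)
  also have "\<dots> \<le> ennreal e" by (rule assms(3))
  finally show ?thesis using assms(4) by simp
qed

lemma locally_uniformly_integrable_component:
  fixes \<theta> :: "nat \<Rightarrow> 'x::euclidean_space \<Rightarrow> real ^ 'k::finite"
  assumes ui: "locally_uniformly_integrable \<Omega> \<theta>" and K: "compact K" "K \<subseteq> \<Omega>"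
    and int: "\<And>l. \<theta> l absolutely_integrable_on K"
  shows "\<exists>B. \<forall>l. (LINT x:K|lebesgue. \<bar>\<theta> l x $ i\<bar>) \<le> B"
    and "0 < e \<Longrightarrow> \<exists>d>0. \<forall>E\<in>sets lebesgue. E \<subseteq> K \<and> measure lebesgue E \<le> d \<longrightarrow>
       (\<forall>l. (LINT x:E|lebesgue. \<bar>\<theta> l x $ i\<bar>) \<le> e)"
proof -
  have Km: "K \<in> lmeasurable" using K(1) by (rule lmeasurable_compact)
  have inti: "set_integrable lebesgue E (\<lambda>x. \<theta> l x $ i)" if "E \<in> sets lebesgue" "E \<subseteq> K" for E l
    using absolutely_integrable_component[OF int[of l], of "axis i 1"]
    by (intro set_integrable_subset[OF _ that]) (simp add: inner_axis)
  have "(\<lambda>x. norm (\<theta> l x)) \<in> borel_measurable (lebesgue_on K)" for l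
    using int[of l] fmeasurableD[OF Km] borel_measurable_norm
    by (auto simp: set_integrable_def integrable_restrict_space[symmetric])
  then obtain B where B: "0 \<le> B" "\<And>l. (\<integral>\<^sup>+x\<in>K. ennreal (norm (\<theta> l x)) \<partial>lebesgue) \<le> ennreal B"
    using locally_uniformly_integrable_imp_bounded[OF ui K] by metis
  have "(LINT x:K|lebesgue. \<bar>\<theta> l x $ i\<bar>) \<le> B" for l
    by (rule set_integral_abs_le_of_nn_integral[OF inti _ B(2,1)])
       (use Km component_le_norm_cart in \<open>auto simp: fmeasurableD\<close>)
  then show "\<exists>B. \<forall>l. (LINT x:K|lebesgue. \<bar>\<theta> l x $ i\<bar>) \<le> B" by metis
  assume e: "0 < e"
  then obtain d where d: "0 < d" "\<And>E l. E \<in> sets lebesgue \<Longrightarrow> E \<subseteq> K \<Longrightarrow> emeasure lebesgue E \<le> ennreal d \<Longrightarrow>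
     (\<integral>\<^sup>+x\<in>E. ennreal (norm (\<theta> l x)) \<partial>lebesgue) \<le> ennreal e"
    using ui K unfolding locally_uniformly_integrable_def by metis
  have "(LINT x:E|lebesgue. \<bar>\<theta> l x $ i\<bar>) \<le> e"
    if E: "E \<in> sets lebesgue" "E \<subseteq> K" "measure lebesgue E \<le> d" for E l
  proof (rule set_integral_abs_le_of_nn_integral[OF inti[OF E(1,2)]])
    have "E \<in> lmeasurable" using E Km fmeasurableI2 by blast
    then have "emeasure lebesgue E \<le> ennreal d" using E(3) by (simp add: emeasure_eq_measure2 ennreal_leI)
    then show "(\<integral>\<^sup>+x\<in>E. ennreal (norm (\<theta> l x)) \<partial>lebesgue) \<le> ennreal e" by (rule d(2)[OF E(1,2)])
  qed (use e component_le_norm_cart in auto)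
  then show "\<exists>d>0. \<forall>E\<in>sets lebesgue. E \<subseteq> K \<and> measure lebesgue E \<le> d \<longrightarrow>
       (\<forall>l. (LINT x:E|lebesgue. \<bar>\<theta> l x $ i\<bar>) \<le> e)"
    using d(1) by (intro exI[of _ d]) simp
qed

text \<open>The filter is fixed before the component is chosen, so the weak limits of all components
  hold along one and the same filter.\<close>

lemma locally_uniformly_integrable_weak_limit:
  fixes \<theta> :: "nat \<Rightarrow> real ^ 'm::finite \<Rightarrow> real ^ 'k::finite"
  assumes \<Omega>: "open \<Omega>" and ui: "locally_uniformly_integrable \<Omega> \<theta>"
    and int: "\<And>l. locally_integrable \<Omega> (\<theta> l)"
  obtains F h where "F \<noteq> bot" "F \<le> sequentially" "locally_integrable \<Omega> h"
    "\<And>K E i. compact K \<Longrightarrow> K \<subseteq> \<Omega> \<Longrightarrow> E \<in> sets lebesgue \<Longrightarrow> E \<subseteq> K \<Longrightarrow>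
       ((\<lambda>l. LINT x:E|lebesgue. \<theta> l x $ i) \<longlongrightarrow> (LINT x:E|lebesgue. h x $ i)) F"
proof -
  obtain F :: "nat filter" where F: "F \<le> sequentially" "F \<noteq> bot"
     "\<And>a::nat \<Rightarrow> real. bounded (range a) \<Longrightarrow> \<exists>L. (a \<longlongrightarrow> L) F"
    using exists_filter_all_bounded_convergent by metis
  have intK: "\<theta> l absolutely_integrable_on K" if "compact K" "K \<subseteq> \<Omega>" for l K
    using int that unfolding locally_integrable_def by blast
  have "\<forall>i. \<exists>h. (\<forall>K. compact K \<and> K \<subseteq> \<Omega> \<longrightarrow> h absolutely_integrable_on K) \<and>
     (\<forall>K E. compact K \<and> K \<subseteq> \<Omega> \<and> E \<in> sets lebesgue \<and> E \<subseteq> K \<longrightarrow>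
        ((\<lambda>l. LINT x:E|lebesgue. \<theta> l x $ i) \<longlongrightarrow> (LINT x:E|lebesgue. h x)) F)"
  proof (intro allI locally_uniformly_integrable_weak_limit_real[OF F(2) _ \<Omega>])
    fix i
    show "\<exists>L. (a \<longlongrightarrow> L) F" if "bounded (range a)" for a :: "nat \<Rightarrow> real" using F(3) that .
    fix K assume K: "compact K" "K \<subseteq> \<Omega>"
    show "(\<lambda>x. \<theta> l x $ i) absolutely_integrable_on K" for l
      using absolutely_integrable_component[OF intK[OF K, of l], of "axis i 1"] by (simp add: inner_axis)
    show "\<exists>B. \<forall>l. (LINT x:K|lebesgue. \<bar>\<theta> l x $ i\<bar>) \<le> B"
      by (rule locally_uniformly_integrable_component(1)[OF ui K intK[OF K]])
    show "\<exists>d>0. \<forall>E\<in>sets lebesgue. E \<subseteq> K \<and> measure lebesgue E \<le> d \<longrightarrow>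
       (\<forall>l. (LINT x:E|lebesgue. \<bar>\<theta> l x $ i\<bar>) \<le> e)" if "0 < e" for e
      by (rule locally_uniformly_integrable_component(2)[OF ui K intK[OF K] that])
  qed
  from choice[OF this] obtain h where h: "\<forall>i. (\<forall>K. compact K \<and> K \<subseteq> \<Omega> \<longrightarrow> h i absolutely_integrable_on K) \<and>
     (\<forall>K E. compact K \<and> K \<subseteq> \<Omega> \<and> E \<in> sets lebesgue \<and> E \<subseteq> K \<longrightarrow>
        ((\<lambda>l. LINT x:E|lebesgue. \<theta> l x $ i) \<longlongrightarrow> (LINT x:E|lebesgue. h i x)) F)" by (rule exE)
  show thesis
  proof (rule that[of F "\<lambda>x. \<chi> i. h i x"])
    show "locally_integrable \<Omega> (\<lambda>x. \<chi> i. h i x)"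
      unfolding locally_integrable_def
    proof (intro allI impI)
      fix K assume K: "compact K \<and> K \<subseteq> \<Omega>"
      show "(\<lambda>x. \<chi> i. h i x) absolutely_integrable_on K"
      proof (subst absolutely_integrable_componentwise_iff, rule ballI)
        fix b :: "real ^ 'k" assume "b \<in> Basis"
        then obtain i where "b = axis i 1" by (auto simp: Basis_vec_def)
        then show "(\<lambda>x. (\<chi> i. h i x) \<bullet> b) absolutely_integrable_on K"
          using h K by (simp add: inner_axis)
      qed
    qed
  qed (use F(1,2) h in auto)
qed


section \<open>Limits of weak derivatives\<close>

text \<open>Testing with open sets needs no metric on the target and is stable under composition
  with continuous maps. Only compact sets are tested, because the comparison between charts is
  controlled only locally.\<close>

definition converges_in_measure_on ::
  "'x::euclidean_space set \<Rightarrow> (nat \<Rightarrow> 'x \<Rightarrow> 'y::topological_space) \<Rightarrow> ('x \<Rightarrow> 'y) \<Rightarrow> bool" where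
  "converges_in_measure_on \<Omega> g g0 \<longleftrightarrow>
     (\<forall>K U. compact K \<and> K \<subseteq> \<Omega> \<and> open U \<longrightarrow>
        (\<lambda>l. emeasure lebesgue {x \<in> K. g0 x \<in> U \<and> g l x \<notin> U}) \<longlonglongrightarrow> 0)"

lemma converges_in_measure_on_compose:
  assumes "converges_in_measure_on \<Omega> g g0" "continuous_on UNIV \<phi>"
  shows "converges_in_measure_on \<Omega> (\<lambda>l x. \<phi> (g l x)) (\<lambda>x. \<phi> (g0 x))"
  unfolding converges_in_measure_on_def
proof (intro allI impI)
  fix K :: "'a set" and U :: "'c set" assume K: "compact K \<and> K \<subseteq> \<Omega> \<and> open U"
  have "open (\<phi> -` U)" using assms(2) K by (simp add: open_vimage)
  with K assms(1) have "(\<lambda>l. emeasure lebesgue {x \<in> K. g0 x \<in> \<phi> -` U \<and> g l x \<notin> \<phi> -` U}) \<longlonglongrightarrow> 0"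
    unfolding converges_in_measure_on_def by blast
  then show "(\<lambda>l. emeasure lebesgue {x \<in> K. \<phi> (g0 x) \<in> U \<and> \<phi> (g l x) \<notin> U}) \<longlonglongrightarrow> 0" by simp
qed

lemma converges_in_measure_on_dist:
  fixes g :: "nat \<Rightarrow> 'x::euclidean_space \<Rightarrow> real"
  assumes conv: "converges_in_measure_on \<Omega> g g0" and K: "compact K" "K \<subseteq> \<Omega>"
    and g: "\<And>l. g l \<in> borel_measurable (lebesgue_on K)" and g0: "g0 \<in> borel_measurable (lebesgue_on K)"
    and e: "0 < e"
  shows "(\<lambda>l. measure (lebesgue_on K) {x \<in> space (lebesgue_on K). e < dist (g l x) (g0 x)}) \<longlonglongrightarrow> 0"
proof -
  have Km: "K \<in> lmeasurable" using K(1) by (rule lmeasurable_compact)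
  interpret finite_measure "lebesgue_on K" using Km by (rule finite_measure_lebesgue_on)
  show ?thesis
  proof (rule open_set_convergence_imp_in_measure[OF g g0 _ e])
    fix U :: "real set" assume U: "open U"
    have "(\<lambda>l. emeasure lebesgue {x \<in> K. g0 x \<in> U \<and> g l x \<notin> U}) \<longlonglongrightarrow> ennreal 0"
      using conv K U unfolding converges_in_measure_on_def by simp
    from tendsto_enn2real[OF this]
    have "(\<lambda>l. measure lebesgue {x \<in> K. g0 x \<in> U \<and> g l x \<notin> U}) \<longlonglongrightarrow> 0"
      by (simp add: measure_def)
    then show "(\<lambda>l. measure (lebesgue_on K) {x \<in> space (lebesgue_on K). g0 x \<in> U \<and> g l x \<notin> U}) \<longlonglongrightarrow> 0"
      using Km by (subst measure_restrict_space) (auto simp: fmeasurableD)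
  qed
qed

lemma set_integral_restrict_support:
  fixes f :: "'x::euclidean_space \<Rightarrow> real"
  assumes "K \<subseteq> \<Omega>" "\<And>x. x \<notin> K \<Longrightarrow> f x = 0" "K \<in> sets lebesgue"
  shows "(LINT x:\<Omega>|lebesgue. f x) = (\<integral>x. f x \<partial>lebesgue_on K)"
proof -
  have "(\<lambda>x. indicator \<Omega> x *\<^sub>R f x) = (\<lambda>x. indicator K x *\<^sub>R f x)"
    using assms(1,2) by (fastforce simp: indicator_def)
  then show ?thesis using assms(3)
    by (simp only: set_lebesgue_integral_def integral_restrict_space sets.Int_space_eq2)
qed

lemma set_integral_test_tendsto:
  fixes g :: "nat \<Rightarrow> 'x::euclidean_space \<Rightarrow> real"
  assumes conv: "converges_in_measure_on \<Omega> g g0"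
    and g: "\<And>l K. compact K \<Longrightarrow> K \<subseteq> \<Omega> \<Longrightarrow> g l \<in> borel_measurable (lebesgue_on K)"
    and g0: "\<And>K. compact K \<Longrightarrow> K \<subseteq> \<Omega> \<Longrightarrow> g0 \<in> borel_measurable (lebesgue_on K)"
    and bd: "\<And>l x. \<bar>g l x\<bar> \<le> B" "\<And>x. \<bar>g0 x\<bar> \<le> B"
    and \<phi>: "continuous_on UNIV \<phi>" and K: "compact K" "K \<subseteq> \<Omega>" "\<And>x. x \<notin> K \<Longrightarrow> \<phi> x = 0"
  shows "(\<lambda>l. LINT x:\<Omega>|lebesgue. g l x * \<phi> x) \<longlonglongrightarrow> (LINT x:\<Omega>|lebesgue. g0 x * \<phi> x)"
proof -
  have Km: "K \<in> lmeasurable" using K(1) by (rule lmeasurable_compact)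
  interpret finite_measure "lebesgue_on K" using Km by (rule finite_measure_lebesgue_on)
  have "bounded (\<phi> ` K)"
    by (intro compact_imp_bounded compact_continuous_image continuous_on_subset[OF \<phi>] K) simp
  then obtain C where C: "\<And>x. x \<in> K \<Longrightarrow> \<bar>\<phi> x\<bar> \<le> C" unfolding bounded_iff by (metis imageI real_norm_def)
  have C': "\<bar>\<phi> x\<bar> \<le> max C 0" for x using C[of x] K(3)[of x] by (cases "x \<in> K") auto
  have \<phi>m: "\<phi> \<in> borel_measurable (lebesgue_on K)"
    using Km by (intro continuous_imp_measurable_on_sets_lebesgue continuous_on_subset[OF \<phi>]) (auto simp: fmeasurableD)
  have eq: "(LINT x:\<Omega>|lebesgue. k x * \<phi> x) = (\<integral>x. k x * \<phi> x \<partial>lebesgue_on K)" for k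
    by (rule set_integral_restrict_support) (use K Km in \<open>auto simp: fmeasurableD\<close>)
  show ?thesis unfolding eq
    by (rule bounded_in_measure_imp_integral_tendsto[OF g[OF K(1,2)] g0[OF K(1,2)] bd \<phi>m C'
          converges_in_measure_on_dist[OF conv K(1,2) g[OF K(1,2)] g0[OF K(1,2)]]])
qed

text \<open>Both sides of the integration by parts formula converge along the filter: the left side
  because it converges along the whole sequence, the right side by weak convergence against the
  bounded field \<open>v\<close>. The filter and the weak convergence are exported so that
  \<open>h\<close> can later be compared with a limit in measure.\<close>

lemma has_weak_derivative_limit:
  fixes \<theta> :: "nat \<Rightarrow> real ^ 'm::finite \<Rightarrow> real ^ 'm"
  assumes \<Omega>: "open \<Omega>" and ui: "locally_uniformly_integrable \<Omega> \<theta>"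
    and wd: "\<And>l. has_weak_derivative \<Omega> (g l) (\<theta> l)" and g0: "locally_integrable \<Omega> g0"
    and lim: "\<And>v. v \<in> C1c_vector_fields \<Omega> \<Longrightarrow>
      (\<lambda>l. LINT x:\<Omega>|lebesgue. g l x * divergence v x) \<longlonglongrightarrow> (LINT x:\<Omega>|lebesgue. g0 x * divergence v x)"
  obtains F h where "F \<noteq> bot" "F \<le> sequentially" "has_weak_derivative \<Omega> g0 h"
    "\<And>K E i. compact K \<Longrightarrow> K \<subseteq> \<Omega> \<Longrightarrow> E \<in> sets lebesgue \<Longrightarrow> E \<subseteq> K \<Longrightarrow>
       ((\<lambda>l. LINT x:E|lebesgue. \<theta> l x $ i) \<longlongrightarrow> (LINT x:E|lebesgue. h x $ i)) F"
proof -
  have int: "locally_integrable \<Omega> (\<theta> l)" for l using wd unfolding has_weak_derivative_def by blast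
  obtain F h where F: "F \<noteq> bot" "F \<le> sequentially" and h: "locally_integrable \<Omega> h"
    "\<And>K E i. compact K \<Longrightarrow> K \<subseteq> \<Omega> \<Longrightarrow> E \<in> sets lebesgue \<Longrightarrow> E \<subseteq> K \<Longrightarrow>
       ((\<lambda>l. LINT x:E|lebesgue. \<theta> l x $ i) \<longlongrightarrow> (LINT x:E|lebesgue. h x $ i)) F"
    by (rule locally_uniformly_integrable_weak_limit[OF \<Omega> ui int]) (rule that)
  have "(LINT x:\<Omega>|lebesgue. g0 x * divergence v x) = - (LINT x:\<Omega>|lebesgue. h x \<bullet> v x)"
    if v: "v \<in> C1c_vector_fields \<Omega>" for v
  proof (rule tendsto_unique[OF F(1)])
    show "((\<lambda>l. LINT x:\<Omega>|lebesgue. g l x * divergence v x) \<longlongrightarrow> (LINT x:\<Omega>|lebesgue. g0 x * divergence v x)) F"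
      by (rule tendsto_mono[OF F(2) lim[OF v]])
    obtain K where K: "compact K" "K \<subseteq> \<Omega>" "\<And>x. x \<notin> K \<Longrightarrow> v x = 0" and v1: "C1_on UNIV v"
      using v unfolding C1c_vector_fields_def by auto
    have Km: "K \<in> lmeasurable" using K(1) by (rule lmeasurable_compact)
    interpret finite_measure "lebesgue_on K" using Km by (rule finite_measure_lebesgue_on)
    have vc: "continuous_on UNIV (\<lambda>x. v x $ i)" for i
      by (intro bounded_linear.continuous_on[OF bounded_linear_vec_nth] C1_on_continuous_on[OF v1])
    have vm: "(\<lambda>x. v x $ i) \<in> borel_measurable (lebesgue_on K)" for i
      using Km by (intro continuous_imp_measurable_on_sets_lebesgue continuous_on_subset[OF vc]) (auto simp: fmeasurableD)
    have "bounded (v ` K)"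
      by (intro compact_imp_bounded compact_continuous_image continuous_on_subset[OF C1_on_continuous_on[OF v1]] K) simp
    then obtain C where C: "\<And>x. x \<in> K \<Longrightarrow> norm (v x) \<le> C" unfolding bounded_iff by (metis imageI)
    have C': "\<bar>v x $ i\<bar> \<le> max C 0" for x i
      using C[of x] K(3)[of x] component_le_norm_cart[of "v x" i] by (cases "x \<in> K") auto
    have ii: "integrable (lebesgue_on K) (\<lambda>x. k x $ i)" if "locally_integrable \<Omega> k" for k :: "real ^ 'm \<Rightarrow> real ^ 'm" and i
    proof -
      have "k absolutely_integrable_on K" using that K unfolding locally_integrable_def by blast
      from absolutely_integrable_component[OF this, of "axis i 1"] show ?thesis
        using Km by (simp add: inner_axis set_integrable_def integrable_restrict_space fmeasurableD)
    qed
    have iv: "integrable (lebesgue_on K) (\<lambda>x. k x $ i * v x $ i)" if "locally_integrable \<Omega> k" for k :: "real ^ 'm \<Rightarrow> real ^ 'm" and i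
    proof (rule Bochner_Integration.integrable_bound)
      show "integrable (lebesgue_on K) (\<lambda>x. max C 0 * k x $ i)" using ii[OF that] by (rule integrable_mult_right)
      show "(\<lambda>x. k x $ i * v x $ i) \<in> borel_measurable (lebesgue_on K)"
        using borel_measurable_integrable[OF ii[OF that]] vm by (rule borel_measurable_times)
      have "norm (k x $ i * v x $ i) \<le> norm (max C 0 * k x $ i)" for x
        using mult_right_mono[OF C'[of x i], of "\<bar>k x $ i\<bar>"] by (simp add: abs_mult mult.commute)
      then show "AE x in lebesgue_on K. norm (k x $ i * v x $ i) \<le> norm (max C 0 * k x $ i)" by simp
    qed
    have eq: "(LINT x:\<Omega>|lebesgue. k x \<bullet> v x) = (\<Sum>i\<in>UNIV. \<integral>x. k x $ i * v x $ i \<partial>lebesgue_on K)"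
      if "locally_integrable \<Omega> k" for k
    proof -
      have "(LINT x:\<Omega>|lebesgue. k x \<bullet> v x) = (\<integral>x. k x \<bullet> v x \<partial>lebesgue_on K)"
        by (rule set_integral_restrict_support) (use K Km in \<open>auto simp: fmeasurableD\<close>)
      also have "\<dots> = (\<Sum>i\<in>UNIV. \<integral>x. k x $ i * v x $ i \<partial>lebesgue_on K)"
        unfolding inner_vec_def inner_real_def
        by (rule Bochner_Integration.integral_sum[OF iv[OF that]])
      finally show ?thesis .
    qed
    have "((\<lambda>l. LINT x:\<Omega>|lebesgue. \<theta> l x \<bullet> v x) \<longlongrightarrow> (LINT x:\<Omega>|lebesgue. h x \<bullet> v x)) F"
      unfolding eq[OF int] eq[OF h(1)]
    proof (rule tendsto_sum)
      fix i
      obtain B where B: "\<And>l. (LINT x:K|lebesgue. \<bar>\<theta> l x $ i\<bar>) \<le> B"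
        using locally_uniformly_integrable_component(1)[OF ui K(1,2)] int K
        unfolding locally_integrable_def by metis
      show "((\<lambda>l. \<integral>x. \<theta> l x $ i * v x $ i \<partial>lebesgue_on K) \<longlongrightarrow> (\<integral>x. h x $ i * v x $ i \<partial>lebesgue_on K)) F"
      proof (rule set_integrals_tendsto_imp_bounded_integrals_tendsto[OF ii[OF int] ii[OF h(1)] _ _ vm C'])
        show "(\<integral>x. \<bar>\<theta> l x $ i\<bar> \<partial>lebesgue_on K) \<le> B" for l
          using B[of l] Km by (simp add: integral_restrict_space set_lebesgue_integral_def fmeasurableD)
        fix E assume "E \<in> sets (lebesgue_on K)"
        then have E: "E \<in> sets lebesgue" "E \<subseteq> K" using Km by (auto simp: sets_restrict_space_iff fmeasurableD)
        show "((\<lambda>l. LINT x:E|lebesgue_on K. \<theta> l x $ i) \<longlongrightarrow> (LINT x:E|lebesgue_on K. h x $ i)) F"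
          unfolding set_integral_lebesgue_on[OF fmeasurableD[OF Km] E(2)] by (rule h(2)[OF K(1,2) E])
      qed
    qed
    moreover have "(LINT x:\<Omega>|lebesgue. g l x * divergence v x) = - (LINT x:\<Omega>|lebesgue. \<theta> l x \<bullet> v x)" for l
      using wd[of l] v unfolding has_weak_derivative_def by blast
    ultimately show "((\<lambda>l. LINT x:\<Omega>|lebesgue. g l x * divergence v x) \<longlongrightarrow> - (LINT x:\<Omega>|lebesgue. h x \<bullet> v x)) F"
      by (simp add: tendsto_minus)
  qed
  then have "has_weak_derivative \<Omega> g0 h" unfolding has_weak_derivative_def using g0 h(1) by blast
  from that[OF F this h(2)] show thesis .
qed

lemma weak_limit_eq_limit_in_measure_vec:
  fixes \<theta> :: "nat \<Rightarrow> real ^ 'm::finite \<Rightarrow> real ^ 'k::finite"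
  assumes \<Omega>: "open \<Omega>" and ui: "locally_uniformly_integrable \<Omega> \<theta>"
    and int: "\<And>l. locally_integrable \<Omega> (\<theta> l)" and h: "locally_integrable \<Omega> h"
    and F: "F \<noteq> bot" "F \<le> sequentially"
    and lim: "\<And>K E i. compact K \<Longrightarrow> K \<subseteq> \<Omega> \<Longrightarrow> E \<in> sets lebesgue \<Longrightarrow> E \<subseteq> K \<Longrightarrow>
       ((\<lambda>l. LINT x:E|lebesgue. \<theta> l x $ i) \<longlongrightarrow> (LINT x:E|lebesgue. h x $ i)) F"
    and conv: "converges_in_measure_on \<Omega> \<theta> \<theta>0"
    and \<theta>0: "\<And>K. compact K \<Longrightarrow> K \<subseteq> \<Omega> \<Longrightarrow> \<theta>0 \<in> borel_measurable (lebesgue_on K)"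
  shows "AE x in lebesgue. x \<in> \<Omega> \<longrightarrow> h x = \<theta>0 x"
proof -
  have AEK: "AE x in lebesgue. x \<in> K \<longrightarrow> h x $ i = \<theta>0 x $ i" if K: "compact K" "K \<subseteq> \<Omega>" for K i
  proof -
    have Km: "K \<in> lmeasurable" using K(1) by (rule lmeasurable_compact)
    then have Ks: "K \<in> sets lebesgue" by (rule fmeasurableD)
    interpret finite_measure "lebesgue_on K" using Km by (rule finite_measure_lebesgue_on)
    have ii: "integrable (lebesgue_on K) (\<lambda>x. k x $ i)" if "locally_integrable \<Omega> k" for k :: "real ^ 'm \<Rightarrow> real ^ 'k"
    proof -
      have "k absolutely_integrable_on K" using that K unfolding locally_integrable_def by blast
      from absolutely_integrable_component[OF this, of "axis i 1"] show ?thesis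
        using Ks by (simp add: inner_axis set_integrable_def integrable_restrict_space)
    qed
    have nth: "continuous_on UNIV (\<lambda>y::real ^ 'k. y $ i)"
      by (intro bounded_linear.continuous_on[OF bounded_linear_vec_nth] continuous_on_id)
    have conv': "converges_in_measure_on \<Omega> (\<lambda>l x. \<theta> l x $ i) (\<lambda>x. \<theta>0 x $ i)"
      by (rule converges_in_measure_on_compose[OF conv nth])
    have m0: "(\<lambda>x. \<theta>0 x $ i) \<in> borel_measurable (lebesgue_on K)"
      using measurable_compose[OF \<theta>0[OF K] borel_measurable_continuous_onI[OF nth]] .
    have intK: "\<theta> l absolutely_integrable_on K" for l using int K unfolding locally_integrable_def by blast
    have "AE x in lebesgue_on K. h x $ i = \<theta>0 x $ i"
    proof (rule weak_limit_eq_limit_in_measure[OF F ii[OF int] m0 ii[OF h]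
          converges_in_measure_on_dist[OF conv' K borel_measurable_integrable[OF ii[OF int]] m0]])
      fix e :: real assume "0 < e"
      from locally_uniformly_integrable_component(2)[OF ui K intK this, of i]
      obtain d where d: "0 < d" "\<And>E l. E \<in> sets lebesgue \<Longrightarrow> E \<subseteq> K \<Longrightarrow> measure lebesgue E \<le> d \<Longrightarrow>
         (LINT x:E|lebesgue. \<bar>\<theta> l x $ i\<bar>) \<le> e" by metis
      show "\<exists>d>0. \<forall>E\<in>sets (lebesgue_on K). measure (lebesgue_on K) E \<le> d \<longrightarrow>
         (\<forall>l. (LINT x:E|lebesgue_on K. \<bar>\<theta> l x $ i\<bar>) \<le> e)"
      proof (intro exI conjI ballI impI allI)
        fix E l assume E: "E \<in> sets (lebesgue_on K)" "measure (lebesgue_on K) E \<le> d"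
        then have E': "E \<in> sets lebesgue" "E \<subseteq> K" using Ks by (auto simp: sets_restrict_space_iff)
        then show "(LINT x:E|lebesgue_on K. \<bar>\<theta> l x $ i\<bar>) \<le> e"
          unfolding set_integral_lebesgue_on[OF Ks E'(2)]
          using E(2) Ks d(2)[of E l] by (auto simp: measure_restrict_space)
      qed (rule d(1))
    next
      fix E assume "E \<in> sets (lebesgue_on K)"
      then have E: "E \<in> sets lebesgue" "E \<subseteq> K" using Ks by (auto simp: sets_restrict_space_iff)
      show "((\<lambda>l. LINT x:E|lebesgue_on K. \<theta> l x $ i) \<longlongrightarrow> (LINT x:E|lebesgue_on K. h x $ i)) F"
        unfolding set_integral_lebesgue_on[OF Ks E(2)] by (rule lim[OF K E])
    qed
    then show ?thesis using Ks by (subst (asm) AE_restrict_space_iff) auto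
  qed
  obtain C where C: "\<And>n::nat. compact (C n)" "\<And>n. C n \<subseteq> \<Omega>" "\<Union>(range C) = \<Omega>"
    by (rule open_Union_compact_subsets[OF \<Omega>]) (rule that)
  have "AE x in lebesgue. \<forall>n i. x \<in> C n \<longrightarrow> h x $ i = \<theta>0 x $ i"
    unfolding AE_all_countable using AEK[OF C(1,2)] by blast
  then show ?thesis
    by eventually_elim (use C(3) in \<open>auto simp: vec_eq_iff\<close>)
qed


section \<open>Charts and tangent spaces\<close>

locale C1_manifold =
  fixes A :: "('a::{t2_space, second_countable_topology}, 'm::finite) chart set"
  assumes atlas: "C1_atlas A"
begin

lemma chart_openD:
  assumes "c \<in> charts A"
  shows "open (chart_dom c)" "open (chart_image c)"
    "homeomorphism (chart_dom c) (chart_image c) (chart_map c) (chart_inv c)"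
  using assms unfolding charts_def topological_chart_def by auto

lemma chart_inv_map:
  "c \<in> charts A \<Longrightarrow> x \<in> chart_dom c \<Longrightarrow> chart_inv c (chart_map c x) = x"
  using homeomorphism_apply1[OF chart_openD(3)] .

lemma chart_map_inv:
  "p \<in> chart_image c \<Longrightarrow> chart_map c (chart_inv c p) = p"
  by (rule f_inv_into_f)

lemma chart_inv_in:
  "p \<in> chart_image c \<Longrightarrow> chart_inv c p \<in> chart_dom c"
  by (rule inv_into_into)

text \<open>Images under a chart become preimages under its inverse, which commute with
  intersections and differences; most measurability arguments below rest on this.\<close>

lemma chart_map_image_eq:
  assumes "c \<in> charts A" "P \<subseteq> chart_dom c"
  shows "chart_map c ` P = {p \<in> chart_image c. chart_inv c p \<in> P}"
proof
  show "chart_map c ` P \<subseteq> {p \<in> chart_image c. chart_inv c p \<in> P}"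
    using assms chart_inv_map by auto
  show "{p \<in> chart_image c. chart_inv c p \<in> P} \<subseteq> chart_map c ` P"
    using chart_map_inv[of _ c] by (metis (no_types, lifting) image_eqI mem_Collect_eq subsetI)
qed

lemma chart_image_open:
  assumes "c \<in> charts A" "open P" "P \<subseteq> chart_dom c"
  shows "open (chart_map c ` P)"
proof -
  have "continuous_on (chart_image c) (chart_inv c)"
    using chart_openD(3)[OF assms(1)] by (rule homeomorphism_cont2)
  then have "open (chart_inv c -` P \<inter> chart_image c)"
    using continuous_on_open_vimage[OF chart_openD(2)[OF assms(1)]] assms(2) by blast
  then show ?thesis unfolding chart_map_image_eq[OF assms(1,3)] by (simp add: vimage_def Int_def conj_commute)
qed

lemma chart_preimage_open:
  assumes "c \<in> charts A" "open S"
  shows "open {x \<in> chart_dom c. chart_map c x \<in> S}"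
proof -
  have "continuous_on (chart_dom c) (chart_map c)"
    using chart_openD(3)[OF assms(1)] by (rule homeomorphism_cont1)
  then have "open (chart_map c -` S \<inter> chart_dom c)"
    using continuous_on_open_vimage[OF chart_openD(1)[OF assms(1)]] assms(2) by blast
  then show ?thesis by (simp add: vimage_def Int_def conj_commute)
qed

lemma atlas_subset_charts: "A \<subseteq> charts A"
  using atlas unfolding C1_atlas_def charts_def by blast

lemma atlas_chart_at: obtains a where "a \<in> A" "x \<in> chart_dom a"
  using atlas unfolding C1_atlas_def by blast

lemma chart_at_exists: obtains c where "c \<in> charts_at A x"
  using atlas_chart_at[of x] atlas_subset_charts unfolding charts_at_def by blast

text \<open>Two charts of the maximal atlas are only known to be compatible with the charts in
  \<open>A\<close>. Near each point the transition is therefore factored through a chart of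
  \<open>A\<close>.\<close>

lemma transition_C1:
  assumes c: "c \<in> charts A" and d: "d \<in> charts A"
  shows "C1_on (chart_map c ` (chart_dom c \<inter> chart_dom d)) (chart_map d \<circ> chart_inv c)"
proof (rule C1_on_local)
  fix p assume "p \<in> chart_map c ` (chart_dom c \<inter> chart_dom d)"
  then obtain x where x: "x \<in> chart_dom c" "x \<in> chart_dom d" "p = chart_map c x" by auto
  obtain a where a: "a \<in> A" "x \<in> chart_dom a" by (rule atlas_chart_at)
  have a': "a \<in> charts A" using a atlas_subset_charts by blast
  let ?P = "chart_dom c \<inter> chart_dom d \<inter> chart_dom a"
  let ?T = "chart_map c ` ?P"
  have T: "open ?T"
    using chart_openD(1)[OF c] chart_openD(1)[OF d] chart_openD(1)[OF a'] by (intro chart_image_open[OF c]) auto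
  have ca: "C1_on ?T (chart_map a \<circ> chart_inv c)"
  proof (rule C1_on_subset)
    show "C1_on (chart_map c ` (chart_dom c \<inter> chart_dom a)) (chart_map a \<circ> chart_inv c)"
      using c a(1) unfolding charts_def C1_compatible_def by auto
  qed auto
  have ad: "C1_on (chart_map a ` (chart_dom d \<inter> chart_dom a)) (chart_map d \<circ> chart_inv a)"
    using d a(1) unfolding charts_def C1_compatible_def by auto
  have "C1_on ?T ((chart_map d \<circ> chart_inv a) \<circ> (chart_map a \<circ> chart_inv c))"
    using chart_inv_map[OF c] by (intro C1_on_compose[OF ca ad]) auto
  then have "C1_on ?T (chart_map d \<circ> chart_inv c)"
    by (rule C1_on_cong[OF _ T]) (use chart_inv_map[OF c] chart_inv_map[OF a'] in auto)
  then show "\<exists>T. open T \<and> p \<in> T \<and> C1_on T (chart_map d \<circ> chart_inv c)"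
    using T x a by (intro exI[of _ ?T]) auto
qed

lemma transition_has_derivative:
  assumes "c \<in> charts_at A x" "d \<in> charts_at A x"
  shows "(chart_map d \<circ> chart_inv c has_derivative transition_deriv c d x) (at (chart_map c x))"
  unfolding transition_deriv_def
  by (rule C1_on_has_derivative[OF transition_C1]) (use assms in \<open>auto simp: charts_at_def\<close>)

lemma transition_deriv_linear:
  assumes "c \<in> charts_at A x" "d \<in> charts_at A x"
  shows "bounded_linear (transition_deriv c d x)"
  using transition_has_derivative[OF assms] by (rule has_derivative_bounded_linear)

lemma transition_deriv_chain:
  assumes c: "c \<in> charts_at A x" and d: "d \<in> charts_at A x" and e: "e \<in> charts_at A x"
  shows "transition_deriv d e x (transition_deriv c d x w) = transition_deriv c e x w"
proof -
  have cs: "c \<in> charts A" "d \<in> charts A" "e \<in> charts A" and x: "x \<in> chart_dom c" "x \<in> chart_dom d" "x \<in> chart_dom e"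
    using assms by (auto simp: charts_at_def)
  have eq: "(chart_map d \<circ> chart_inv c) (chart_map c x) = chart_map d x"
    using chart_inv_map[OF cs(1) x(1)] by simp
  have "((chart_map e \<circ> chart_inv d) \<circ> (chart_map d \<circ> chart_inv c) has_derivative
      transition_deriv d e x \<circ> transition_deriv c d x) (at (chart_map c x))"
    by (rule diff_chain_at[OF transition_has_derivative[OF c d]])
       (use transition_has_derivative[OF d e] eq in simp)
  then have "(chart_map e \<circ> chart_inv c has_derivative
      transition_deriv d e x \<circ> transition_deriv c d x) (at (chart_map c x))"
  proof (rule has_derivative_transform_within_open)
    show "open (chart_map c ` (chart_dom c \<inter> chart_dom d))"
      using chart_openD(1)[OF cs(1)] chart_openD(1)[OF cs(2)] by (intro chart_image_open[OF cs(1)]) auto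
    show "chart_map c x \<in> chart_map c ` (chart_dom c \<inter> chart_dom d)" using x by blast
  qed (use chart_inv_map[OF cs(1)] chart_inv_map[OF cs(2)] in auto)
  from frechet_derivative_at[OF this] show ?thesis
    unfolding transition_deriv_def[of c e] by (metis comp_apply)
qed

lemma transition_deriv_self:
  assumes c: "c \<in> charts_at A x"
  shows "transition_deriv c c x w = w"
proof -
  have cs: "c \<in> charts A" "x \<in> chart_dom c" using c by (auto simp: charts_at_def)
  have "((\<lambda>p. p) has_derivative (\<lambda>w. w)) (at (chart_map c x))" by (rule has_derivative_ident)
  then have "(chart_map c \<circ> chart_inv c has_derivative (\<lambda>w. w)) (at (chart_map c x))"
    by (rule has_derivative_transform_within_open[OF _ chart_openD(2)[OF cs(1)]])
       (use cs chart_inv_map[OF cs(1)] in auto)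
  from frechet_derivative_at[OF this] show ?thesis unfolding transition_deriv_def by metis
qed

section \<open>Tangent vectors and differentials in coordinates\<close>

lemma tangent_spaceD:
  "t \<in> tangent_space A x \<Longrightarrow> c \<in> charts_at A x \<Longrightarrow> d \<in> charts_at A x \<Longrightarrow> t d = transition_deriv c d x (t c)"
  unfolding tangent_space_def by blast

lemma chart_inv_deriv_in_tangent_space:
  assumes c: "c \<in> charts_at A x"
  shows "chart_inv_deriv A c x w \<in> tangent_space A x"
proof -
  have "chart_inv_deriv A c x w e = transition_deriv d e x (chart_inv_deriv A c x w d)"
    if "d \<in> charts_at A x" "e \<in> charts_at A x" for d e
    unfolding chart_inv_deriv_def using that transition_deriv_chain[OF c that] by simp
  moreover have "chart_inv_deriv A c x w d = 0" if "d \<notin> charts_at A x" for d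
    using that by (simp add: chart_inv_deriv_def)
  ultimately show ?thesis unfolding tangent_space_def by blast
qed

lemma chart_inv_deriv_self:
  "c \<in> charts_at A x \<Longrightarrow> chart_inv_deriv A c x w c = w"
  unfolding chart_inv_deriv_def by (simp add: transition_deriv_self)

text \<open>Together with \<open>chart_inv_deriv_self\<close> this identifies the tangent space with
  its coordinate space through any single chart; the normalisation to 0 at foreign charts is what
  makes the two families equal as functions.\<close>

lemma chart_inv_deriv_eq:
  assumes c: "c \<in> charts_at A x" and t: "t \<in> tangent_space A x"
  shows "chart_inv_deriv A c x (t c) = t"
proof
  show "chart_inv_deriv A c x (t c) d = t d" for d
  proof (cases "d \<in> charts_at A x")
    case True
    then show ?thesis using tangent_spaceD[OF t c True] by (simp add: chart_inv_deriv_def)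
  next
    case False
    then have "t d = 0" using t unfolding tangent_space_def by blast
    then show ?thesis using False by (simp add: chart_inv_deriv_def)
  qed
qed

lemma tangent_space_eqI:
  assumes "c \<in> charts_at A x" "s \<in> tangent_space A x" "t \<in> tangent_space A x" "s c = t c"
  shows "s = t"
  using chart_inv_deriv_eq[OF assms(1,2)] chart_inv_deriv_eq[OF assms(1,3)] assms(4) by metis

lemma chart_inv_deriv_transition:
  assumes c: "c \<in> charts_at A x" and d: "d \<in> charts_at A x"
  shows "chart_inv_deriv A c x w = chart_inv_deriv A d x (transition_deriv c d x w)"
proof -
  have "chart_inv_deriv A c x w d = transition_deriv c d x w"
    using d by (simp add: chart_inv_deriv_def)
  with chart_inv_deriv_eq[OF d chart_inv_deriv_in_tangent_space[OF c], of w]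
  show ?thesis by (simp only:)
qed

lemma tangent_space_linear:
  assumes s: "s \<in> tangent_space A x" and t: "t \<in> tangent_space A x"
  shows "(\<lambda>c. a *\<^sub>R s c + b *\<^sub>R t c) \<in> tangent_space A x"
proof -
  have "a *\<^sub>R s d + b *\<^sub>R t d = transition_deriv c d x (a *\<^sub>R s c + b *\<^sub>R t c)"
    if "c \<in> charts_at A x" "d \<in> charts_at A x" for c d
    unfolding tangent_spaceD[OF s that] tangent_spaceD[OF t that]
    by (simp add: linear_simps[OF transition_deriv_linear[OF that]])
  moreover have "a *\<^sub>R s c + b *\<^sub>R t c = 0" if "c \<notin> charts_at A x" for c
  proof -
    have "s c = 0" "t c = 0" using s t that unfolding tangent_space_def by blast+
    then show ?thesis by simp
  qed
  ultimately show ?thesis unfolding tangent_space_def by blast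
qed

lemma zero_in_tangent_space: "(\<lambda>c. 0) \<in> tangent_space A x"
proof -
  obtain c where "c \<in> charts_at A x" by (rule chart_at_exists)
  from tangent_space_linear[OF chart_inv_deriv_in_tangent_space[OF this] chart_inv_deriv_in_tangent_space[OF this], of 0 0 0 0]
  show ?thesis by simp
qed

lemma chart_inv_deriv_linear:
  assumes c: "c \<in> charts_at A x"
  shows "chart_inv_deriv A c x (a *\<^sub>R v + b *\<^sub>R w) =
    (\<lambda>d. a *\<^sub>R chart_inv_deriv A c x v d + b *\<^sub>R chart_inv_deriv A c x w d)"
  by (rule tangent_space_eqI[OF c chart_inv_deriv_in_tangent_space[OF c]
        tangent_space_linear[OF chart_inv_deriv_in_tangent_space[OF c] chart_inv_deriv_in_tangent_space[OF c]]])
     (simp add: chart_inv_deriv_self[OF c])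

text \<open>\<open>manifold_deriv\<close> is evaluated in a chart picked by \<open>SOME\<close>. The
  chain rule for the transition map and the transformation law of tangent vectors cancel, so every
  chart around the point gives the same value.\<close>

lemma manifold_deriv_chart:
  assumes f: "\<And>c. c \<in> charts A \<Longrightarrow> C1_on (chart_image c) (f \<circ> chart_inv c)"
    and c: "c \<in> charts_at A x" and t: "t \<in> tangent_space A x"
  shows "manifold_deriv A f x t = frechet_derivative (f \<circ> chart_inv c) (at (chart_map c x)) (t c)"
proof -
  define d where "d = (SOME c. c \<in> charts_at A x)"
  have d: "d \<in> charts_at A x" unfolding d_def using c by (rule someI)
  have cs: "c \<in> charts A" "x \<in> chart_dom c" "d \<in> charts A" "x \<in> chart_dom d"
    using c d by (auto simp: charts_at_def)
  have fd: "(f \<circ> chart_inv d has_derivative frechet_derivative (f \<circ> chart_inv d) (at (chart_map d x))) (at (chart_map d x))"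
    by (rule C1_on_has_derivative[OF f[OF cs(3)]]) (use cs in auto)
  have eq: "(chart_map d \<circ> chart_inv c) (chart_map c x) = chart_map d x"
    using chart_inv_map[OF cs(1,2)] by simp
  have "((f \<circ> chart_inv d) \<circ> (chart_map d \<circ> chart_inv c) has_derivative
      frechet_derivative (f \<circ> chart_inv d) (at (chart_map d x)) \<circ> transition_deriv c d x) (at (chart_map c x))"
    by (rule diff_chain_at[OF transition_has_derivative[OF c d]]) (use fd eq in simp)
  then have "(f \<circ> chart_inv c has_derivative
      frechet_derivative (f \<circ> chart_inv d) (at (chart_map d x)) \<circ> transition_deriv c d x) (at (chart_map c x))"
  proof (rule has_derivative_transform_within_open)
    show "open (chart_map c ` (chart_dom c \<inter> chart_dom d))"
      using chart_openD(1)[OF cs(1)] chart_openD(1)[OF cs(3)] by (intro chart_image_open[OF cs(1)]) auto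
    show "chart_map c x \<in> chart_map c ` (chart_dom c \<inter> chart_dom d)" using cs by blast
  qed (use chart_inv_map[OF cs(1)] chart_inv_map[OF cs(3)] in auto)
  from frechet_derivative_at[OF this]
  have "frechet_derivative (f \<circ> chart_inv c) (at (chart_map c x)) (t c) =
     frechet_derivative (f \<circ> chart_inv d) (at (chart_map d x)) (t d)"
    unfolding tangent_spaceD[OF t c d] by (metis comp_apply)
  then show ?thesis unfolding manifold_deriv_def Let_def d_def by simp
qed

text \<open>On a small neighbourhood both transition maps are Lipschitz. This gives in one package
  what a change of chart costs: a factor for covectors, and factors for measures and
  integrals.\<close>

lemma chart_comparison:
  assumes c: "c \<in> charts_at A x" and d: "d \<in> charts_at A x"
  obtains P L where "open P" "x \<in> P" "P \<subseteq> chart_dom c \<inter> chart_dom d" "0 < L"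
    "\<And>y w. y \<in> P \<Longrightarrow> norm (transition_deriv c d y w) \<le> L * norm w"
    "\<And>E. E \<subseteq> P \<Longrightarrow> chart_map c ` E \<in> sets lebesgue \<Longrightarrow> chart_map d ` E \<in> sets lebesgue \<and>
        emeasure lebesgue (chart_map d ` E) \<le> ennreal L * emeasure lebesgue (chart_map c ` E)"
    "\<And>E. E \<subseteq> P \<Longrightarrow> chart_map d ` E \<in> sets lebesgue \<Longrightarrow> chart_map c ` E \<in> sets lebesgue \<and>
        emeasure lebesgue (chart_map c ` E) \<le> ennreal L * emeasure lebesgue (chart_map d ` E)"
    "\<And>W f. W \<subseteq> P \<Longrightarrow> chart_map c ` W \<in> sets lebesgue \<Longrightarrow> f \<in> borel_measurable (lebesgue_on (chart_map d ` W)) \<Longrightarrow>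
        (\<integral>\<^sup>+p\<in>chart_map c ` W. f (chart_map d (chart_inv c p)) \<partial>lebesgue) \<le>
        ennreal L * (\<integral>\<^sup>+q\<in>chart_map d ` W. f q \<partial>lebesgue)"
proof -
  have cs: "c \<in> charts A" "x \<in> chart_dom c" "d \<in> charts A" "x \<in> chart_dom d"
    using c d by (auto simp: charts_at_def)
  let ?cd = "chart_map d \<circ> chart_inv c" and ?dc = "chart_map c \<circ> chart_inv d"
  have o1: "open (chart_map c ` (chart_dom c \<inter> chart_dom d))"
    using chart_openD(1)[OF cs(1)] chart_openD(1)[OF cs(3)] by (intro chart_image_open[OF cs(1)]) auto
  have o2: "open (chart_map d ` (chart_dom d \<inter> chart_dom c))"
    using chart_openD(1)[OF cs(1)] chart_openD(1)[OF cs(3)] by (intro chart_image_open[OF cs(3)]) auto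
  obtain r1 L1 where r1: "0 < r1" "0 < L1" "ball (chart_map c x) r1 \<subseteq> chart_map c ` (chart_dom c \<inter> chart_dom d)"
    "\<And>y w. y \<in> ball (chart_map c x) r1 \<Longrightarrow> norm (frechet_derivative ?cd (at y) w) \<le> L1 * norm w"
    "\<And>y z. y \<in> ball (chart_map c x) r1 \<Longrightarrow> z \<in> ball (chart_map c x) r1 \<Longrightarrow> norm (?cd y - ?cd z) \<le> L1 * norm (y - z)"
    by (rule C1_on_locally_lipschitz[OF transition_C1[OF cs(1,3)] o1, of "chart_map c x"]) (use cs that in auto)
  obtain r2 L2 where r2: "0 < r2" "0 < L2" "ball (chart_map d x) r2 \<subseteq> chart_map d ` (chart_dom d \<inter> chart_dom c)"
    "\<And>y w. y \<in> ball (chart_map d x) r2 \<Longrightarrow> norm (frechet_derivative ?dc (at y) w) \<le> L2 * norm w"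
    "\<And>y z. y \<in> ball (chart_map d x) r2 \<Longrightarrow> z \<in> ball (chart_map d x) r2 \<Longrightarrow> norm (?dc y - ?dc z) \<le> L2 * norm (y - z)"
    by (rule C1_on_locally_lipschitz[OF transition_C1[OF cs(3,1)] o2, of "chart_map d x"]) (use cs that in auto)
  define P where "P = {y \<in> chart_dom c. chart_map c y \<in> ball (chart_map c x) r1} \<inter>
     {y \<in> chart_dom d. chart_map d y \<in> ball (chart_map d x) r2}"
  define n where "n = CARD('m)"
  \<comment> \<open>One constant that dominates the derivative bound \<open>L1\<close> and the two
    measure distortions \<open>L1 ^ n\<close> and \<open>L2 ^ n\<close>.\<close>
  define L where "L = L1 + L1 ^ n + L2 ^ n"
  have Lge: "L1 \<le> L" "L1 ^ n \<le> L" "L2 ^ n \<le> L" "0 < L" using r1(2) r2(2) by (auto simp: L_def add_pos_pos)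
  have Pc: "y \<in> chart_dom c" "chart_map c y \<in> ball (chart_map c x) r1" "chart_inv c (chart_map c y) = y" if "y \<in> P" for y
    using that chart_inv_map[OF cs(1)] by (auto simp: P_def)
  have Pd: "y \<in> chart_dom d" "chart_map d y \<in> ball (chart_map d x) r2" "chart_inv d (chart_map d y) = y" if "y \<in> P" for y
    using that chart_inv_map[OF cs(3)] by (auto simp: P_def)
  have imcd: "?cd ` chart_map c ` E = chart_map d ` E" if "E \<subseteq> P" for E
    unfolding image_image by (rule image_cong) (use that Pc(3) in auto)
  have imdc: "?dc ` chart_map d ` E = chart_map c ` E" if "E \<subseteq> P" for E
    unfolding image_image by (rule image_cong) (use that Pd(3) in auto)
  have lipc: "norm (?cd p - ?cd q) \<le> L1 * norm (p - q)" if "E \<subseteq> P" "p \<in> chart_map c ` E" "q \<in> chart_map c ` E" for E p q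
    using that Pc(2) by (intro r1(5)) auto
  have lipd: "norm (?dc p - ?dc q) \<le> L2 * norm (p - q)" if "E \<subseteq> P" "p \<in> chart_map d ` E" "q \<in> chart_map d ` E" for E p q
    using that Pd(2) by (intro r2(5)) auto
  show thesis
  proof (rule that[of P L])
    show "open P" unfolding P_def
      by (intro open_Int chart_preimage_open cs open_ball)
    show "x \<in> P" using cs r1(1) r2(1) by (simp add: P_def)
    show "P \<subseteq> chart_dom c \<inter> chart_dom d" by (auto simp: P_def)
    show "0 < L" by (rule Lge)
    show "norm (transition_deriv c d y w) \<le> L * norm w" if "y \<in> P" for y w
    proof -
      have "norm (transition_deriv c d y w) \<le> L1 * norm w"
        unfolding transition_deriv_def by (rule r1(4)[OF Pc(2)[OF that]])
      also have "\<dots> \<le> L * norm w" by (intro mult_right_mono Lge) simp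
      finally show ?thesis .
    qed
    show "chart_map d ` E \<in> sets lebesgue \<and>
        emeasure lebesgue (chart_map d ` E) \<le> ennreal L * emeasure lebesgue (chart_map c ` E)"
      if E: "E \<subseteq> P" "chart_map c ` E \<in> sets lebesgue" for E
    proof -
      have "?cd ` chart_map c ` E \<in> sets lebesgue \<and> emeasure lebesgue (?cd ` chart_map c ` E) \<le>
          ennreal (L1 ^ DIM(real ^ 'm)) * emeasure lebesgue (chart_map c ` E)"
        by (rule lipschitz_image_lebesgue[OF lipc[OF E(1)] E(2) r1(2)])
      moreover have "ennreal (L1 ^ DIM(real ^ 'm)) * emeasure lebesgue (chart_map c ` E) \<le> ennreal L * emeasure lebesgue (chart_map c ` E)"
        using Lge(2) by (intro mult_right_mono ennreal_leI) (auto simp: n_def)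
      ultimately show ?thesis unfolding imcd[OF E(1)] by (meson order_trans)
    qed
    show "chart_map c ` E \<in> sets lebesgue \<and>
        emeasure lebesgue (chart_map c ` E) \<le> ennreal L * emeasure lebesgue (chart_map d ` E)"
      if E: "E \<subseteq> P" "chart_map d ` E \<in> sets lebesgue" for E
    proof -
      have "?dc ` chart_map d ` E \<in> sets lebesgue \<and> emeasure lebesgue (?dc ` chart_map d ` E) \<le>
          ennreal (L2 ^ DIM(real ^ 'm)) * emeasure lebesgue (chart_map d ` E)"
        by (rule lipschitz_image_lebesgue[OF lipd[OF E(1)] E(2) r2(2)])
      moreover have "ennreal (L2 ^ DIM(real ^ 'm)) * emeasure lebesgue (chart_map d ` E) \<le> ennreal L * emeasure lebesgue (chart_map d ` E)"
        using Lge(3) by (intro mult_right_mono ennreal_leI) (auto simp: n_def)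
      ultimately show ?thesis unfolding imdc[OF E(1)] by (meson order_trans)
    qed
    show "(\<integral>\<^sup>+p\<in>chart_map c ` W. f (chart_map d (chart_inv c p)) \<partial>lebesgue) \<le>
        ennreal L * (\<integral>\<^sup>+q\<in>chart_map d ` W. f q \<partial>lebesgue)"
      if W: "W \<subseteq> P" "chart_map c ` W \<in> sets lebesgue" "f \<in> borel_measurable (lebesgue_on (chart_map d ` W))" for W f
    proof -
      have "(\<integral>\<^sup>+p\<in>chart_map c ` W. f (?cd p) \<partial>lebesgue) \<le>
          ennreal (L2 ^ DIM(real ^ 'm)) * (\<integral>\<^sup>+q\<in>?cd ` chart_map c ` W. f q \<partial>lebesgue)"
      proof (rule nn_integral_lipschitz_transfer[where h = ?dc, OF lipc[OF W(1)] r1(2) _ r2(2) _ W(2)])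
        show "norm (?dc p - ?dc q) \<le> L2 * norm (p - q)"
          if "p \<in> ?cd ` chart_map c ` W" "q \<in> ?cd ` chart_map c ` W" for p q
          using that lipd[OF W(1)] unfolding imcd[OF W(1)] by blast
        show "?dc (?cd p) = p" if "p \<in> chart_map c ` W" for p
          using that W(1) Pc(3) Pd(3) by auto
        show "f \<in> borel_measurable (lebesgue_on (?cd ` chart_map c ` W))"
          unfolding imcd[OF W(1)] by (rule W(3))
      qed
      also have "\<dots> \<le> ennreal L * (\<integral>\<^sup>+q\<in>chart_map d ` W. f q \<partial>lebesgue)"
        unfolding imcd[OF W(1)] using Lge(3) by (intro mult_right_mono ennreal_leI) (auto simp: n_def)
      finally show ?thesis by simp
    qed
  qed
qed

end


section \<open>Pulling back differentials through the bundle\<close>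

lemma norm_matrix_vector_mult_le:
  fixes Q :: "real ^ 'm::finite ^ 'n::finite"
  shows "norm (Q *v w) \<le> norm Q * norm w"
proof -
  have "norm (Q *v w) = L2_set (\<lambda>i. norm ((Q *v w) $ i)) UNIV" by (simp add: norm_vec_def)
  also have "\<dots> \<le> L2_set (\<lambda>i. norm (Q $ i) * norm w) UNIV"
    by (rule L2_set_mono) (auto simp: matrix_vector_mul_component intro: Cauchy_Schwarz_ineq2)
  also have "\<dots> = norm Q * norm w"
    by (simp add: norm_vec_def[of Q] L2_set_left_distrib)
  finally show ?thesis .
qed

lemma linear_functional_representation:
  fixes g :: "real ^ 'm::finite \<Rightarrow> real"
  assumes "linear g"
  shows "(\<chi> i. g (axis i 1)) \<bullet> w = g w"
proof -
  have "g w = g (\<Sum>i\<in>UNIV. w $ i *\<^sub>R axis i 1)"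
    using basis_expansion[of w] by (simp add: scalar_mult_eq_scaleR)
  also have "\<dots> = (\<Sum>i\<in>UNIV. w $ i * g (axis i 1))"
    by (simp add: linear_sum[OF assms] linear_cmul[OF assms])
  finally show ?thesis by (simp add: inner_vec_def mult.commute)
qed

text \<open>
  The vector that represents the linear form \<open>Df \<circ> L\<close> in the chart \<open>c\<close>; at \<open>hom_section u Du x\<close> it
  represents \<open>D(f \<circ> u)\<close>.
\<close>

definition pullback_covector ::
  "('a::topological_space, 'm::finite) chart set \<Rightarrow> ('b::topological_space, 'n::finite) chart set \<Rightarrow>
   ('b \<Rightarrow> real) \<Rightarrow> ('a, 'm) chart \<Rightarrow> 'a \<times> 'b \<times> (('a, 'm) tangent \<Rightarrow> ('b, 'n) tangent) \<Rightarrow> real ^ 'm" where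
  "pullback_covector A B f c = (\<lambda>(x, y, L). \<chi> i. manifold_deriv B f y (L (chart_inv_deriv A c x (axis i 1))))"

locale C1_manifold_pair = M: C1_manifold A + N: C1_manifold B
  for A :: "('a::{t2_space, second_countable_topology}, 'm::finite) chart set"
    and B :: "('b::{t2_space, second_countable_topology}, 'n::finite) chart set"
begin

lemma tangent_hom_in:
  "L \<in> tangent_hom A B x y \<Longrightarrow> t \<in> tangent_space A x \<Longrightarrow> L t \<in> tangent_space B y"
  unfolding tangent_hom_def by (auto dest: PiE_mem)

lemma tangent_hom_chart_linear:
  assumes L: "L \<in> tangent_hom A B x y" and c: "c \<in> charts_at A x"
  shows "linear (\<lambda>w. L (chart_inv_deriv A c x w) d)"
proof -
  have L': "L (\<lambda>e. a *\<^sub>R s e + b *\<^sub>R t e) = (\<lambda>e. a *\<^sub>R L s e + b *\<^sub>R L t e)"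
    if "s \<in> tangent_space A x" "t \<in> tangent_space A x" for s t a b
    using L that unfolding tangent_hom_def by blast
  have lin: "L (chart_inv_deriv A c x (a *\<^sub>R v + b *\<^sub>R w)) d =
      a *\<^sub>R L (chart_inv_deriv A c x v) d + b *\<^sub>R L (chart_inv_deriv A c x w) d" for a b v w
    unfolding M.chart_inv_deriv_linear[OF c]
    by (subst L') (auto intro: M.chart_inv_deriv_in_tangent_space[OF c])
  show ?thesis
  proof (rule linearI)
    show "L (chart_inv_deriv A c x (v + w)) d = L (chart_inv_deriv A c x v) d + L (chart_inv_deriv A c x w) d" for v w
      using lin[of 1 v 1 w] by simp
    show "L (chart_inv_deriv A c x (a *\<^sub>R v)) d = a *\<^sub>R L (chart_inv_deriv A c x v) d" for a v
      using lin[of a v 0 v] by simp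
  qed
qed

lemma C1c_manifold_C1:
  "f \<in> C1c_manifold B \<Longrightarrow> d \<in> charts B \<Longrightarrow> C1_on (chart_image d) (f \<circ> chart_inv d)"
  unfolding C1c_manifold_def by blast

lemma pullback_chart:
  assumes f: "f \<in> C1c_manifold B" and L: "L \<in> tangent_hom A B x y" and c: "c \<in> charts_at A x" and d: "d \<in> charts_at B y"
  shows "manifold_deriv B f y (L (chart_inv_deriv A c x w)) =
    frechet_derivative (f \<circ> chart_inv d) (at (chart_map d y)) (L (chart_inv_deriv A c x w) d)"
  by (rule N.manifold_deriv_chart[OF C1c_manifold_C1[OF f] d])
     (auto intro: tangent_hom_in[OF L] M.chart_inv_deriv_in_tangent_space[OF c])

lemma C1c_chart_linear:
  assumes f: "f \<in> C1c_manifold B" and d: "d \<in> charts_at B y"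
  shows "linear (frechet_derivative (f \<circ> chart_inv d) (at (chart_map d y)))"
proof -
  have "(f \<circ> chart_inv d has_derivative frechet_derivative (f \<circ> chart_inv d) (at (chart_map d y))) (at (chart_map d y))"
    by (rule C1_on_has_derivative[OF C1c_manifold_C1[OF f]]) (use d in \<open>auto simp: charts_at_def\<close>)
  then show ?thesis by (rule has_derivative_linear)
qed

lemma pullback_covector_inner:
  assumes f: "f \<in> C1c_manifold B" and L: "L \<in> tangent_hom A B x y" and c: "c \<in> charts_at A x"
  shows "pullback_covector A B f c (x, y, L) \<bullet> w = manifold_deriv B f y (L (chart_inv_deriv A c x w))"
proof -
  obtain d where d: "d \<in> charts_at B y" by (rule N.chart_at_exists)
  have "linear (frechet_derivative (f \<circ> chart_inv d) (at (chart_map d y)) \<circ> (\<lambda>w. L (chart_inv_deriv A c x w) d))"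
    by (intro linear_compose tangent_hom_chart_linear[OF L c] C1c_chart_linear[OF f d])
  then have "linear (\<lambda>w. manifold_deriv B f y (L (chart_inv_deriv A c x w)))"
    unfolding pullback_chart[OF f L c d] comp_def .
  from linear_functional_representation[OF this] show ?thesis unfolding pullback_covector_def by simp
qed

text \<open>Covectors transform by the transpose of the transition derivative. Pairing the covector
  with itself and cancelling one factor of its norm gives the bound without writing down the
  transpose.\<close>

lemma pullback_covector_transition_le:
  assumes f: "f \<in> C1c_manifold B" and L: "L \<in> tangent_hom A B x y" and c: "c \<in> charts_at A x" "c' \<in> charts_at A x"
    and K: "\<And>w. norm (transition_deriv c c' x w) \<le> K * norm w"
  shows "norm (pullback_covector A B f c (x, y, L)) \<le> K * norm (pullback_covector A B f c' (x, y, L))"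
proof -
  let ?v = "pullback_covector A B f c (x, y, L)" and ?v' = "pullback_covector A B f c' (x, y, L)"
  have "norm ?v * norm ?v = ?v \<bullet> ?v" by (simp add: power2_norm_eq_inner[symmetric] power2_eq_square)
  also have "\<dots> = ?v' \<bullet> transition_deriv c c' x ?v"
    by (simp add: pullback_covector_inner[OF f L] c M.chart_inv_deriv_transition[OF c])
  also have "\<dots> \<le> norm ?v' * norm (transition_deriv c c' x ?v)" by (rule norm_cauchy_schwarz)
  also have "\<dots> \<le> norm ?v' * (K * norm ?v)" by (intro mult_left_mono K) simp
  finally have "norm ?v * norm ?v \<le> (K * norm ?v') * norm ?v" by (simp add: mult_ac)
  moreover have "0 \<le> K * norm ?v'"
  proof -
    \<comment> \<open>Nonnegativity of \<open>K\<close> is read off from the hypothesis at an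
      arbitrary unit vector.\<close>
    have "0 \<le> K * norm (axis undefined 1 :: real ^ 'm)" using K[of "axis undefined 1"] norm_ge_zero order_trans by blast
    then show ?thesis by (simp add: norm_axis_1)
  qed
  ultimately show ?thesis by (cases "?v = 0") (auto simp: mult_le_cancel_right)
qed

text \<open>The same self-pairing, combined with the fact that the Hilbert-Schmidt norm dominates
  the operator norm, compares \<open>Df \<circ> \<upsilon>\<close> with the quantity that bilocal
  uniform integrability controls.\<close>

lemma pullback_covector_matrix_le:
  assumes f: "f \<in> C1c_manifold B" and L: "\<upsilon> (chart_inv c p) \<in> tangent_hom A B (chart_inv c p) y"
    and c: "c \<in> charts_at A (chart_inv c p)" and d: "d \<in> charts_at B y"
    and K: "\<And>w. \<bar>frechet_derivative (f \<circ> chart_inv d) (at (chart_map d y)) w\<bar> \<le> K * norm w" "0 \<le> K"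
  shows "norm (pullback_covector A B f c (chart_inv c p, y, \<upsilon> (chart_inv c p))) \<le> K * norm (local_matrix A c d \<upsilon> p)"
proof -
  let ?v = "pullback_covector A B f c (chart_inv c p, y, \<upsilon> (chart_inv c p))" and ?Q = "local_matrix A c d \<upsilon> p"
  have Q: "\<upsilon> (chart_inv c p) (chart_inv_deriv A c (chart_inv c p) w) d = ?Q *v w" for w
    unfolding local_matrix_def by (rule fun_cong[OF matrix_vector_mul(2)[OF tangent_hom_chart_linear[OF L c], symmetric]])
  have "norm ?v * norm ?v = ?v \<bullet> ?v" by (simp add: power2_norm_eq_inner[symmetric] power2_eq_square)
  also have "\<dots> = frechet_derivative (f \<circ> chart_inv d) (at (chart_map d y)) (?Q *v ?v)"
    by (simp add: pullback_covector_inner[OF f L c] pullback_chart[OF f L c d] Q)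
  also have "\<dots> \<le> K * norm (?Q *v ?v)" using K(1)[of "?Q *v ?v"] by linarith
  also have "\<dots> \<le> K * (norm ?Q * norm ?v)" by (intro mult_left_mono norm_matrix_vector_mult_le K(2))
  finally have "norm ?v * norm ?v \<le> (K * norm ?Q) * norm ?v" by (simp add: mult_ac)
  moreover have "0 \<le> K * norm ?Q" using K(2) by simp
  ultimately show ?thesis by (cases "?v = 0") (auto simp: mult_le_cancel_right)
qed

section \<open>Open sets of the bundle of linear maps between tangent spaces\<close>

lemma hom_chart_inv_in_tangent_hom:
  assumes c: "c \<in> charts A" and d: "d \<in> charts B" and p: "p \<in> chart_image c" and q: "q \<in> chart_image d"
  shows "(\<lambda>t\<in>tangent_space A (chart_inv c p). chart_inv_deriv B d (chart_inv d q) (Q *v t c))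
     \<in> tangent_hom A B (chart_inv c p) (chart_inv d q)"
proof -
  have d': "d \<in> charts_at B (chart_inv d q)" using d q N.chart_inv_in by (simp add: charts_at_def)
  show ?thesis
    unfolding tangent_hom_def
  proof (intro CollectI conjI ballI allI)
    show "(\<lambda>t\<in>tangent_space A (chart_inv c p). chart_inv_deriv B d (chart_inv d q) (Q *v t c))
      \<in> tangent_space A (chart_inv c p) \<rightarrow>\<^sub>E tangent_space B (chart_inv d q)"
      using N.chart_inv_deriv_in_tangent_space[OF d'] by auto
    fix s t a b assume st: "s \<in> tangent_space A (chart_inv c p)" "t \<in> tangent_space A (chart_inv c p)"
    have "Q *v (a *\<^sub>R s c + b *\<^sub>R t c) = a *\<^sub>R (Q *v s c) + b *\<^sub>R (Q *v t c)"
      by (simp add: matrix_vector_right_distrib matrix_vector_mult_scaleR)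
    then show "(\<lambda>t\<in>tangent_space A (chart_inv c p). chart_inv_deriv B d (chart_inv d q) (Q *v t c))
         (\<lambda>c. a *\<^sub>R s c + b *\<^sub>R t c) =
       (\<lambda>e. a *\<^sub>R (\<lambda>t\<in>tangent_space A (chart_inv c p). chart_inv_deriv B d (chart_inv d q) (Q *v t c)) s e +
            b *\<^sub>R (\<lambda>t\<in>tangent_space A (chart_inv c p). chart_inv_deriv B d (chart_inv d q) (Q *v t c)) t e)"
      using st M.tangent_space_linear[OF st, of a b] by (simp add: N.chart_inv_deriv_linear[OF d'])
  qed
qed

text \<open>This is the continuity of the covector of \<open>Df \<circ> L\<close> in the fixed chart
  \<open>c\<close>, expressed by open preimages. The bundle topology must be tested in every pair of
  charts, so the transition from the test chart \<open>c'\<close> to \<open>c\<close> enters the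
  coordinate expression.\<close>

lemma openin_hom_bundle_pullback:
  assumes f: "f \<in> C1c_manifold B" and c: "c \<in> charts A" and U: "open U"
  shows "openin (hom_bundle A B) {(x, y, L). L \<in> tangent_hom A B x y \<and> x \<in> chart_dom c \<and>
     pullback_covector A B f c (x, y, L) \<in> U}" (is "openin _ ?W")
  unfolding openin_hom_bundle hom_bundle_open_def
proof (intro conjI ballI)
  show "?W \<subseteq> {(x, y, L). L \<in> tangent_hom A B x y}" by auto
  fix c' d assume c': "c' \<in> charts A" and d: "d \<in> charts B"
  \<comment> \<open>\<open>\<Phi>\<close> is \<open>Df\<close> in the chart \<open>d\<close> and
    \<open>\<Psi>\<close> is the derivative of the change from \<open>c\<close> to
    \<open>c'\<close>, both as bounded operators so that continuity makes sense; \<open>G\<close>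
    composes them with the matrix coordinate and is the covector read in the bundle chart.\<close>
  define \<Phi> where "\<Phi> q = Blinfun (frechet_derivative (f \<circ> chart_inv d) (at q))" for q
  define \<Psi> where "\<Psi> p = Blinfun (frechet_derivative (chart_map c' \<circ> chart_inv c) (at p))" for p
  let ?D = "chart_map c' ` (chart_dom c' \<inter> chart_dom c)"
  define G where "G z = (\<chi> i. blinfun_apply (\<Phi> (fst (snd z)))
     (snd (snd z) *v blinfun_apply (\<Psi> ((chart_map c \<circ> chart_inv c') (fst z))) (axis i 1)))"
    for z :: "(real ^ 'm) \<times> (real ^ 'n) \<times> (real ^ 'm ^ 'n)"
  have Dopen: "open ?D"
    using M.chart_openD(1)[OF c] M.chart_openD(1)[OF c'] by (intro M.chart_image_open[OF c']) auto
  have fC1: "C1_on (chart_image d) (f \<circ> chart_inv d)" by (rule C1c_manifold_C1[OF f d])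
  have \<Phi>c: "continuous_on (chart_image d) \<Phi>" using fC1 unfolding C1_on_iff \<Phi>_def by blast
  have \<Psi>c: "continuous_on (chart_map c ` (chart_dom c \<inter> chart_dom c')) \<Psi>"
    using M.transition_C1[OF c c'] unfolding C1_on_iff \<Psi>_def by blast
  have tc: "continuous_on ?D (chart_map c \<circ> chart_inv c')"
    by (rule C1_on_continuous_on[OF M.transition_C1[OF c' c]])
  have tim: "(chart_map c \<circ> chart_inv c') ` ?D \<subseteq> chart_map c ` (chart_dom c \<inter> chart_dom c')"
    using M.chart_inv_map[OF c'] by auto
  let ?S = "?D \<times> chart_image d \<times> (UNIV :: (real ^ 'm ^ 'n) set)"
  have c1: "continuous_on ?S (\<lambda>z. \<Phi> (fst (snd z)))"
    by (rule continuous_on_compose2[OF \<Phi>c]) (auto intro!: continuous_intros)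
  have c2: "continuous_on ?S (\<lambda>z. \<Psi> ((chart_map c \<circ> chart_inv c') (fst z)))"
  proof (rule continuous_on_compose2[OF \<Psi>c])
    show "continuous_on ?S (\<lambda>z. (chart_map c \<circ> chart_inv c') (fst z))"
      by (rule continuous_on_compose2[OF tc]) (auto intro!: continuous_intros)
  qed (use tim in auto)
  have c3: "continuous_on ?S (\<lambda>z. snd (snd z) *v v z)"
    if "continuous_on ?S v" for v :: "_ \<Rightarrow> real ^ 'm"
  proof -
    have "continuous_on ?S (\<lambda>z. \<chi> k. snd (snd z) $ k \<bullet> v z)"
      by (intro continuous_on_vec_lambda continuous_on_inner that
          bounded_linear.continuous_on[OF bounded_linear_vec_nth] continuous_on_snd continuous_on_id)
    moreover have "(\<lambda>z. \<chi> k. snd (snd z) $ k \<bullet> v z) = (\<lambda>z. snd (snd z) *v v z)"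
      by (simp add: fun_eq_iff vec_eq_iff matrix_vector_mul_component)
    ultimately show ?thesis by (simp only:)
  qed
  have "continuous_on ?S G"
    unfolding G_def
    by (intro continuous_on_vec_lambda bounded_bilinear.continuous_on[OF bounded_bilinear_blinfun_apply] c1 c3 c2
        continuous_on_const)
  moreover have "open ?S"
    by (intro open_Times Dopen N.chart_openD(2)[OF d] open_UNIV)
  ultimately have "open (G -` U \<inter> ?S)"
    using continuous_on_open_vimage U by blast
  moreover have "{z \<in> chart_image c' \<times> chart_image d \<times> UNIV. hom_chart_inv A B c' d z \<in> ?W} = G -` U \<inter> ?S"
  proof -
    have key: "hom_chart_inv A B c' d (p, q, Q) \<in> ?W \<longleftrightarrow> G (p, q, Q) \<in> U \<and> p \<in> ?D"
      if p: "p \<in> chart_image c'" and q: "q \<in> chart_image d" for p q Q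
    proof -
      define x where "x = chart_inv c' p"
      define y where "y = chart_inv d q"
      have x: "x \<in> chart_dom c'" "chart_map c' x = p" and y: "y \<in> chart_dom d" "chart_map d y = q"
        unfolding x_def y_def
        by (rule M.chart_inv_in[OF p] M.chart_map_inv[OF p] N.chart_inv_in[OF q] N.chart_map_inv[OF q])+
      define L where "L = (\<lambda>t\<in>tangent_space A x. chart_inv_deriv B d y (Q *v t c'))"
      have L: "L \<in> tangent_hom A B x y"
        using hom_chart_inv_in_tangent_hom[OF c' d p q] unfolding L_def x_def y_def .
      have h: "hom_chart_inv A B c' d (p, q, Q) = (x, y, L)"
        by (simp add: hom_chart_inv_def x_def y_def L_def)
      have pD: "p \<in> ?D \<longleftrightarrow> x \<in> chart_dom c"
      proof
        show "x \<in> chart_dom c" if "p \<in> ?D" using that M.chart_inv_map[OF c'] by (auto simp: x_def)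
        show "p \<in> ?D" if "x \<in> chart_dom c" using that x by blast
      qed
      have d': "d \<in> charts_at B y" using d y by (simp add: charts_at_def)
      have "pullback_covector A B f c (x, y, L) = G (p, q, Q)" if xc: "x \<in> chart_dom c"
      proof -
        have ca: "c \<in> charts_at A x" "c' \<in> charts_at A x" using c c' x xc by (auto simp: charts_at_def)
        have "manifold_deriv B f y (L (chart_inv_deriv A c x w)) =
            blinfun_apply (\<Phi> q) (Q *v blinfun_apply (\<Psi> (chart_map c x)) w)" for w
        proof -
          have "L (chart_inv_deriv A c x w) d = Q *v chart_inv_deriv A c x w c'"
            using M.chart_inv_deriv_in_tangent_space[OF ca(1)] by (simp add: L_def N.chart_inv_deriv_self[OF d'])
          also have "chart_inv_deriv A c x w c' = transition_deriv c c' x w"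
            using ca(2) by (simp add: chart_inv_deriv_def)
          also have "\<dots> = blinfun_apply (\<Psi> (chart_map c x)) w"
            unfolding \<Psi>_def transition_deriv_def[symmetric]
            by (simp add: bounded_linear_Blinfun_apply M.transition_deriv_linear[OF ca])
          finally have "L (chart_inv_deriv A c x w) d = Q *v blinfun_apply (\<Psi> (chart_map c x)) w" .
          moreover have "frechet_derivative (f \<circ> chart_inv d) (at (chart_map d y)) v = blinfun_apply (\<Phi> q) v" for v
            unfolding \<Phi>_def y(2)[symmetric]
            using C1c_chart_linear[OF f d'] by (simp add: bounded_linear_Blinfun_apply linear_conv_bounded_linear)
          ultimately show ?thesis unfolding pullback_chart[OF f L ca(1) d'] by simp
        qed
        then show ?thesis
          unfolding pullback_covector_def G_def by (simp add: x_def)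
      qed
      then show ?thesis unfolding h using L pD by auto
    qed
    show ?thesis
    proof (rule set_eqI)
      fix z :: "(real ^ 'm) \<times> (real ^ 'n) \<times> (real ^ 'm ^ 'n)"
      obtain p q Q where z: "z = (p, q, Q)" by (metis prod_cases3)
      show "z \<in> {z \<in> chart_image c' \<times> chart_image d \<times> UNIV. hom_chart_inv A B c' d z \<in> ?W} \<longleftrightarrow> z \<in> G -` U \<inter> ?S"
        unfolding z using key[of p q Q] by auto
    qed
  qed
  ultimately show "open {z \<in> chart_image c' \<times> chart_image d \<times> UNIV. hom_chart_inv A B c' d z \<in> ?W}" by simp
qed

text \<open>Continuity of the projection onto \<open>N\<close>. It transports measurability and
  convergence in measure from a section to the map it covers.\<close>

lemma openin_hom_bundle_base:
  assumes U: "open U"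
  shows "openin (hom_bundle A B) {(x, y, L). L \<in> tangent_hom A B x y \<and> y \<in> U}" (is "openin _ ?W")
  unfolding openin_hom_bundle hom_bundle_open_def
proof (intro conjI ballI)
  show "?W \<subseteq> {(x, y, L). L \<in> tangent_hom A B x y}" by auto
  fix c d assume c: "c \<in> charts A" and d: "d \<in> charts B"
  have "{z \<in> chart_image c \<times> chart_image d \<times> UNIV. hom_chart_inv A B c d z \<in> ?W} =
     chart_image c \<times> chart_map d ` (U \<inter> chart_dom d) \<times> UNIV"
    using hom_chart_inv_in_tangent_hom[OF c d] N.chart_map_image_eq[OF d, of "U \<inter> chart_dom d"] N.chart_inv_in[of _ d]
    by (fastforce simp: hom_chart_inv_def)
  moreover have "open (chart_map d ` (U \<inter> chart_dom d))"
    using U N.chart_openD(1)[OF d] by (intro N.chart_image_open[OF d]) auto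
  ultimately show "open {z \<in> chart_image c \<times> chart_image d \<times> UNIV. hom_chart_inv A B c d z \<in> ?W}"
    using M.chart_openD(2)[OF c] by (simp add: open_Times)
qed

lemma topspace_hom_bundle: "topspace (hom_bundle A B) = {(x, y, L). L \<in> tangent_hom A B x y}"
proof
  show "topspace (hom_bundle A B) \<subseteq> {(x, y, L). L \<in> tangent_hom A B x y}"
    using openin_topspace[of "hom_bundle A B"] unfolding openin_hom_bundle hom_bundle_open_def by blast
  show "{(x, y, L). L \<in> tangent_hom A B x y} \<subseteq> topspace (hom_bundle A B)"
    using openin_subset[OF openin_hom_bundle_base[OF open_UNIV]] by auto
qed

end


section \<open>Convergence in measure in charts\<close>

lemma ennreal_tendsto_0_mono:
  fixes f g :: "nat \<Rightarrow> ennreal"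
  assumes "\<And>l. f l \<le> g l" "g \<longlonglongrightarrow> 0"
  shows "f \<longlonglongrightarrow> 0"
  by (rule tendsto_sandwich[OF _ _ tendsto_const assms(2)]) (simp_all add: assms(1))

context C1_manifold
begin

lemma chart_cover_compact:
  assumes c: "c \<in> charts A" and K: "compact K" "K \<subseteq> chart_image c"
    and P: "\<And>x. x \<in> chart_dom c \<Longrightarrow> open (P x) \<and> x \<in> P x \<and> P x \<subseteq> chart_dom c"
  obtains T where "finite T" "T \<subseteq> chart_dom c" "K \<subseteq> (\<Union>x\<in>T. chart_map c ` P x)"
proof (rule compactE_image[OF K(1), of "chart_dom c" "\<lambda>x. chart_map c ` P x"])
  show "open (chart_map c ` P x)" if "x \<in> chart_dom c" for x
    using P[OF that] by (intro chart_image_open[OF c]) auto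
  show "K \<subseteq> (\<Union>x\<in>chart_dom c. chart_map c ` P x)"
    using K(2) P by blast
qed (rule that)

lemma chart_measurable_Int:
  assumes c: "c \<in> charts A" and E: "manifold_measurable_set A E"
  shows "{p \<in> chart_image c. chart_inv c p \<in> E} \<in> sets lebesgue"
proof -
  have "chart_map c ` (E \<inter> chart_dom c) \<in> sets lebesgue"
    using E c unfolding manifold_measurable_set_def by blast
  moreover have "chart_map c ` (E \<inter> chart_dom c) = {p \<in> chart_image c. chart_inv c p \<in> E}"
    unfolding chart_map_image_eq[OF c Int_lower2] using chart_inv_map[OF c] by auto
  ultimately show ?thesis by simp
qed

lemma chart_measurable_preimage:
  assumes c: "c \<in> charts A" and u: "manifold_measurable A Y u" and U: "openin Y U"
  shows "{p \<in> chart_image c. u (chart_inv c p) \<in> U} \<in> sets lebesgue"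
  using chart_measurable_Int[OF c, of "u -` U"] u U unfolding manifold_measurable_def by simp

text \<open>The definition offers only some chart around each point. Passing to the given chart
  multiplies measures by a locally bounded factor, and the compact set \<open>K\<close> is covered
  by finitely many of the neighbourhoods on which this factor is under control.\<close>

lemma locally_in_measure_chart:
  assumes conv: "converges_locally_in_measure A Y us u" and c: "c \<in> charts A"
    and K: "compact K" "K \<subseteq> chart_image c" and U: "openin Y U"
  shows "(\<lambda>l. emeasure lebesgue {p \<in> K. u (chart_inv c p) \<in> U \<and> us l (chart_inv c p) \<notin> U}) \<longlonglongrightarrow> 0"
proof -
  have m: "manifold_measurable A Y u" "\<And>l. manifold_measurable A Y (us l)"
    using conv unfolding converges_locally_in_measure_def by auto
  define D where "D l = u -` U - us l -` U" for l
  have Dm: "{p \<in> chart_image e. chart_inv e p \<in> D l} \<in> sets lebesgue" if "e \<in> charts A" for e l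
  proof -
    have "{p \<in> chart_image e. chart_inv e p \<in> D l} =
       {p \<in> chart_image e. u (chart_inv e p) \<in> U} - {p \<in> chart_image e. us l (chart_inv e p) \<in> U}"
      by (auto simp: D_def)
    then show ?thesis
      using chart_measurable_preimage[OF that m(1) U] chart_measurable_preimage[OF that m(2) U] by simp
  qed
  have "\<exists>P. open P \<and> x \<in> P \<and> P \<subseteq> chart_dom c \<and> (\<forall>l. chart_map c ` (P \<inter> D l) \<in> sets lebesgue) \<and>
      (\<lambda>l. emeasure lebesgue (chart_map c ` (P \<inter> D l))) \<longlonglongrightarrow> 0" if x: "x \<in> chart_dom c" for x
  proof -
    obtain d where d: "d \<in> charts_at A x" and dl:
      "(\<lambda>l. emeasure lebesgue (chart_map d ` ((u -` U \<inter> chart_dom d) - us l -` U))) \<longlonglongrightarrow> 0"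
      using conv U unfolding converges_locally_in_measure_def by metis
    have d': "d \<in> charts A" using d by (simp add: charts_at_def)
    have c': "c \<in> charts_at A x" using c x by (simp add: charts_at_def)
    obtain P L where P: "open P" "x \<in> P" "P \<subseteq> chart_dom d \<inter> chart_dom c" "0 < L"
      and PE: "\<And>E. E \<subseteq> P \<Longrightarrow> chart_map d ` E \<in> sets lebesgue \<Longrightarrow> chart_map c ` E \<in> sets lebesgue \<and>
        emeasure lebesgue (chart_map c ` E) \<le> ennreal L * emeasure lebesgue (chart_map d ` E)"
      by (rule chart_comparison[OF d c']) (rule that)
    have dE: "chart_map d ` (P \<inter> D l) \<in> sets lebesgue" for l
    proof -
      have PD: "P \<subseteq> chart_dom d" "P \<inter> D l \<subseteq> chart_dom d" using P(3) by auto
      have "chart_map d ` (P \<inter> D l) = chart_map d ` P \<inter> {p \<in> chart_image d. chart_inv d p \<in> D l}"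
        unfolding chart_map_image_eq[OF d' PD(1)] chart_map_image_eq[OF d' PD(2)] by blast
      moreover have "open (chart_map d ` P)" using P by (intro chart_image_open[OF d']) auto
      ultimately show ?thesis using Dm[OF d'] by (auto simp: lborelD)
    qed
    have Dset: "chart_map d ` ((u -` U \<inter> chart_dom d) - us l -` U) \<in> sets lebesgue" for l
    proof -
      have "chart_map d ` ((u -` U \<inter> chart_dom d) - us l -` U) = {p \<in> chart_image d. chart_inv d p \<in> D l}"
        by (subst chart_map_image_eq[OF d']) (use chart_inv_map[OF d'] in \<open>auto simp: D_def\<close>)
      then show ?thesis using Dm[OF d'] by simp
    qed
    have "emeasure lebesgue (chart_map c ` (P \<inter> D l)) \<le>
        ennreal L * emeasure lebesgue (chart_map d ` ((u -` U \<inter> chart_dom d) - us l -` U))" for l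
    proof -
      have "emeasure lebesgue (chart_map c ` (P \<inter> D l)) \<le> ennreal L * emeasure lebesgue (chart_map d ` (P \<inter> D l))"
        by (rule PE[OF Int_lower1 dE, THEN conjunct2])
      also have "\<dots> \<le> ennreal L * emeasure lebesgue (chart_map d ` ((u -` U \<inter> chart_dom d) - us l -` U))"
        using P(3) by (intro mult_left_mono emeasure_mono Dset image_mono) (auto simp: D_def)
      finally show ?thesis .
    qed
    moreover have "(\<lambda>l. ennreal L * emeasure lebesgue (chart_map d ` ((u -` U \<inter> chart_dom d) - us l -` U))) \<longlonglongrightarrow> 0"
      using ennreal_tendsto_cmult[OF ennreal_less_top dl, of L] unfolding mult_zero_right .
    ultimately have "(\<lambda>l. emeasure lebesgue (chart_map c ` (P \<inter> D l))) \<longlonglongrightarrow> 0"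
      by (rule ennreal_tendsto_0_mono)
    moreover have "chart_map c ` (P \<inter> D l) \<in> sets lebesgue" for l using PE[OF Int_lower1 dE] by (rule conjunct1)
    ultimately show ?thesis using P by (intro exI[of _ P] conjI allI) auto
  qed
  then have "\<forall>x\<in>chart_dom c. \<exists>P. open P \<and> x \<in> P \<and> P \<subseteq> chart_dom c \<and> (\<forall>l. chart_map c ` (P \<inter> D l) \<in> sets lebesgue) \<and>
      (\<lambda>l. emeasure lebesgue (chart_map c ` (P \<inter> D l))) \<longlonglongrightarrow> 0" by (rule ballI)
  from bchoice[OF this] obtain P where P: "\<forall>x\<in>chart_dom c. open (P x) \<and> x \<in> P x \<and> P x \<subseteq> chart_dom c \<and>
      (\<forall>l. chart_map c ` (P x \<inter> D l) \<in> sets lebesgue) \<and>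
      (\<lambda>l. emeasure lebesgue (chart_map c ` (P x \<inter> D l))) \<longlonglongrightarrow> 0" by (rule exE)
  obtain T where T: "finite T" "T \<subseteq> chart_dom c" "K \<subseteq> (\<Union>x\<in>T. chart_map c ` P x)"
    by (rule chart_cover_compact[OF c K, of P]) (use P in auto)
  have "emeasure lebesgue {p \<in> K. u (chart_inv c p) \<in> U \<and> us l (chart_inv c p) \<notin> U} \<le>
      (\<Sum>x\<in>T. emeasure lebesgue (chart_map c ` (P x \<inter> D l)))" for l
  proof -
    have "{p \<in> K. u (chart_inv c p) \<in> U \<and> us l (chart_inv c p) \<notin> U} \<subseteq> (\<Union>x\<in>T. chart_map c ` (P x \<inter> D l))"
    proof
      fix p assume p: "p \<in> {p \<in> K. u (chart_inv c p) \<in> U \<and> us l (chart_inv c p) \<notin> U}"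
      then obtain x y where x: "x \<in> T" "y \<in> P x" "p = chart_map c y" using T(3) by blast
      then have "y \<in> chart_dom c" using P T(2) by blast
      then have "chart_inv c p = y" using chart_inv_map[OF c] x by simp
      then show "p \<in> (\<Union>x\<in>T. chart_map c ` (P x \<inter> D l))" using p x by (auto simp: D_def)
    qed
    then have "emeasure lebesgue {p \<in> K. u (chart_inv c p) \<in> U \<and> us l (chart_inv c p) \<notin> U} \<le>
        emeasure lebesgue (\<Union>x\<in>T. chart_map c ` (P x \<inter> D l))"
      by (rule emeasure_mono) (use P T in blast)
    also have "\<dots> \<le> (\<Sum>x\<in>T. emeasure lebesgue (chart_map c ` (P x \<inter> D l)))"
      by (rule emeasure_subadditive_finite) (use P T in auto)
    finally show ?thesis .
  qed
  moreover have "(\<lambda>l. \<Sum>x\<in>T. emeasure lebesgue (chart_map c ` (P x \<inter> D l))) \<longlonglongrightarrow> (\<Sum>x\<in>T. 0)"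
    by (rule tendsto_sum) (use P T(2) in blast)
  ultimately show ?thesis
    unfolding sum.neutral_const by (rule ennreal_tendsto_0_mono)
qed

end

context C1_manifold_pair
begin

text \<open>Sections converge in measure when tested with open sets of the bundle, and the covectors
  lying in \<open>U\<close> come from such an open set. For bundle morphisms over points of the
  chart the additional conditions defining that set hold automatically.\<close>

lemma pullback_in_measure_chart:
  assumes conv: "converges_locally_in_measure A (hom_bundle A B) (\<lambda>l. hom_section (us l) (Dus l)) (hom_section w \<upsilon>)"
    and bm: "\<And>l. bundle_morphism A B (us l) (Dus l)" and bw: "bundle_morphism A B w \<upsilon>"
    and f: "f \<in> C1c_manifold B" and c: "c \<in> charts A"
  shows "converges_in_measure_on (chart_image c)
    (\<lambda>l p. pullback_covector A B f c (hom_section (us l) (Dus l) (chart_inv c p)))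
    (\<lambda>p. pullback_covector A B f c (hom_section w \<upsilon> (chart_inv c p)))"
  unfolding converges_in_measure_on_def
proof (intro allI impI)
  fix K :: "(real ^ 'm) set" and U :: "(real ^ 'm) set"
  assume K: "compact K \<and> K \<subseteq> chart_image c \<and> open U"
  let ?W = "{(x, y, L). L \<in> tangent_hom A B x y \<and> x \<in> chart_dom c \<and> pullback_covector A B f c (x, y, L) \<in> U}"
  have mem: "hom_section v \<eta> (chart_inv c p) \<in> ?W \<longleftrightarrow> pullback_covector A B f c (hom_section v \<eta> (chart_inv c p)) \<in> U"
    if "bundle_morphism A B v \<eta>" "p \<in> chart_image c" for v \<eta> p
    using that M.chart_inv_in[OF that(2)] by (simp add: bundle_morphism_def hom_section_def)
  have "(\<lambda>l. emeasure lebesgue {p \<in> K. hom_section w \<upsilon> (chart_inv c p) \<in> ?W \<and>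
      hom_section (us l) (Dus l) (chart_inv c p) \<notin> ?W}) \<longlonglongrightarrow> 0"
    using K by (intro M.locally_in_measure_chart[OF conv c _ _ openin_hom_bundle_pullback[OF f c]]) auto
  moreover have "{p \<in> K. hom_section w \<upsilon> (chart_inv c p) \<in> ?W \<and> hom_section (us l) (Dus l) (chart_inv c p) \<notin> ?W} =
     {p \<in> K. pullback_covector A B f c (hom_section w \<upsilon> (chart_inv c p)) \<in> U \<and>
             pullback_covector A B f c (hom_section (us l) (Dus l) (chart_inv c p)) \<notin> U}" for l
  proof (rule Collect_cong)
    fix p
    show "(p \<in> K \<and> hom_section w \<upsilon> (chart_inv c p) \<in> ?W \<and> hom_section (us l) (Dus l) (chart_inv c p) \<notin> ?W) =
     (p \<in> K \<and> pullback_covector A B f c (hom_section w \<upsilon> (chart_inv c p)) \<in> U \<and>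
             pullback_covector A B f c (hom_section (us l) (Dus l) (chart_inv c p)) \<notin> U)"
    proof (cases "p \<in> K")
      case True
      then have p: "p \<in> chart_image c" using K by blast
      show ?thesis unfolding mem[OF bm p] mem[OF bw p] ..
    qed simp
  qed
  ultimately show "(\<lambda>l. emeasure lebesgue {p \<in> K. pullback_covector A B f c (hom_section w \<upsilon> (chart_inv c p)) \<in> U \<and>
             pullback_covector A B f c (hom_section (us l) (Dus l) (chart_inv c p)) \<notin> U}) \<longlonglongrightarrow> 0"
    by (simp only:)
qed

lemma pullback_measurable:
  assumes m: "manifold_measurable A (hom_bundle A B) (hom_section w \<upsilon>)" and bw: "bundle_morphism A B w \<upsilon>"
    and f: "f \<in> C1c_manifold B" and c: "c \<in> charts A" and S: "S \<subseteq> chart_image c" "S \<in> sets lebesgue"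
  shows "(\<lambda>p. pullback_covector A B f c (hom_section w \<upsilon> (chart_inv c p))) \<in> borel_measurable (lebesgue_on S)"
proof (rule borel_measurableI)
  fix U :: "(real ^ 'm) set" assume U: "open U"
  let ?W = "{(x, y, L). L \<in> tangent_hom A B x y \<and> x \<in> chart_dom c \<and> pullback_covector A B f c (x, y, L) \<in> U}"
  have "{p \<in> chart_image c. hom_section w \<upsilon> (chart_inv c p) \<in> ?W} \<in> sets lebesgue"
    by (rule M.chart_measurable_preimage[OF c m openin_hom_bundle_pullback[OF f c U]])
  moreover have "(\<lambda>p. pullback_covector A B f c (hom_section w \<upsilon> (chart_inv c p))) -` U \<inter> S =
     {p \<in> chart_image c. hom_section w \<upsilon> (chart_inv c p) \<in> ?W} \<inter> S"
  proof (rule set_eqI)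
    fix p
    show "p \<in> (\<lambda>p. pullback_covector A B f c (hom_section w \<upsilon> (chart_inv c p))) -` U \<inter> S \<longleftrightarrow>
      p \<in> {p \<in> chart_image c. hom_section w \<upsilon> (chart_inv c p) \<in> ?W} \<inter> S"
    proof (cases "p \<in> S")
      case True
      then have "p \<in> chart_image c" using S by blast
      then show ?thesis using True M.chart_inv_in[of p c] bw by (simp add: bundle_morphism_def hom_section_def)
    qed simp
  qed
  ultimately show "(\<lambda>p. pullback_covector A B f c (hom_section w \<upsilon> (chart_inv c p))) -` U \<inter> space (lebesgue_on S)
      \<in> sets (lebesgue_on S)"
    using S(2) by (simp add: sets_restrict_space_iff)
qed

lemma C1c_continuous: "f \<in> C1c_manifold B \<Longrightarrow> continuous_on UNIV f"
proof (rule continuous_at_imp_continuous_on, rule ballI)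
  fix y assume f: "f \<in> C1c_manifold B"
  obtain d where "d \<in> charts_at B y" by (rule N.chart_at_exists)
  then have d: "d \<in> charts B" "y \<in> chart_dom d" by (auto simp: charts_at_def)
  have "continuous_on (chart_dom d) ((f \<circ> chart_inv d) \<circ> chart_map d)"
    by (intro continuous_on_compose homeomorphism_cont1[OF N.chart_openD(3)[OF d(1)]]
        C1_on_continuous_on[OF C1c_manifold_C1[OF f d(1)]])
  then have "continuous_on (chart_dom d) f"
    by (rule continuous_on_cong[THEN iffD1, OF refl, rotated]) (simp add: N.chart_inv_map[OF d(1)])
  then show "isCont f y" using d N.chart_openD(1)[OF d(1)] by (simp add: continuous_on_eq_continuous_at)
qed

lemma manifold_deriv_outside_support:
  assumes f: "f \<in> C1c_manifold B" and K: "compact K" "\<And>y. y \<notin> K \<Longrightarrow> f y = 0" and y: "y \<notin> K"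
    and t: "t \<in> tangent_space B y"
  shows "manifold_deriv B f y t = 0"
proof -
  obtain d where d: "d \<in> charts_at B y" by (rule N.chart_at_exists)
  then have ds: "d \<in> charts B" "y \<in> chart_dom d" by (auto simp: charts_at_def)
  let ?S = "chart_map d ` (chart_dom d - K)"
  have "open ?S"
    using N.chart_openD(1)[OF ds(1)] compact_imp_closed[OF K(1)] by (intro N.chart_image_open[OF ds(1)]) auto
  then have "(f \<circ> chart_inv d has_derivative (\<lambda>h. 0)) (at (chart_map d y))"
    by (rule has_derivative_transform_within_open[OF has_derivative_const[of 0]])
       (use ds y K(2) N.chart_inv_map[OF ds(1)] in auto)
  from frechet_derivative_at[OF this, symmetric] show ?thesis
    by (simp add: N.manifold_deriv_chart[OF C1c_manifold_C1[OF f] d t])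
qed

end


section \<open>Uniform integrability in charts\<close>

text \<open>Points where the integrand vanishes may stay uncovered; this accommodates the points
  that \<open>us l\<close> maps outside the support of \<open>f\<close>.\<close>

lemma nn_integral_finite_cover:
  fixes g :: "'a \<Rightarrow> ennreal"
  assumes T: "finite T" and cover: "\<And>x. x \<in> S \<Longrightarrow> g x = 0 \<or> (\<exists>t\<in>T. x \<in> W t)"
    and m: "\<And>t. t \<in> T \<Longrightarrow> (\<lambda>x. g x * indicator (W t) x) \<in> borel_measurable M"
  shows "(\<integral>\<^sup>+x\<in>S. g x \<partial>M) \<le> (\<Sum>t\<in>T. \<integral>\<^sup>+x\<in>W t. g x \<partial>M)"
proof -
  have "(\<integral>\<^sup>+x\<in>S. g x \<partial>M) \<le> (\<integral>\<^sup>+x. (\<Sum>t\<in>T. g x * indicator (W t) x) \<partial>M)"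
  proof (rule nn_integral_mono)
    fix x
    show "g x * indicator S x \<le> (\<Sum>t\<in>T. g x * indicator (W t) x)"
    proof (cases "x \<in> S \<and> g x \<noteq> 0")
      case True
      then obtain t where t: "t \<in> T" "x \<in> W t" using cover by blast
      have "g x * indicator S x = g x * indicator (W t) x" using True t(2) by simp
      also have "\<dots> \<le> (\<Sum>t\<in>T. g x * indicator (W t) x)" using T t(1) by (intro member_le_sum) auto
      finally show ?thesis .
    qed (auto simp: indicator_def)
  qed
  also have "\<dots> = (\<Sum>t\<in>T. \<integral>\<^sup>+x\<in>W t. g x \<partial>M)" by (rule nn_integral_sum[OF m])
  finally show ?thesis .
qed

lemma finite_common_delta:
  fixes Q :: "'i \<Rightarrow> real \<Rightarrow> bool"
  assumes "finite T" "\<And>t. t \<in> T \<Longrightarrow> \<exists>d>0. Q t d" "\<And>t d d'. Q t d \<Longrightarrow> d' \<le> d \<Longrightarrow> Q t d'"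
  obtains d where "0 < d" "\<And>t. t \<in> T \<Longrightarrow> Q t d"
proof -
  have "\<exists>d>0. \<forall>t\<in>T. Q t d" using assms(1,2)
  proof (induction T rule: finite_induct)
    case empty
    show ?case by (intro exI[of _ 1]) simp
  next
    case (insert t T)
    obtain d1 where d1: "0 < d1" "\<forall>s\<in>T. Q s d1" using insert.IH insert.prems by (meson insertI2)
    obtain d2 where d2: "0 < d2" "Q t d2" using insert.prems by (meson insertI1)
    have "Q s (min d1 d2)" if "s \<in> insert t T" for s
    proof (cases "s = t")
      case True
      show ?thesis unfolding True by (rule assms(3)[OF d2(2) min.cobounded2])
    next
      case False
      then have "Q s d1" using that d1(2) by blast
      from assms(3)[OF this min.cobounded1] show ?thesis .
    qed
    moreover have "0 < min d1 d2" using d1(1) d2(1) by simp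
    ultimately show ?case by (intro exI[of _ "min d1 d2"]) simp
  qed
  then show thesis using that by metis
qed

context C1_manifold_pair
begin

context
  fixes us :: "nat \<Rightarrow> 'a \<Rightarrow> 'b" and Dus :: "nat \<Rightarrow> 'a \<Rightarrow> ('a, 'm) tangent \<Rightarrow> ('b, 'n) tangent" and f :: "'b \<Rightarrow> real"
  assumes bui: "bilocally_uniformly_integrable A B us Dus"
    and mbm: "\<And>l. measurable_bundle_morphism A B (us l) (Dus l)"
    and mu: "\<And>l. manifold_measurable A euclidean (us l)"
    and f: "f \<in> C1c_manifold B"
begin

text \<open>When \<open>Dus l\<close> is the colocal weak derivative of \<open>us l\<close>, this
  represents the weak derivative of \<open>f \<circ> us l\<close> in the chart \<open>c\<close>, but
  it is given pointwise and can be estimated pointwise.\<close>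

definition pullback_seq :: "('a, 'm) chart \<Rightarrow> nat \<Rightarrow> real ^ 'm \<Rightarrow> real ^ 'm" where
  "pullback_seq c l p = pullback_covector A B f c (hom_section (us l) (Dus l) (chart_inv c p))"

lemma pullback_seq_measurable:
  assumes c: "c \<in> charts A" and S: "S \<subseteq> chart_image c" "S \<in> sets lebesgue"
  shows "pullback_seq c l \<in> borel_measurable (lebesgue_on S)"
  unfolding pullback_seq_def[abs_def]
  using mbm[of l] unfolding measurable_bundle_morphism_def
  by (intro pullback_measurable[OF _ _ f c S]) auto

lemma pullback_seq_indicator_measurable:
  assumes c: "c \<in> charts A" and S: "S \<subseteq> chart_image c" "S \<in> sets lebesgue"
  shows "(\<lambda>p. ennreal (norm (pullback_seq c l p)) * indicator S p) \<in> borel_measurable lebesgue"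
proof -
  have "(\<lambda>p. ennreal (norm (pullback_seq c l p))) \<in> borel_measurable (lebesgue_on S)"
    using pullback_seq_measurable[OF assms] by measurable
  then show ?thesis using S(2)
    by (subst (asm) borel_measurable_restrict_space_iff_ennreal) auto
qed

lemma pullback_seq_le_transition:
  assumes c: "c \<in> charts_at A x" "c' \<in> charts_at A x" and L: "\<And>w. norm (transition_deriv c c' x w) \<le> L * norm w"
  shows "norm (pullback_seq c l (chart_map c x)) \<le> L * norm (pullback_seq c' l (chart_map c' x))"
proof -
  have "chart_inv c (chart_map c x) = x" "chart_inv c' (chart_map c' x) = x"
    using c M.chart_inv_map by (auto simp: charts_at_def)
  moreover have "Dus l x \<in> tangent_hom A B x (us l x)"
    using mbm[of l] unfolding measurable_bundle_morphism_def bundle_morphism_def by blast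
  ultimately show ?thesis
    unfolding pullback_seq_def hom_section_def by (simp add: pullback_covector_transition_le[OF f _ c L])
qed

lemma pullback_seq_le_matrix:
  assumes c: "c \<in> charts_at A x" and d: "d \<in> charts_at B (us l x)"
    and K: "\<And>w. \<bar>frechet_derivative (f \<circ> chart_inv d) (at (chart_map d (us l x))) w\<bar> \<le> K * norm w" "0 \<le> K"
  shows "norm (pullback_seq c l (chart_map c x)) \<le> K * norm (local_matrix A c d (Dus l) (chart_map c x))"
proof -
  have x: "chart_inv c (chart_map c x) = x" using c M.chart_inv_map by (auto simp: charts_at_def)
  have "Dus l x \<in> tangent_hom A B x (us l x)"
    using mbm[of l] unfolding measurable_bundle_morphism_def bundle_morphism_def by blast
  then show ?thesis
    using pullback_covector_matrix_le[OF f, of "Dus l" c "chart_map c x" "us l x" d K] c d K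
    unfolding pullback_seq_def hom_section_def x by simp
qed

text \<open>The charts \<open>e\<close> and \<open>d\<close> furnished by bilocal uniform
  integrability are compared with the given chart \<open>c\<close> on \<open>M\<close>, while on
  \<open>N\<close> the differential of \<open>f\<close> is bounded by \<open>C\<close> near
  \<open>y\<close> in the chart \<open>d\<close>. Restricting to points mapped into \<open>U\<close>
  keeps both estimates valid.\<close>

lemma uniformly_integrable_near_pair:
  assumes c: "c \<in> charts A" and x: "x \<in> chart_dom c"
  shows "\<exists>P U. open P \<and> x \<in> P \<and> P \<subseteq> chart_dom c \<and> open U \<and> y \<in> U \<and>
    (\<forall>\<epsilon>>0. \<exists>\<delta>>0. \<forall>E l. E \<subseteq> P \<longrightarrow> chart_map c ` E \<in> sets lebesgue \<longrightarrow> emeasure lebesgue (chart_map c ` E) \<le> ennreal \<delta> \<longrightarrow>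
      (\<integral>\<^sup>+p\<in>chart_map c ` (E \<inter> us l -` U). ennreal (norm (pullback_seq c l p)) \<partial>lebesgue) \<le> ennreal \<epsilon>)"
proof -
  have cx: "c \<in> charts_at A x" using c x by (simp add: charts_at_def)
  have "\<exists>e\<in>charts_at A x. \<exists>d\<in>charts_at B y. \<forall>\<epsilon>>0. \<exists>\<delta>>0. \<forall>W\<in>sets lebesgue. W \<subseteq> chart_image e \<and> emeasure lebesgue W \<le> ennreal \<delta> \<longrightarrow>
          (\<forall>l. (\<integral>\<^sup>+p\<in>W \<inter> chart_map e ` (chart_dom e \<inter> us l -` chart_dom d).
                  ennreal (norm (local_matrix A e d (Dus l) p)) \<partial>lebesgue) \<le> ennreal \<epsilon>)"
    by (rule bui[unfolded bilocally_uniformly_integrable_def, THEN conjunct2, THEN spec, THEN spec])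
  then obtain e d where e: "e \<in> charts_at A x" and d: "d \<in> charts_at B y"
    and H: "\<forall>\<epsilon>>0. \<exists>\<delta>>0. \<forall>W\<in>sets lebesgue. W \<subseteq> chart_image e \<and> emeasure lebesgue W \<le> ennreal \<delta> \<longrightarrow>
          (\<forall>l. (\<integral>\<^sup>+p\<in>W \<inter> chart_map e ` (chart_dom e \<inter> us l -` chart_dom d).
                  ennreal (norm (local_matrix A e d (Dus l) p)) \<partial>lebesgue) \<le> ennreal \<epsilon>)"
    by (elim bexE) (rule that)
  have e': "e \<in> charts A" and d': "d \<in> charts B" "y \<in> chart_dom d" using e d by (auto simp: charts_at_def)
  obtain P L where P: "open P" "x \<in> P" "P \<subseteq> chart_dom c \<inter> chart_dom e" and L: "0 < L"
    and PL: "\<And>y w. y \<in> P \<Longrightarrow> norm (transition_deriv c e y w) \<le> L * norm w"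
    and PE: "\<And>E. E \<subseteq> P \<Longrightarrow> chart_map c ` E \<in> sets lebesgue \<Longrightarrow> chart_map e ` E \<in> sets lebesgue \<and>
        emeasure lebesgue (chart_map e ` E) \<le> ennreal L * emeasure lebesgue (chart_map c ` E)"
    and PW: "\<And>W f. W \<subseteq> P \<Longrightarrow> chart_map c ` W \<in> sets lebesgue \<Longrightarrow> f \<in> borel_measurable (lebesgue_on (chart_map e ` W)) \<Longrightarrow>
        (\<integral>\<^sup>+p\<in>chart_map c ` W. f (chart_map e (chart_inv c p)) \<partial>lebesgue) \<le>
        ennreal L * (\<integral>\<^sup>+q\<in>chart_map e ` W. f q \<partial>lebesgue)"
    by (rule M.chart_comparison[OF cx e]) (rule that)
  obtain r C where r: "0 < r" "0 < C"
    "\<And>q w. q \<in> ball (chart_map d y) r \<Longrightarrow> norm (frechet_derivative (f \<circ> chart_inv d) (at q) w) \<le> C * norm w"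
    by (rule C1_on_locally_lipschitz[OF C1c_manifold_C1[OF f d'(1)] N.chart_openD(2)[OF d'(1)], of "chart_map d y"])
       (use d' that in auto)
  define U where "U = {z \<in> chart_dom d. chart_map d z \<in> ball (chart_map d y) r}"
  have U: "open U" "y \<in> U"
    unfolding U_def using N.chart_preimage_open[OF d'(1) open_ball] d' r(1) by auto
  have main: "\<exists>\<delta>>0. \<forall>E l. E \<subseteq> P \<longrightarrow> chart_map c ` E \<in> sets lebesgue \<longrightarrow> emeasure lebesgue (chart_map c ` E) \<le> ennreal \<delta> \<longrightarrow>
      (\<integral>\<^sup>+p\<in>chart_map c ` (E \<inter> us l -` U). ennreal (norm (pullback_seq c l p)) \<partial>lebesgue) \<le> ennreal \<epsilon>"
    if \<epsilon>: "0 < \<epsilon>" for \<epsilon>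
  proof -
    \<comment> \<open>One factor \<open>L\<close> comes from the change of covectors, the other from
      the change of variables in the integral, and \<open>C\<close> from the differential of
      \<open>f\<close>. The threshold \<open>\<delta>' / L\<close> below absorbs the distortion of
      the measure of \<open>E\<close>.\<close>
    define \<epsilon>' where "\<epsilon>' = \<epsilon> / (L * (L * C))"
    have \<epsilon>': "0 < \<epsilon>'" using \<epsilon> L r(2) by (simp add: \<epsilon>'_def)
    obtain \<delta>' where \<delta>': "0 < \<delta>'"
      and H\<delta>: "\<forall>W\<in>sets lebesgue. W \<subseteq> chart_image e \<and> emeasure lebesgue W \<le> ennreal \<delta>' \<longrightarrow>
          (\<forall>l. (\<integral>\<^sup>+p\<in>W \<inter> chart_map e ` (chart_dom e \<inter> us l -` chart_dom d).
                  ennreal (norm (local_matrix A e d (Dus l) p)) \<partial>lebesgue) \<le> ennreal \<epsilon>')"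
      using H[THEN spec, THEN mp, OF \<epsilon>'] by (elim exE conjE) (rule that)
    note H' = H\<delta>[THEN bspec, THEN mp, OF _ conjI, THEN spec]
    have "(\<integral>\<^sup>+p\<in>chart_map c ` (E \<inter> us l -` U). ennreal (norm (pullback_seq c l p)) \<partial>lebesgue) \<le> ennreal \<epsilon>"
      if E: "E \<subseteq> P" and cE: "chart_map c ` E \<in> sets lebesgue" and small: "emeasure lebesgue (chart_map c ` E) \<le> ennreal (\<delta>' / L)"
      for E l
    proof -
      define W where "W = E \<inter> us l -` U"
      have WP: "W \<subseteq> P" using E by (auto simp: W_def)
      have Edom: "E \<subseteq> chart_dom c" "W \<subseteq> chart_dom c" using E P(3) by (auto simp: W_def)
      have cW: "chart_map c ` W \<in> sets lebesgue"
      proof -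
        have "chart_map c ` W = chart_map c ` E \<inter> {p \<in> chart_image c. us l (chart_inv c p) \<in> U}"
          unfolding M.chart_map_image_eq[OF c Edom(1)] M.chart_map_image_eq[OF c Edom(2)] by (auto simp: W_def)
        then show ?thesis
          using cE M.chart_measurable_preimage[OF c mu, of U l] U(1) by (simp add: sets.Int)
      qed
      have eW: "chart_map e ` W \<in> sets lebesgue" using PE[OF WP cW] by (rule conjunct1)
      have eWi: "chart_map e ` W \<subseteq> chart_image e" using WP P(3) by blast
      \<comment> \<open>Dividing by \<open>C\<close> here makes \<open>G\<close> lie below the norm
        of the local matrix. The steps that need measurability are then applied to \<open>G\<close>,
        and the matrix norm enters only through a pointwise comparison.\<close>
      define G where "G q = ennreal (norm (pullback_seq e l q) / C)" for q
      have Gm: "G \<in> borel_measurable (lebesgue_on (chart_map e ` W))"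
        unfolding G_def using pullback_seq_measurable[OF e' eWi eW, of l] by measurable
      have "(\<integral>\<^sup>+p\<in>chart_map c ` W. ennreal (norm (pullback_seq c l p)) \<partial>lebesgue) \<le>
          (\<integral>\<^sup>+p\<in>chart_map c ` W. (ennreal (L * C) * G (chart_map e (chart_inv c p))) \<partial>lebesgue)"
      proof (rule nn_integral_mono)
        fix p
        show "ennreal (norm (pullback_seq c l p)) * indicator (chart_map c ` W) p \<le>
           ennreal (L * C) * G (chart_map e (chart_inv c p)) * indicator (chart_map c ` W) p"
        proof (cases "p \<in> chart_map c ` W")
          case True
          then obtain z where z: "z \<in> W" "p = chart_map c z" by blast
          have zc: "c \<in> charts_at A z" "e \<in> charts_at A z" using z(1) WP P(3) c e' by (auto simp: charts_at_def)
          have zi: "chart_inv c p = z" using z Edom(2) M.chart_inv_map[OF c] by auto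
          have "norm (pullback_seq c l p) \<le> L * norm (pullback_seq e l (chart_map e z))"
            unfolding z(2) by (rule pullback_seq_le_transition[OF zc PL]) (use z(1) WP in blast)
          then have "ennreal (norm (pullback_seq c l p)) \<le> ennreal (L * norm (pullback_seq e l (chart_map e z)))"
            by (rule ennreal_leI)
          also have "\<dots> = ennreal (L * C) * G (chart_map e z)"
            unfolding G_def using L r(2) by (simp add: ennreal_mult[symmetric])
          finally show ?thesis using True zi by simp
        qed simp
      qed
      also have "\<dots> \<le> ennreal L * (\<integral>\<^sup>+q\<in>chart_map e ` W. (ennreal (L * C) * G q) \<partial>lebesgue)"
        by (rule PW[OF WP cW]) (use Gm in measurable)
      also have "(\<integral>\<^sup>+q\<in>chart_map e ` W. (ennreal (L * C) * G q) \<partial>lebesgue) = (\<integral>\<^sup>+q. ennreal (L * C) * G q \<partial>lebesgue_on (chart_map e ` W))"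
        by (rule nn_integral_restrict_space[symmetric]) (use eW in simp)
      also have "\<dots> = ennreal (L * C) * (\<integral>\<^sup>+q. G q \<partial>lebesgue_on (chart_map e ` W))"
        by (rule nn_integral_cmult[OF Gm])
      also have "(\<integral>\<^sup>+q. G q \<partial>lebesgue_on (chart_map e ` W)) = (\<integral>\<^sup>+q\<in>chart_map e ` W. G q \<partial>lebesgue)"
        by (rule nn_integral_restrict_space) (use eW in simp)
      also have "\<dots> \<le> (\<integral>\<^sup>+q\<in>chart_map e ` E \<inter> chart_map e ` (chart_dom e \<inter> us l -` chart_dom d).
                  ennreal (norm (local_matrix A e d (Dus l) q)) \<partial>lebesgue)"
      proof (rule nn_integral_mono)
        fix q
        show "G q * indicator (chart_map e ` W) q \<le> ennreal (norm (local_matrix A e d (Dus l) q)) *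
            indicator (chart_map e ` E \<inter> chart_map e ` (chart_dom e \<inter> us l -` chart_dom d)) q"
        proof (cases "q \<in> chart_map e ` W")
          case True
          then obtain z where z: "z \<in> W" "q = chart_map e z" by blast
          have zU: "us l z \<in> U" and zE: "z \<in> E" using z(1) by (auto simp: W_def)
          have ze: "e \<in> charts_at A z" and zdom: "z \<in> chart_dom e" using z(1) WP P(3) e' by (auto simp: charts_at_def)
          have zd: "d \<in> charts_at B (us l z)" "us l z \<in> chart_dom d" using zU d' by (auto simp: U_def charts_at_def)
          have "norm (pullback_seq e l q) \<le> C * norm (local_matrix A e d (Dus l) q)"
            unfolding z(2)
          proof (rule pullback_seq_le_matrix[OF ze zd(1)])
            show "\<bar>frechet_derivative (f \<circ> chart_inv d) (at (chart_map d (us l z))) w\<bar> \<le> C * norm w" for w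
              using r(3)[of "chart_map d (us l z)" w] zU by (simp add: U_def)
          qed (use r(2) in simp)
          then have "G q \<le> ennreal (norm (local_matrix A e d (Dus l) q))"
            unfolding G_def using r(2) by (intro ennreal_leI) (simp add: pos_divide_le_eq mult.commute)
          moreover have "q \<in> chart_map e ` E \<inter> chart_map e ` (chart_dom e \<inter> us l -` chart_dom d)"
            using z(2) zE zdom zd(2) by blast
          ultimately show ?thesis using True by simp
        qed simp
      qed
      also have "\<dots> \<le> ennreal \<epsilon>'"
      proof (rule H')
        show "chart_map e ` E \<in> sets lebesgue" using PE[OF E cE] by (rule conjunct1)
        show "chart_map e ` E \<subseteq> chart_image e" using E P(3) by blast
        have "emeasure lebesgue (chart_map e ` E) \<le> ennreal L * emeasure lebesgue (chart_map c ` E)"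
          using PE[OF E cE] by (rule conjunct2)
        also have "\<dots> \<le> ennreal L * ennreal (\<delta>' / L)" by (intro mult_left_mono small) simp
        also have "\<dots> = ennreal \<delta>'" using L \<delta>' by (simp add: ennreal_mult[symmetric])
        finally show "emeasure lebesgue (chart_map e ` E) \<le> ennreal \<delta>'" .
      qed
      finally have "(\<integral>\<^sup>+p\<in>chart_map c ` W. ennreal (norm (pullback_seq c l p)) \<partial>lebesgue) \<le>
         ennreal L * (ennreal (L * C) * ennreal \<epsilon>')" by (simp add: mult_left_mono)
      also have "\<dots> = ennreal (L * ((L * C) * \<epsilon>'))"
        using L r(2) \<epsilon>' by (simp add: ennreal_mult[symmetric])
      also have "L * ((L * C) * \<epsilon>') = \<epsilon>" using L r(2) by (simp add: \<epsilon>'_def)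
      finally show ?thesis unfolding W_def .
    qed
    then show ?thesis using \<delta>' L by (intro exI[of _ "\<delta>' / L"]) auto
  qed
  show ?thesis using P U main by (intro exI[of _ P] exI[of _ U]) auto
qed

text \<open>Removes the dependence on the point of \<open>N\<close>: the compact support of
  \<open>f\<close> is covered by finitely many of the sets \<open>U y\<close>, the neighbourhoods of
  \<open>x\<close> are intersected, and wherever \<open>us l\<close> leaves the support the covector
  is zero.\<close>

lemma uniformly_integrable_near_point:
  assumes c: "c \<in> charts A" and x: "x \<in> chart_dom c"
  shows "\<exists>P. open P \<and> x \<in> P \<and> P \<subseteq> chart_dom c \<and>
    (\<forall>\<epsilon>>0. \<exists>\<delta>>0. \<forall>E l. E \<subseteq> P \<longrightarrow> chart_map c ` E \<in> sets lebesgue \<longrightarrow> emeasure lebesgue (chart_map c ` E) \<le> ennreal \<delta> \<longrightarrow>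
      (\<integral>\<^sup>+p\<in>chart_map c ` E. ennreal (norm (pullback_seq c l p)) \<partial>lebesgue) \<le> ennreal \<epsilon>)"
proof -
  obtain K where K: "compact K" "\<And>y. y \<notin> K \<Longrightarrow> f y = 0" using f unfolding C1c_manifold_def by blast
  define Q where "Q P U \<epsilon> \<delta> \<longleftrightarrow> (\<forall>E l. E \<subseteq> P \<longrightarrow> chart_map c ` E \<in> sets lebesgue \<longrightarrow> emeasure lebesgue (chart_map c ` E) \<le> ennreal \<delta> \<longrightarrow>
      (\<integral>\<^sup>+p\<in>chart_map c ` (E \<inter> us l -` U). ennreal (norm (pullback_seq c l p)) \<partial>lebesgue) \<le> ennreal \<epsilon>)" for P U \<epsilon> and \<delta> :: real
  have "\<forall>y. \<exists>P U. open P \<and> x \<in> P \<and> P \<subseteq> chart_dom c \<and> open U \<and> y \<in> U \<and> (\<forall>\<epsilon>>0. \<exists>\<delta>>0. Q P U \<epsilon> \<delta>)"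
    unfolding Q_def using uniformly_integrable_near_pair[OF c x] by (rule allI)
  from choice[OF this] obtain P where "\<forall>y. \<exists>U. open (P y) \<and> x \<in> P y \<and> P y \<subseteq> chart_dom c \<and> open U \<and> y \<in> U \<and>
     (\<forall>\<epsilon>>0. \<exists>\<delta>>0. Q (P y) U \<epsilon> \<delta>)" by (rule exE)
  from choice[OF this] obtain U where PU: "\<forall>y. open (P y) \<and> x \<in> P y \<and> P y \<subseteq> chart_dom c \<and> open (U y) \<and> y \<in> U y \<and>
     (\<forall>\<epsilon>>0. \<exists>\<delta>>0. Q (P y) (U y) \<epsilon> \<delta>)" by (rule exE)
  obtain T where T: "finite T" "K \<subseteq> (\<Union>y\<in>T. U y)"
  proof (rule compactE_image[OF K(1), of K U])
    show "K \<subseteq> (\<Union>y\<in>K. U y)" using PU by blast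
  qed (use PU that in auto)
  \<comment> \<open>The factor \<open>chart_dom c\<close> keeps \<open>R\<close> inside the chart
    when \<open>T\<close> is empty and the intersection over \<open>T\<close> is the whole
    space.\<close>
  define R where "R = chart_dom c \<inter> (\<Inter>y\<in>T. P y)"
  have R: "open R" "x \<in> R" "R \<subseteq> chart_dom c"
    unfolding R_def using PU T(1) x M.chart_openD(1)[OF c] by (auto intro!: open_Int open_INT)
  have main: "\<exists>\<delta>>0. \<forall>E l. E \<subseteq> R \<longrightarrow> chart_map c ` E \<in> sets lebesgue \<longrightarrow> emeasure lebesgue (chart_map c ` E) \<le> ennreal \<delta> \<longrightarrow>
      (\<integral>\<^sup>+p\<in>chart_map c ` E. ennreal (norm (pullback_seq c l p)) \<partial>lebesgue) \<le> ennreal \<epsilon>"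
    if \<epsilon>: "0 < \<epsilon>" for \<epsilon>
  proof -
    \<comment> \<open>The bound is shared among the members of \<open>T\<close>; the added 1 covers
      the case of an empty \<open>T\<close>.\<close>
    define \<epsilon>' where "\<epsilon>' = \<epsilon> / (real (card T) + 1)"
    have \<epsilon>': "0 < \<epsilon>'" using \<epsilon> by (simp add: \<epsilon>'_def add_nonneg_pos)
    obtain \<delta> where \<delta>: "0 < \<delta>" "\<And>y. y \<in> T \<Longrightarrow> Q (P y) (U y) \<epsilon>' \<delta>"
    proof (rule finite_common_delta[OF T(1), of "\<lambda>y. Q (P y) (U y) \<epsilon>'"])
      show "\<exists>\<delta>>0. Q (P y) (U y) \<epsilon>' \<delta>" for y using PU \<epsilon>' by blast
      show "Q (P y) (U y) \<epsilon>' d'" if "Q (P y) (U y) \<epsilon>' d" "d' \<le> d" for y d d'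
        using that(1) ennreal_leI[OF that(2)] unfolding Q_def by (meson order_trans)
    qed (rule that)
    have "(\<integral>\<^sup>+p\<in>chart_map c ` E. ennreal (norm (pullback_seq c l p)) \<partial>lebesgue) \<le> ennreal \<epsilon>"
      if E: "E \<subseteq> R" and cE: "chart_map c ` E \<in> sets lebesgue" and small: "emeasure lebesgue (chart_map c ` E) \<le> ennreal \<delta>" for E l
    proof -
      have Edom: "E \<subseteq> chart_dom c" using E R by blast
      have "(\<integral>\<^sup>+p\<in>chart_map c ` E. ennreal (norm (pullback_seq c l p)) \<partial>lebesgue) \<le>
          (\<Sum>y\<in>T. \<integral>\<^sup>+p\<in>chart_map c ` (E \<inter> us l -` U y). ennreal (norm (pullback_seq c l p)) \<partial>lebesgue)"
      proof (rule nn_integral_finite_cover[OF T(1)])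
        fix p assume "p \<in> chart_map c ` E"
        then obtain z where z: "z \<in> E" "p = chart_map c z" by blast
        then have zi: "chart_inv c p = z" and zc: "c \<in> charts_at A z"
          using Edom M.chart_inv_map[OF c] c by (auto simp: charts_at_def)
        show "ennreal (norm (pullback_seq c l p)) = 0 \<or> (\<exists>y\<in>T. p \<in> chart_map c ` (E \<inter> us l -` U y))"
        proof (cases "us l z \<in> K")
          case True
          then show ?thesis using T(2) z by blast
        next
          case False
          have L: "Dus l z \<in> tangent_hom A B z (us l z)"
            using mbm[of l] unfolding measurable_bundle_morphism_def bundle_morphism_def by blast
          have "manifold_deriv B f (us l z) (Dus l z (chart_inv_deriv A c z w)) = 0" for w
            by (rule manifold_deriv_outside_support[OF f K False tangent_hom_in[OF L M.chart_inv_deriv_in_tangent_space[OF zc]]])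
          then have "pullback_seq c l p = 0"
            unfolding pullback_seq_def zi hom_section_def pullback_covector_def by (simp add: vec_eq_iff)
          then show ?thesis by simp
        qed
      next
        fix y assume "y \<in> T"
        have sub: "E \<inter> us l -` U y \<subseteq> chart_dom c" using Edom by blast
        have "chart_map c ` (E \<inter> us l -` U y) = chart_map c ` E \<inter> {p \<in> chart_image c. us l (chart_inv c p) \<in> U y}"
          unfolding M.chart_map_image_eq[OF c Edom] M.chart_map_image_eq[OF c sub] by auto
        then have "chart_map c ` (E \<inter> us l -` U y) \<in> sets lebesgue"
          using cE M.chart_measurable_preimage[OF c mu, of "U y" l] PU by (simp add: sets.Int)
        then show "(\<lambda>p. ennreal (norm (pullback_seq c l p)) * indicator (chart_map c ` (E \<inter> us l -` U y)) p) \<in> borel_measurable lebesgue"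
          by (intro pullback_seq_indicator_measurable[OF c]) (use sub in blast)
      qed
      also have "\<dots> \<le> (\<Sum>y\<in>T. ennreal \<epsilon>')"
      proof (rule sum_mono)
        fix y assume y: "y \<in> T"
        have "E \<subseteq> P y" using E y by (auto simp: R_def)
        then show "(\<integral>\<^sup>+p\<in>chart_map c ` (E \<inter> us l -` U y). ennreal (norm (pullback_seq c l p)) \<partial>lebesgue) \<le> ennreal \<epsilon>'"
          using \<delta>(2)[OF y] cE small unfolding Q_def by blast
      qed
      also have "\<dots> = ennreal (real (card T) * \<epsilon>')"
        using \<epsilon>' by (simp add: ennreal_of_nat_eq_real_of_nat ennreal_mult[symmetric])
      also have "\<dots> \<le> ennreal \<epsilon>"
      proof (rule ennreal_leI)
        have "real (card T) * \<epsilon>' \<le> (real (card T) + 1) * \<epsilon>'" using \<epsilon>' by (intro mult_right_mono) auto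
        also have "\<dots> = \<epsilon>" by (simp add: \<epsilon>'_def add_nonneg_pos less_imp_neq[symmetric])
        finally show "real (card T) * \<epsilon>' \<le> \<epsilon>" .
      qed
      finally show ?thesis .
    qed
    then show ?thesis using \<delta>(1) by (intro exI[of _ \<delta>]) auto
  qed
  show ?thesis using R main by (intro exI[of _ R]) auto
qed

text \<open>The second compactness argument, now on the side of \<open>M\<close>: finitely many of
  the neighbourhoods from \<open>uniformly_integrable_near_point\<close> cover the compact
  set.\<close>

lemma pullback_seq_locally_uniformly_integrable:
  assumes c: "c \<in> charts A"
  shows "locally_uniformly_integrable (chart_image c) (pullback_seq c)"
  unfolding locally_uniformly_integrable_def
proof (intro allI impI)
  fix K :: "(real ^ 'm) set" and \<epsilon> :: real assume K: "compact K \<and> K \<subseteq> chart_image c" and \<epsilon>: "0 < \<epsilon>"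
  define Q where "Q P \<epsilon> \<delta> \<longleftrightarrow> (\<forall>E l. E \<subseteq> P \<longrightarrow> chart_map c ` E \<in> sets lebesgue \<longrightarrow> emeasure lebesgue (chart_map c ` E) \<le> ennreal \<delta> \<longrightarrow>
      (\<integral>\<^sup>+p\<in>chart_map c ` E. ennreal (norm (pullback_seq c l p)) \<partial>lebesgue) \<le> ennreal \<epsilon>)" for P \<epsilon> and \<delta> :: real
  have "\<forall>x\<in>chart_dom c. \<exists>P. open P \<and> x \<in> P \<and> P \<subseteq> chart_dom c \<and> (\<forall>\<epsilon>>0. \<exists>\<delta>>0. Q P \<epsilon> \<delta>)"
    unfolding Q_def using uniformly_integrable_near_point[OF c] by (rule ballI)
  from bchoice[OF this] obtain P where P: "\<forall>x\<in>chart_dom c. open (P x) \<and> x \<in> P x \<and> P x \<subseteq> chart_dom c \<and>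
     (\<forall>\<epsilon>>0. \<exists>\<delta>>0. Q (P x) \<epsilon> \<delta>)" by (rule exE)
  obtain T where T: "finite T" "T \<subseteq> chart_dom c" "K \<subseteq> (\<Union>x\<in>T. chart_map c ` P x)"
    by (rule M.chart_cover_compact[OF c conjunct1[OF K] conjunct2[OF K], of P]) (use P in auto)
  define \<epsilon>' where "\<epsilon>' = \<epsilon> / (real (card T) + 1)"
  have \<epsilon>': "0 < \<epsilon>'" using \<epsilon> by (simp add: \<epsilon>'_def add_nonneg_pos)
  obtain \<delta> where \<delta>: "0 < \<delta>" "\<And>x. x \<in> T \<Longrightarrow> Q (P x) \<epsilon>' \<delta>"
  proof (rule finite_common_delta[OF T(1), of "\<lambda>x. Q (P x) \<epsilon>'"])
    show "\<exists>\<delta>>0. Q (P x) \<epsilon>' \<delta>" if "x \<in> T" for x using P T(2) \<epsilon>' that by blast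
    show "Q (P x) \<epsilon>' d'" if "Q (P x) \<epsilon>' d" "d' \<le> d" for x d d'
      using that(1) ennreal_leI[OF that(2)] unfolding Q_def by (meson order_trans)
  qed (rule that)
  have "(\<integral>\<^sup>+p\<in>E. ennreal (norm (pullback_seq c l p)) \<partial>lebesgue) \<le> ennreal \<epsilon>"
    if E: "E \<in> sets lebesgue" "E \<subseteq> K" "emeasure lebesgue E \<le> ennreal \<delta>" for E l
  proof -
    define S where "S x = {y \<in> P x. chart_map c y \<in> E}" for x
    have cS: "chart_map c ` S x = E \<inter> chart_map c ` P x" for x unfolding S_def by blast
    have cSm: "chart_map c ` S x \<in> sets lebesgue" if "x \<in> T" for x
    proof -
      have "open (chart_map c ` P x)" using P T(2) that by (intro M.chart_image_open[OF c]) auto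
      then show ?thesis unfolding cS using E(1) by (intro sets.Int) auto
    qed
    have "(\<integral>\<^sup>+p\<in>E. ennreal (norm (pullback_seq c l p)) \<partial>lebesgue) \<le>
        (\<Sum>x\<in>T. \<integral>\<^sup>+p\<in>chart_map c ` S x. ennreal (norm (pullback_seq c l p)) \<partial>lebesgue)"
    proof (rule nn_integral_finite_cover[OF T(1)])
      show "ennreal (norm (pullback_seq c l p)) = 0 \<or> (\<exists>x\<in>T. p \<in> chart_map c ` S x)" if "p \<in> E" for p
        unfolding cS using that E(2) T(3) by blast
      show "(\<lambda>p. ennreal (norm (pullback_seq c l p)) * indicator (chart_map c ` S x) p) \<in> borel_measurable lebesgue"
        if "x \<in> T" for x
        by (rule pullback_seq_indicator_measurable[OF c _ cSm[OF that]]) (use cS E(2) K in blast)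
    qed
    also have "\<dots> \<le> (\<Sum>x\<in>T. ennreal \<epsilon>')"
    proof (rule sum_mono)
      fix x assume x: "x \<in> T"
      have "emeasure lebesgue (chart_map c ` S x) \<le> emeasure lebesgue E"
        by (rule emeasure_mono) (use cS E(1) in auto)
      then have "emeasure lebesgue (chart_map c ` S x) \<le> ennreal \<delta>" using E(3) by (rule order_trans)
      moreover have "S x \<subseteq> P x" by (auto simp: S_def)
      ultimately show "(\<integral>\<^sup>+p\<in>chart_map c ` S x. ennreal (norm (pullback_seq c l p)) \<partial>lebesgue) \<le> ennreal \<epsilon>'"
        using \<delta>(2)[OF x] cSm[OF x] unfolding Q_def by blast
    qed
    also have "\<dots> = ennreal (real (card T) * \<epsilon>')"
      using \<epsilon>' by (simp add: ennreal_of_nat_eq_real_of_nat ennreal_mult[symmetric])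
    also have "\<dots> \<le> ennreal \<epsilon>"
    proof (rule ennreal_leI)
      have "real (card T) * \<epsilon>' \<le> (real (card T) + 1) * \<epsilon>'" using \<epsilon>' by (intro mult_right_mono) auto
      also have "\<dots> = \<epsilon>" by (simp add: \<epsilon>'_def add_nonneg_pos less_imp_neq[symmetric])
      finally show "real (card T) * \<epsilon>' \<le> \<epsilon>" .
    qed
    finally show ?thesis .
  qed
  then show "\<exists>d>0. \<forall>E\<in>sets lebesgue. E \<subseteq> K \<and> emeasure lebesgue E \<le> ennreal d \<longrightarrow>
        (\<forall>l. (\<integral>\<^sup>+p\<in>E. ennreal (norm (pullback_seq c l p)) \<partial>lebesgue) \<le> ennreal \<epsilon>)"
    using \<delta>(1) by (intro exI[of _ \<delta>]) auto
qed

end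

end


section \<open>Separation by functions of class \<open>C\<^sup>1\<close>\<close>

text \<open>Allows the representative chosen by \<open>weak_derivative\<close> to be exchanged for
  the pointwise expression \<open>pullback_seq\<close>.\<close>

lemma has_weak_derivative_cong_AE:
  assumes h: "has_weak_derivative \<Omega> g h" and ae: "AE x in lebesgue. x \<in> \<Omega> \<longrightarrow> h x = h' x"
    and \<Omega>: "\<Omega> \<in> sets lebesgue" and m: "h' \<in> borel_measurable (lebesgue_on \<Omega>)"
  shows "has_weak_derivative \<Omega> g h'"
proof -
  have int: "h' absolutely_integrable_on K" if K: "compact K" "K \<subseteq> \<Omega>" for K
  proof -
    have Ks: "K \<in> sets lebesgue" using K(1) by (simp add: lmeasurable_compact fmeasurableD)
    have hK: "h absolutely_integrable_on K"
      using h K unfolding has_weak_derivative_def locally_integrable_def by blast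
    have "h' \<in> borel_measurable (lebesgue_on K)" by (rule measurable_restrict_mono[OF m K(2)])
    then have m': "(\<lambda>x. indicator K x *\<^sub>R h' x) \<in> borel_measurable lebesgue"
      using Ks by (subst (asm) borel_measurable_restrict_space_iff) auto
    have "AE x in lebesgue. indicator K x *\<^sub>R h x = indicator K x *\<^sub>R h' x"
      using ae by eventually_elim (use K(2) in \<open>auto simp: indicator_def\<close>)
    then show ?thesis
      unfolding set_integrable_def
      by (rule integrable_cong_AE_imp[OF hK[unfolded set_integrable_def] m'])
  qed
  have "(LINT x:\<Omega>|lebesgue. h x \<bullet> v x) = (LINT x:\<Omega>|lebesgue. h' x \<bullet> v x)"
    if v: "v \<in> C1c_vector_fields \<Omega>" for v
  proof -
    have vc: "continuous_on UNIV v" using v C1_on_continuous_on unfolding C1c_vector_fields_def by blast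
    have vm: "v \<in> borel_measurable lebesgue"
      using borel_measurable_continuous_onI[OF vc] by (simp add: measurable_completion)
    have mm: "(\<lambda>x. indicator \<Omega> x *\<^sub>R (k x \<bullet> v x)) \<in> borel_measurable lebesgue"
      if "(\<lambda>x. indicator \<Omega> x *\<^sub>R k x) \<in> borel_measurable lebesgue" for k
      using borel_measurable_inner[OF that vm] by simp
    have h'm: "(\<lambda>x. indicator \<Omega> x *\<^sub>R h' x) \<in> borel_measurable lebesgue"
      using m \<Omega> by (subst (asm) borel_measurable_restrict_space_iff) auto
    have "AE x in lebesgue. indicator \<Omega> x *\<^sub>R h' x = indicator \<Omega> x *\<^sub>R h x"
      using ae by eventually_elim (auto simp: indicator_def)
    then have hm: "(\<lambda>x. indicator \<Omega> x *\<^sub>R h x) \<in> borel_measurable lebesgue"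
      by (rule borel_measurable_AE[OF h'm])
    show ?thesis
      unfolding set_lebesgue_integral_def
      by (rule integral_cong_AE[OF mm[OF hm] mm[OF h'm]])
         (use ae in \<open>eventually_elim, auto simp: indicator_def\<close>)
  qed
  then show ?thesis
    using h int unfolding has_weak_derivative_def locally_integrable_def by simp
qed

context C1_manifold
begin

text \<open>Around points of the chart domain the function is a composition with a transition map.
  Around all other points it vanishes near the point, because the support is compact and hence
  closed in a Hausdorff space; this is where the separation axiom enters.\<close>

lemma C1c_manifold_chart_extension:
  fixes \<phi> :: "real ^ 'm \<Rightarrow> real"
  assumes d: "d \<in> charts A" and \<phi>: "C1_on UNIV \<phi>" and S: "compact S" "S \<subseteq> chart_image d"
    and supp: "\<And>p. p \<notin> S \<Longrightarrow> \<phi> p = 0"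
  shows "(\<lambda>z. if z \<in> chart_dom d then \<phi> (chart_map d z) else 0) \<in> C1c_manifold A" (is "?g \<in> _")
proof -
  define K where "K = chart_inv d ` S"
  have K: "compact K" unfolding K_def
    by (intro compact_continuous_image continuous_on_subset[OF homeomorphism_cont2[OF chart_openD(3)[OF d]]] S)
  have out: "?g z = 0" if "z \<notin> K" for z
  proof (cases "z \<in> chart_dom d")
    case True
    have "chart_map d z \<notin> S"
    proof
      assume "chart_map d z \<in> S"
      then have "chart_inv d (chart_map d z) \<in> K" unfolding K_def by (rule imageI)
      then show False using that chart_inv_map[OF d True] by simp
    qed
    then show ?thesis using supp by simp
  qed simp
  have "C1_on (chart_image e) (?g \<circ> chart_inv e)" if e: "e \<in> charts A" for e
  proof (rule C1_on_local)
    fix q assume "q \<in> chart_image e"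
    then obtain z where z: "z \<in> chart_dom e" "q = chart_map e z" by blast
    show "\<exists>T. open T \<and> q \<in> T \<and> C1_on T (?g \<circ> chart_inv e)"
    proof (cases "z \<in> chart_dom d")
      case True
      let ?T = "chart_map e ` (chart_dom e \<inter> chart_dom d)"
      have T: "open ?T"
        using chart_openD(1)[OF e] chart_openD(1)[OF d] by (intro chart_image_open[OF e]) auto
      have "C1_on ?T (\<phi> \<circ> (chart_map d \<circ> chart_inv e))"
        by (rule C1_on_compose[OF transition_C1[OF e d] \<phi>]) simp
      then have C1: "C1_on ?T (?g \<circ> chart_inv e)"
      proof (rule C1_on_cong[OF _ T])
        fix p assume "p \<in> ?T"
        then obtain y where y: "y \<in> chart_dom e" "y \<in> chart_dom d" "p = chart_map e y" by blast
        show "(\<phi> \<circ> (chart_map d \<circ> chart_inv e)) p = (?g \<circ> chart_inv e) p"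
          unfolding y(3) comp_apply chart_inv_map[OF e y(1)] using y(2) by simp
      qed
      have "q \<in> ?T" using z True by blast
      with T C1 show ?thesis by (intro exI[of _ ?T] conjI)
    next
      case False
      let ?T = "chart_map e ` (chart_dom e - K)"
      have T: "open ?T"
        by (intro chart_image_open[OF e] open_Diff chart_openD(1)[OF e] compact_imp_closed[OF K] Diff_subset)
      have "K \<subseteq> chart_dom d" 
        unfolding K_def image_subset_iff using subsetD[OF S(2)] by (intro ballI chart_inv_in)
      then have zK: "z \<notin> K" using False by blast
      have "C1_on ?T (?g \<circ> chart_inv e)"
      proof (rule C1_on_cong[OF C1_on_const T])
        fix p assume "p \<in> ?T"
        then obtain y where y: "y \<in> chart_dom e" "y \<notin> K" "p = chart_map e y" by blast
        show "0 = (?g \<circ> chart_inv e) p"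
          unfolding y(3) comp_apply chart_inv_map[OF e y(1)] by (rule out[OF y(2), symmetric])
      qed
      moreover have "q \<in> ?T" using z zK by blast
      ultimately show ?thesis using T by (intro exI[of _ ?T] conjI)
    qed
  qed
  then show ?thesis unfolding C1c_manifold_def using K out by blast
qed

text \<open>
  On \<open>V y\<close> the function \<open>g y j\<close> is the \<open>j\<close>-th coordinate of the chart \<open>d y\<close>.
\<close>

lemma coordinate_functions_exist:
  obtains T :: "'a set" and d V g where "countable T" "(\<Union>y\<in>T. V y) = UNIV"
    "\<And>y. d y \<in> charts A" "\<And>y. V y \<subseteq> chart_dom (d y)" "\<And>y j. g y j \<in> C1c_manifold A"
    "\<And>y z j t. z \<in> V y \<Longrightarrow> t \<in> tangent_space A z \<Longrightarrow> manifold_deriv A (g y j) z t = t (d y) $ (j :: 'm)"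
proof -
  have "\<exists>d V g. d \<in> charts A \<and> open V \<and> y \<in> V \<and> V \<subseteq> chart_dom d \<and> (\<forall>j. g j \<in> C1c_manifold A) \<and>
      (\<forall>z j t. z \<in> V \<longrightarrow> t \<in> tangent_space A z \<longrightarrow> manifold_deriv A (g j) z t = t d $ (j :: 'm))" for y
  proof -
    obtain d where "d \<in> charts_at A y" by (rule chart_at_exists)
    then have d: "d \<in> charts A" "y \<in> chart_dom d" by (auto simp: charts_at_def)
    obtain r where r: "0 < r" "cball (chart_map d y) r \<subseteq> chart_image d"
      using chart_openD(2)[OF d(1)] d(2) open_contains_cball by (metis imageI)
    \<comment> \<open>Multiplying a coordinate by this cutoff gives it compact support inside the
      chart and leaves its derivative unchanged on the smaller ball.\<close>
    obtain \<rho> :: "real ^ 'm \<Rightarrow> real" where \<rho>: "C1_on UNIV \<rho>"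
      "\<And>p. p \<in> ball (chart_map d y) (r/2) \<Longrightarrow> \<rho> p = 1" "\<And>p. p \<notin> cball (chart_map d y) r \<Longrightarrow> \<rho> p = 0"
      by (rule C1_cutoff_exists[OF r(1), of "chart_map d y"]) (rule that)
    define V where "V = {z \<in> chart_dom d. chart_map d z \<in> ball (chart_map d y) (r/2)}"
    define g where "g j z = (if z \<in> chart_dom d then \<rho> (chart_map d z) *\<^sub>R (chart_map d z $ j) else 0)" for j z
    have V: "open V" "y \<in> V" "V \<subseteq> chart_dom d"
      using d(2) r(1) by (auto simp: V_def simp del: mem_ball intro!: chart_preimage_open[OF d(1)])
    have g: "g j \<in> C1c_manifold A" for j
      unfolding g_def[abs_def]
    proof (rule C1c_manifold_chart_extension[OF d(1) _ compact_cball r(2)])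
      show "C1_on UNIV (\<lambda>p. \<rho> p *\<^sub>R p $ j)" by (intro C1_on_scaleR \<rho>(1) C1_on_linear bounded_linear_vec_nth)
      show "\<rho> p *\<^sub>R p $ j = 0" if "p \<notin> cball (chart_map d y) r" for p using \<rho>(3)[OF that] by simp
    qed
    have "manifold_deriv A (g j) z t = t d $ j" if z: "z \<in> V" and t: "t \<in> tangent_space A z" for z j t
    proof -
      have dz: "d \<in> charts_at A z" using z V(3) d(1) by (auto simp: charts_at_def)
      have "((\<lambda>p. p $ j) has_derivative (\<lambda>h. h $ j)) (at (chart_map d z))"
        by (rule bounded_linear_imp_has_derivative[OF bounded_linear_vec_nth])
      then have "(g j \<circ> chart_inv d has_derivative (\<lambda>h. h $ j)) (at (chart_map d z))"
      proof (rule has_derivative_transform_within_open)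
        show "open (chart_map d ` V)" by (rule chart_image_open[OF d(1) V(1,3)])
        show "chart_map d z \<in> chart_map d ` V" using z by (rule imageI)
        fix p assume "p \<in> chart_map d ` V"
        then obtain x where x: "x \<in> V" "p = chart_map d x" by blast
        then have "x \<in> chart_dom d" using V(3) by blast
        then show "p $ j = (g j \<circ> chart_inv d) p"
          using x chart_inv_map[OF d(1)] \<rho>(2)[of p] by (simp add: g_def V_def)
      qed
      from frechet_derivative_at[OF this]
      have e: "frechet_derivative (g j \<circ> chart_inv d) (at (chart_map d z)) = (\<lambda>h. h $ j)" by simp
      have "manifold_deriv A (g j) z t = frechet_derivative (g j \<circ> chart_inv d) (at (chart_map d z)) (t d)"
        by (rule manifold_deriv_chart[OF _ dz t]) (use g[of j] in \<open>simp add: C1c_manifold_def\<close>)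
      then show ?thesis unfolding e .
    qed
    then show ?thesis using d(1) V g
      by (intro exI[of _ d] exI[of _ V] exI[of _ g]) simp
  qed
  \<comment> \<open>The chart, the neighbourhood and the functions are packed into one triple so
    that a single application of choice suffices.\<close>
  then have "\<forall>y. \<exists>dVg. (case dVg of (d, V, g) \<Rightarrow> d \<in> charts A \<and> open V \<and> y \<in> V \<and> V \<subseteq> chart_dom d \<and> (\<forall>j. g j \<in> C1c_manifold A) \<and>
      (\<forall>z j t. z \<in> V \<longrightarrow> t \<in> tangent_space A z \<longrightarrow> manifold_deriv A (g j) z t = t d $ (j :: 'm)))"
    by (simp add: split_paired_Ex)
  from choice[OF this] obtain D where D: "\<forall>y. case D y of (d, V, g) \<Rightarrow> d \<in> charts A \<and> open V \<and> y \<in> V \<and> V \<subseteq> chart_dom d \<and> (\<forall>j. g j \<in> C1c_manifold A) \<and>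
      (\<forall>z j t. z \<in> V \<longrightarrow> t \<in> tangent_space A z \<longrightarrow> manifold_deriv A (g j) z t = t d $ (j :: 'm))" by (rule exE)
  define d where "d y = fst (D y)" for y
  define V where "V y = fst (snd (D y))" for y
  define g where "g y = snd (snd (D y))" for y
  have P: "d y \<in> charts A \<and> open (V y) \<and> y \<in> V y \<and> V y \<subseteq> chart_dom (d y) \<and> (\<forall>j. g y j \<in> C1c_manifold A) \<and>
      (\<forall>z j t. z \<in> V y \<longrightarrow> t \<in> tangent_space A z \<longrightarrow> manifold_deriv A (g y j) z t = t (d y) $ (j :: 'm))" for y
    using spec[OF D, of y] unfolding d_def V_def g_def by (simp add: case_prod_beta)
  \<comment> \<open>Countability of the index set allows the exceptional null sets of all coordinate
    functions to be united later.\<close>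
  obtain \<F> where F: "\<F> \<subseteq> range V" "countable \<F>" "\<Union>\<F> = \<Union>(range V)"
    by (rule Lindelof[of "range V"]) (use P in auto)
  obtain T where T: "countable T" "\<F> = V ` T"
    using countable_subset_image[of \<F> V UNIV] F(1,2) by auto
  have "(\<Union>y\<in>T. V y) = UNIV"
  proof -
    have "\<Union>(range V) = UNIV" using P by blast
    then show ?thesis using F(3) T(2) by simp
  qed
  from that[OF T(1) this] P show thesis by blast
qed

text \<open>Where \<open>u\<close> lies in \<open>U\<close> and \<open>w\<close> in a disjoint
  \<open>V\<close>, the value of \<open>us l\<close> misses one of the two, so this set has measure
  at most a sum tending to 0. A countable basis reduces the Hausdorff separation of distinct values
  to countably many such pairs.\<close>

lemma limit_in_measure_unique:
  fixes u w :: "'a \<Rightarrow> 'y::{t2_space, second_countable_topology}"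
  assumes u: "converges_locally_in_measure A euclidean us u" and w: "converges_locally_in_measure A euclidean us w"
    and c: "c \<in> charts A"
  shows "AE p in lebesgue. p \<in> chart_image c \<longrightarrow> u (chart_inv c p) = w (chart_inv c p)"
proof -
  have um: "manifold_measurable A euclidean u" and wm: "manifold_measurable A euclidean w"
    using u w unfolding converges_locally_in_measure_def by auto
  obtain C where C: "\<And>n::nat. compact (C n)" "\<And>n. C n \<subseteq> chart_image c" "\<Union>(range C) = chart_image c"
    by (rule open_Union_compact_subsets[OF chart_openD(2)[OF c]]) (rule that)
  obtain \<B> :: "'y set set" where \<B>: "countable \<B>" "topological_basis \<B>" using ex_countable_basis by metis
  have AEp: "AE p in lebesgue. \<not> (p \<in> C n \<and> u (chart_inv c p) \<in> U \<and> w (chart_inv c p) \<in> V)"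
    if UV: "open U" "open V" "U \<inter> V = {}" for U V n
  proof -
    let ?E = "{p \<in> C n. u (chart_inv c p) \<in> U \<and> w (chart_inv c p) \<in> V}"
    let ?Eu = "\<lambda>l. {p \<in> C n. u (chart_inv c p) \<in> U \<and> us l (chart_inv c p) \<notin> U}"
    let ?Ew = "\<lambda>l. {p \<in> C n. w (chart_inv c p) \<in> V \<and> us l (chart_inv c p) \<notin> V}"
    have Cm: "C n \<in> sets lebesgue" using C(1) by (simp add: lmeasurable_compact fmeasurableD)
    have usm: "manifold_measurable A euclidean (us l)" for l
      using u unfolding converges_locally_in_measure_def by blast
    have pre: "{p \<in> C n. v (chart_inv c p) \<in> X} \<in> sets lebesgue" if "manifold_measurable A euclidean v" "open X"
      for v :: "'a \<Rightarrow> 'y" and X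
    proof -
      have "{p \<in> C n. v (chart_inv c p) \<in> X} = C n \<inter> {p \<in> chart_image c. v (chart_inv c p) \<in> X}"
        using C(2) by blast
      then show ?thesis using Cm chart_measurable_preimage[OF c that(1)] that(2) by (simp add: sets.Int)
    qed
    have Em: "?Eu l \<in> sets lebesgue" "?Ew l \<in> sets lebesgue" for l
    proof -
      have "?Eu l = {p \<in> C n. u (chart_inv c p) \<in> U} - {p \<in> C n. us l (chart_inv c p) \<in> U}" by blast
      then show "?Eu l \<in> sets lebesgue" using pre[OF um UV(1)] pre[OF usm UV(1)] by (simp only: sets.Diff)
      have "?Ew l = {p \<in> C n. w (chart_inv c p) \<in> V} - {p \<in> C n. us l (chart_inv c p) \<in> V}" by blast
      then show "?Ew l \<in> sets lebesgue" using pre[OF wm UV(2)] pre[OF usm UV(2)] by (simp only: sets.Diff)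
    qed
    have le: "emeasure lebesgue ?E \<le> emeasure lebesgue (?Eu l) + emeasure lebesgue (?Ew l)" for l
    proof -
      have "emeasure lebesgue ?E \<le> emeasure lebesgue (?Eu l \<union> ?Ew l)"
        by (rule emeasure_mono[OF _ sets.Un[OF Em]]) (use UV(3) in blast)
      also have "\<dots> \<le> emeasure lebesgue (?Eu l) + emeasure lebesgue (?Ew l)"
        by (rule emeasure_subadditive[OF Em])
      finally show ?thesis .
    qed
    have "(\<lambda>l. emeasure lebesgue (?Eu l) + emeasure lebesgue (?Ew l)) \<longlonglongrightarrow> 0 + 0"
      by (intro tendsto_add locally_in_measure_chart[OF u c C(1,2)] locally_in_measure_chart[OF w c C(1,2)])
         (use UV in auto)
    then have "(\<lambda>l. emeasure lebesgue ?E) \<longlonglongrightarrow> 0"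
      unfolding add_0_left by (rule ennreal_tendsto_0_mono[OF le])
    then have "emeasure lebesgue ?E = 0" by (simp only: LIMSEQ_const_iff)
    moreover have "?E \<in> sets lebesgue"
    proof -
      have "?E = {p \<in> C n. u (chart_inv c p) \<in> U} \<inter> {p \<in> C n. w (chart_inv c p) \<in> V}" by blast
      then show ?thesis using pre[OF um UV(1)] pre[OF wm UV(2)] by (simp only: sets.Int)
    qed
    ultimately have "?E \<in> null_sets lebesgue" by (rule null_setsI)
    from AE_not_in[OF this] show ?thesis by simp
  qed
  have "AE p in lebesgue. \<forall>n. \<forall>U\<in>\<B>. \<forall>V\<in>\<B>. U \<inter> V = {} \<longrightarrow> \<not> (p \<in> C n \<and> u (chart_inv c p) \<in> U \<and> w (chart_inv c p) \<in> V)"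
    unfolding AE_all_countable AE_ball_countable[OF \<B>(1)]
  proof (intro allI ballI)
    fix n U V assume "U \<in> \<B>" "V \<in> \<B>"
    then have o: "open U" "open V" using topological_basis_open[OF \<B>(2)] by blast+
    show "AE p in lebesgue. U \<inter> V = {} \<longrightarrow> \<not> (p \<in> C n \<and> u (chart_inv c p) \<in> U \<and> w (chart_inv c p) \<in> V)"
      by (cases "U \<inter> V = {}") (use AEp[OF o] in auto)
  qed
  then show ?thesis
  proof eventually_elim
    fix p assume H: "\<forall>n. \<forall>U\<in>\<B>. \<forall>V\<in>\<B>. U \<inter> V = {} \<longrightarrow> \<not> (p \<in> C n \<and> u (chart_inv c p) \<in> U \<and> w (chart_inv c p) \<in> V)"
    show "p \<in> chart_image c \<longrightarrow> u (chart_inv c p) = w (chart_inv c p)"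
    proof (intro impI, rule ccontr)
      assume p: "p \<in> chart_image c" and ne: "u (chart_inv c p) \<noteq> w (chart_inv c p)"
      obtain U V where UV: "open U" "open V" "u (chart_inv c p) \<in> U" "w (chart_inv c p) \<in> V" "U \<inter> V = {}"
        using hausdorff[OF ne] by blast
      obtain U' V' where UV': "U' \<in> \<B>" "u (chart_inv c p) \<in> U'" "U' \<subseteq> U" "V' \<in> \<B>" "w (chart_inv c p) \<in> V'" "V' \<subseteq> V"
        using topological_basisE[OF \<B>(2) UV(1,3)] topological_basisE[OF \<B>(2) UV(2,4)] by metis
      obtain n where "p \<in> C n" using p C(3) by blast
      moreover have "U' \<inter> V' = {}" using UV' UV(5) by blast
      ultimately show False using H UV' by blast
    qed
  qed
qed

end


section \<open>The limit map\<close>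

lemma AE_lebesgue_on_iff:
  "S \<in> sets lebesgue \<Longrightarrow> (AE x in lebesgue_on S. P x) \<longleftrightarrow> (AE x in lebesgue. x \<in> S \<longrightarrow> P x)"
  by (subst AE_restrict_space_iff) auto

lemma negligible_if_AE_not_in:
  assumes "AE x in lebesgue. x \<notin> S"
  shows "negligible S"
proof -
  obtain N where "N \<in> null_sets lebesgue" "{x \<in> space lebesgue. \<not> x \<notin> S} \<subseteq> N"
    using assms unfolding eventually_ae_filter by (elim bexE) (rule that)
  then have "negligible N" "S \<subseteq> N" by (simp_all add: negligible_iff_null_sets)
  then show ?thesis by (rule negligible_subset)
qed

context C1_manifold_pair
begin

lemma chart_image_lebesgue: "c \<in> charts A \<Longrightarrow> chart_image c \<in> sets lebesgue"
  using M.chart_openD(2) by auto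

lemma C1c_bounded:
  assumes f: "f \<in> C1c_manifold B"
  shows "\<exists>C. \<forall>y. \<bar>f y\<bar> \<le> C"
proof -
  obtain K where K: "compact K" "\<And>y. y \<notin> K \<Longrightarrow> f y = 0" using f unfolding C1c_manifold_def by blast
  have "bounded (f ` K)"
    by (intro compact_imp_bounded compact_continuous_image continuous_on_subset[OF C1c_continuous[OF f]] K) simp
  then obtain C where C: "\<And>y. y \<in> K \<Longrightarrow> \<bar>f y\<bar> \<le> C" unfolding bounded_iff by (metis imageI real_norm_def)
  have "\<bar>f y\<bar> \<le> max C 0" for y using C[of y] K(2)[of y] by (cases "y \<in> K") auto
  then show ?thesis by (intro exI[of _ "max C 0"] allI)
qed

lemma chart_composition_measurable:
  assumes f: "f \<in> C1c_manifold B" and u: "manifold_measurable A euclidean u" and c: "c \<in> charts A"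
    and K: "K \<subseteq> chart_image c" "K \<in> sets lebesgue"
  shows "f \<circ> u \<circ> chart_inv c \<in> borel_measurable (lebesgue_on K)"
proof (rule borel_measurableI)
  fix U :: "real set" assume "open U"
  then have "open (f -` U)" using C1c_continuous[OF f] by (simp add: open_vimage)
  then have "{p \<in> chart_image c. u (chart_inv c p) \<in> f -` U} \<in> sets lebesgue"
    by (intro M.chart_measurable_preimage[OF c u]) simp
  moreover have "(f \<circ> u \<circ> chart_inv c) -` U \<inter> space (lebesgue_on K) = {p \<in> chart_image c. u (chart_inv c p) \<in> f -` U} \<inter> K"
    using K(1) by auto
  ultimately show "(f \<circ> u \<circ> chart_inv c) -` U \<inter> space (lebesgue_on K) \<in> sets (lebesgue_on K)"
    using K(2) by (simp only: sets_restrict_space_iff sets.Int_space_eq2) (simp add: sets.Int)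
qed

lemma chart_composition_locally_integrable:
  assumes f: "f \<in> C1c_manifold B" and u: "manifold_measurable A euclidean u" and c: "c \<in> charts A"
  shows "locally_integrable (chart_image c) (f \<circ> u \<circ> chart_inv c)"
  unfolding locally_integrable_def
proof (intro allI impI)
  fix K :: "(real ^ 'm) set" assume K: "compact K \<and> K \<subseteq> chart_image c"
  then have Km: "K \<in> lmeasurable" by (simp add: lmeasurable_compact)
  interpret finite_measure "lebesgue_on K" using Km by (rule finite_measure_lebesgue_on)
  obtain C where C: "\<And>y. \<bar>f y\<bar> \<le> C" using C1c_bounded[OF f] by metis
  have "integrable (lebesgue_on K) (f \<circ> u \<circ> chart_inv c)"
    by (rule integrable_const_bound[of _ C])
       (use C chart_composition_measurable[OF f u c] K Km in \<open>auto simp: fmeasurableD\<close>)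
  then show "(f \<circ> u \<circ> chart_inv c) absolutely_integrable_on K"
    using Km by (simp add: set_integrable_def integrable_restrict_space fmeasurableD)
qed

lemma colocal_weak_derivative_pullback:
  assumes cw: "colocal_weak_derivative A B u Du" and f: "f \<in> C1c_manifold B" and c: "c \<in> charts A"
  shows "AE p in lebesgue. p \<in> chart_image c \<longrightarrow>
     weak_derivative (chart_image c) (f \<circ> u \<circ> chart_inv c) p =
     pullback_covector A B f c (hom_section u Du (chart_inv c p))"
proof -
  have bm: "\<And>x. Du x \<in> tangent_hom A B x (u x)"
    using cw unfolding colocal_weak_derivative_def measurable_bundle_morphism_def bundle_morphism_def by blast
  have "AE p in lebesgue_on (chart_image c). \<forall>w. weak_derivative (chart_image c) (f \<circ> u \<circ> chart_inv c) p \<bullet> w =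
            manifold_deriv B f (u (chart_inv c p)) (Du (chart_inv c p) (chart_inv_deriv A c (chart_inv c p) w))"
    using cw f c unfolding colocal_weak_derivative_def by blast
  then have "AE p in lebesgue. p \<in> chart_image c \<longrightarrow> (\<forall>w. weak_derivative (chart_image c) (f \<circ> u \<circ> chart_inv c) p \<bullet> w =
            manifold_deriv B f (u (chart_inv c p)) (Du (chart_inv c p) (chart_inv_deriv A c (chart_inv c p) w)))"
    unfolding AE_lebesgue_on_iff[OF chart_image_lebesgue[OF c]] .
  then show ?thesis
  proof eventually_elim
    fix p assume H: "p \<in> chart_image c \<longrightarrow> (\<forall>w. weak_derivative (chart_image c) (f \<circ> u \<circ> chart_inv c) p \<bullet> w =
            manifold_deriv B f (u (chart_inv c p)) (Du (chart_inv c p) (chart_inv_deriv A c (chart_inv c p) w)))"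
    show "p \<in> chart_image c \<longrightarrow> weak_derivative (chart_image c) (f \<circ> u \<circ> chart_inv c) p =
     pullback_covector A B f c (hom_section u Du (chart_inv c p))"
    proof
      assume p: "p \<in> chart_image c"
      have cx: "c \<in> charts_at A (chart_inv c p)" using c M.chart_inv_in[OF p] by (simp add: charts_at_def)
      have "weak_derivative (chart_image c) (f \<circ> u \<circ> chart_inv c) p \<bullet> w =
         pullback_covector A B f c (hom_section u Du (chart_inv c p)) \<bullet> w" for w
        using H p pullback_covector_inner[OF f bm cx, of w] by (simp add: hom_section_def)
      then show "weak_derivative (chart_image c) (f \<circ> u \<circ> chart_inv c) p =
         pullback_covector A B f c (hom_section u Du (chart_inv c p))"
        by (rule vector_eq_rdot[THEN iffD1, OF allI])
    qed
  qed
qed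

context
  fixes us :: "nat \<Rightarrow> 'a \<Rightarrow> 'b" and Dus :: "nat \<Rightarrow> 'a \<Rightarrow> ('a, 'm) tangent \<Rightarrow> ('b, 'n) tangent" and u :: "'a \<Rightarrow> 'b"
  assumes cw: "\<And>l. colocal_weak_derivative A B (us l) (Dus l)"
    and conv: "converges_locally_in_measure A euclidean us u"
    and bui: "bilocally_uniformly_integrable A B us Dus"
begin

lemma us_measurable: "manifold_measurable A euclidean (us l)"
  and us_bundle_morphism: "measurable_bundle_morphism A B (us l) (Dus l)"
  and u_measurable: "manifold_measurable A euclidean u"
  using cw[of l] conv
  unfolding colocal_weak_derivative_def colocally_weakly_differentiable_def converges_locally_in_measure_def by auto

lemma us_weak_derivative:
  assumes f: "f \<in> C1c_manifold B" and c: "c \<in> charts A"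
  shows "has_weak_derivative (chart_image c) (f \<circ> us l \<circ> chart_inv c) (weak_derivative (chart_image c) (f \<circ> us l \<circ> chart_inv c))"
    and "has_weak_derivative (chart_image c) (f \<circ> us l \<circ> chart_inv c) (pullback_seq us Dus f c l)"
proof -
  show wd: "has_weak_derivative (chart_image c) (f \<circ> us l \<circ> chart_inv c) (weak_derivative (chart_image c) (f \<circ> us l \<circ> chart_inv c))"
    using cw[of l] f c
    unfolding colocal_weak_derivative_def colocally_weakly_differentiable_def manifold_weakly_differentiable_def
    by (intro weak_derivative_works) blast
  show "has_weak_derivative (chart_image c) (f \<circ> us l \<circ> chart_inv c) (pullback_seq us Dus f c l)"
  proof (rule has_weak_derivative_cong_AE[OF wd _ chart_image_lebesgue[OF c]])
    show "AE p in lebesgue. p \<in> chart_image c \<longrightarrow>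
        weak_derivative (chart_image c) (f \<circ> us l \<circ> chart_inv c) p = pullback_seq us Dus f c l p"
      using colocal_weak_derivative_pullback[OF cw f c, of l]
      unfolding pullback_seq_def[OF bui us_bundle_morphism us_measurable f] .
    show "pullback_seq us Dus f c l \<in> borel_measurable (lebesgue_on (chart_image c))"
      by (rule pullback_seq_measurable[OF bui us_bundle_morphism us_measurable f c order_refl chart_image_lebesgue[OF c]])
  qed
qed

lemma test_integral_limit:
  assumes f: "f \<in> C1c_manifold B" and c: "c \<in> charts A" and v: "v \<in> C1c_vector_fields (chart_image c)"
  shows "(\<lambda>l. LINT p:chart_image c|lebesgue. (f \<circ> us l \<circ> chart_inv c) p * divergence v p)
     \<longlonglongrightarrow> (LINT p:chart_image c|lebesgue. (f \<circ> u \<circ> chart_inv c) p * divergence v p)"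
proof -
  obtain K where K: "compact K" "K \<subseteq> chart_image c" "\<And>x. x \<notin> K \<Longrightarrow> v x = 0" and v1: "C1_on UNIV v"
    using v unfolding C1c_vector_fields_def by auto
  obtain C where C: "\<And>y. \<bar>f y\<bar> \<le> C" using C1c_bounded[OF f] by metis
  have cm: "converges_in_measure_on (chart_image c) (\<lambda>l p. us l (chart_inv c p)) (\<lambda>p. u (chart_inv c p))"
    unfolding converges_in_measure_on_def
    by (intro allI impI M.locally_in_measure_chart[OF conv c]) auto
  have fm: "f \<circ> w \<circ> chart_inv c \<in> borel_measurable (lebesgue_on K)"
    if "manifold_measurable A euclidean w" "compact K" "K \<subseteq> chart_image c" for w K
    by (rule chart_composition_measurable[OF f that(1) c that(3)])
       (use that(2) in \<open>simp add: lmeasurable_compact fmeasurableD\<close>)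
  show ?thesis
  proof (rule set_integral_test_tendsto[OF _ _ _ _ _ divergence_C1c(1)[OF v1 K(1,3)] K(1,2)])
    show "converges_in_measure_on (chart_image c) (\<lambda>l. f \<circ> us l \<circ> chart_inv c) (f \<circ> u \<circ> chart_inv c)"
      using converges_in_measure_on_compose[OF cm C1c_continuous[OF f]] by (simp add: comp_def)
    show "divergence v x = 0" if "x \<notin> K" for x by (rule divergence_C1c(2)[OF v1 K(1,3) that])
    show "f \<circ> us l \<circ> chart_inv c \<in> borel_measurable (lebesgue_on K)" if "compact K" "K \<subseteq> chart_image c" for l K
      by (rule fm[OF us_measurable that])
    show "f \<circ> u \<circ> chart_inv c \<in> borel_measurable (lebesgue_on K)" if "compact K" "K \<subseteq> chart_image c" for K
      by (rule fm[OF u_measurable that])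
    show "\<bar>(f \<circ> us l \<circ> chart_inv c) p\<bar> \<le> C" for l p unfolding comp_apply by (rule C)
    show "\<bar>(f \<circ> u \<circ> chart_inv c) p\<bar> \<le> C" for p unfolding comp_apply by (rule C)
  qed
qed

lemma limit_has_weak_derivative:
  assumes f: "f \<in> C1c_manifold B" and c: "c \<in> charts A"
  obtains F h where "F \<noteq> bot" "F \<le> sequentially" "has_weak_derivative (chart_image c) (f \<circ> u \<circ> chart_inv c) h"
    "\<And>K E i. compact K \<Longrightarrow> K \<subseteq> chart_image c \<Longrightarrow> E \<in> sets lebesgue \<Longrightarrow> E \<subseteq> K \<Longrightarrow>
       ((\<lambda>l. LINT x:E|lebesgue. pullback_seq us Dus f c l x $ i) \<longlongrightarrow> (LINT x:E|lebesgue. h x $ i)) F"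
  by (rule has_weak_derivative_limit[OF M.chart_openD(2)[OF c]
        pullback_seq_locally_uniformly_integrable[OF bui us_bundle_morphism us_measurable f c]
        us_weak_derivative(2)[OF f c] chart_composition_locally_integrable[OF f u_measurable c]
        test_integral_limit[OF f c]]) (assumption, rule that)

lemma limit_weak_derivative_works:
  assumes f: "f \<in> C1c_manifold B" and c: "c \<in> charts A"
  shows "has_weak_derivative (chart_image c) (f \<circ> u \<circ> chart_inv c) (weak_derivative (chart_image c) (f \<circ> u \<circ> chart_inv c))"
proof (rule weak_derivative_works)
  show "weakly_differentiable (chart_image c) (f \<circ> u \<circ> chart_inv c)"
    by (rule limit_has_weak_derivative[OF f c]) (auto simp: weakly_differentiable_def)
qed

lemma limit_colocally_weakly_differentiable: "colocally_weakly_differentiable A B u"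
  unfolding colocally_weakly_differentiable_def manifold_weakly_differentiable_def weakly_differentiable_def
  using u_measurable limit_weak_derivative_works by blast

text \<open>Integration by parts turns both sides into integrals against the divergence of
  \<open>v\<close>, which converge along the whole sequence; the weak limit is used only to know
  that \<open>f \<circ> u\<close> has a weak derivative.\<close>

lemma weak_derivative_integral_limit:
  assumes f: "f \<in> C1c_manifold B" and c: "c \<in> charts A" and v: "v \<in> C1c_vector_fields (chart_image c)"
  shows "(\<lambda>l. LINT p:chart_image c|lebesgue. weak_derivative (chart_image c) (f \<circ> us l \<circ> chart_inv c) p \<bullet> v p)
     \<longlonglongrightarrow> (LINT p:chart_image c|lebesgue. weak_derivative (chart_image c) (f \<circ> u \<circ> chart_inv c) p \<bullet> v p)"
proof -
  have eq: "(LINT p:chart_image c|lebesgue. h p \<bullet> v p) = - (LINT p:chart_image c|lebesgue. g p * divergence v p)"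
    if "has_weak_derivative (chart_image c) g h" for g h
  proof -
    have "(LINT p:chart_image c|lebesgue. g p * divergence v p) = - (LINT p:chart_image c|lebesgue. h p \<bullet> v p)"
      using that v unfolding has_weak_derivative_def by blast
    then show ?thesis by (simp only: minus_minus)
  qed
  show ?thesis
    unfolding eq[OF us_weak_derivative(1)[OF f c]] eq[OF limit_weak_derivative_works[OF f c]]
    by (rule tendsto_minus[OF test_integral_limit[OF f c v]])
qed

section \<open>Identification of the derivative when the derivatives converge in measure\<close>

context
  fixes w :: "'a \<Rightarrow> 'b" and \<upsilon> :: "'a \<Rightarrow> ('a, 'm) tangent \<Rightarrow> ('b, 'n) tangent"
  assumes bw: "bundle_morphism A B w \<upsilon>"
    and hconv: "converges_locally_in_measure A (hom_bundle A B) (\<lambda>l. hom_section (us l) (Dus l)) (hom_section w \<upsilon>)"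
begin

text \<open>The map \<open>w\<close> covered by \<open>\<upsilon>\<close> is not assumed to be
  \<open>u\<close>. Projecting the convergence of sections to \<open>N\<close> shows that
  \<open>us\<close> also converges to \<open>w\<close>, which makes \<open>u\<close> and
  \<open>w\<close> equal almost everywhere.\<close>

lemma base_converges: "converges_locally_in_measure A euclidean us w"
proof -
  let ?W = "\<lambda>U. {(x, y, L). L \<in> tangent_hom A B x y \<and> y \<in> U}"
  have pre: "hom_section v \<eta> -` ?W U = v -` U" if "bundle_morphism A B v \<eta>" for v \<eta> U
    using that by (auto simp: hom_section_def bundle_morphism_def)
  have usb: "bundle_morphism A B (us l) (Dus l)" for l
    using us_bundle_morphism[of l] unfolding measurable_bundle_morphism_def by blast
  have wm: "manifold_measurable A euclidean w"
    unfolding manifold_measurable_def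
  proof (intro conjI allI impI)
    fix U :: "'b set" assume "openin euclidean U"
    then have "openin (hom_bundle A B) (?W U)" by (intro openin_hom_bundle_base) simp
    then have "manifold_measurable_set A (hom_section w \<upsilon> -` ?W U)"
      using hconv unfolding converges_locally_in_measure_def manifold_measurable_def by blast
    then show "manifold_measurable_set A (w -` U)" unfolding pre[OF bw] .
  qed simp
  have "\<exists>c\<in>charts_at A x. \<forall>U. openin euclidean U \<longrightarrow>
        (\<lambda>l. emeasure lebesgue (chart_map c ` ((w -` U \<inter> chart_dom c) - us l -` U))) \<longlonglongrightarrow> 0" for x
  proof -
    have "\<exists>c\<in>charts_at A x. \<forall>W. openin (hom_bundle A B) W \<longrightarrow> (\<lambda>l. emeasure lebesgue (chart_map c `
        ((hom_section w \<upsilon> -` W \<inter> chart_dom c) - hom_section (us l) (Dus l) -` W))) \<longlonglongrightarrow> 0"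
      by (rule hconv[unfolded converges_locally_in_measure_def, THEN conjunct2, THEN conjunct2, THEN spec])
    then obtain c where c: "c \<in> charts_at A x" and H: "\<forall>W. openin (hom_bundle A B) W \<longrightarrow> (\<lambda>l. emeasure lebesgue (chart_map c `
        ((hom_section w \<upsilon> -` W \<inter> chart_dom c) - hom_section (us l) (Dus l) -` W))) \<longlonglongrightarrow> 0" by (rule bexE)
    have "(\<lambda>l. emeasure lebesgue (chart_map c ` ((w -` U \<inter> chart_dom c) - us l -` U))) \<longlonglongrightarrow> 0"
      if "open U" for U
      using H[THEN spec, THEN mp, OF openin_hom_bundle_base[OF that]] unfolding pre[OF bw] pre[OF usb] .
    then show ?thesis using c by (intro bexI[OF _ c]) simp
  qed
  then show ?thesis unfolding converges_locally_in_measure_def using us_measurable wm by blast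
qed

lemma u_eq_w: "c \<in> charts A \<Longrightarrow> AE p in lebesgue. p \<in> chart_image c \<longrightarrow> u (chart_inv c p) = w (chart_inv c p)"
  by (rule M.limit_in_measure_unique[OF conv base_converges])

text \<open>The weak limit \<open>h\<close> is the link: it agrees almost everywhere with the chosen
  representative by uniqueness of weak derivatives, and with the covector of
  \<open>\<upsilon>\<close> because weak limits and limits in measure coincide.\<close>

lemma limit_weak_derivative_eq_pullback:
  assumes f: "f \<in> C1c_manifold B" and c: "c \<in> charts A"
  shows "AE p in lebesgue. p \<in> chart_image c \<longrightarrow> weak_derivative (chart_image c) (f \<circ> u \<circ> chart_inv c) p =
     pullback_covector A B f c (hom_section w \<upsilon> (chart_inv c p))"
proof -
  obtain F h where F: "F \<noteq> bot" "F \<le> sequentially" and h: "has_weak_derivative (chart_image c) (f \<circ> u \<circ> chart_inv c) h"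
    and lim: "\<And>K E i. compact K \<Longrightarrow> K \<subseteq> chart_image c \<Longrightarrow> E \<in> sets lebesgue \<Longrightarrow> E \<subseteq> K \<Longrightarrow>
       ((\<lambda>l. LINT x:E|lebesgue. pullback_seq us Dus f c l x $ i) \<longlongrightarrow> (LINT x:E|lebesgue. h x $ i)) F"
    by (rule limit_has_weak_derivative[OF f c]) (rule that)
  have usb: "bundle_morphism A B (us l) (Dus l)" for l
    using us_bundle_morphism[of l] unfolding measurable_bundle_morphism_def by blast
  have hm: "manifold_measurable A (hom_bundle A B) (hom_section w \<upsilon>)"
    using hconv unfolding converges_locally_in_measure_def by blast
  have int: "locally_integrable (chart_image c) (pullback_seq us Dus f c l)" for l
    using us_weak_derivative(2)[OF f c] unfolding has_weak_derivative_def by blast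
  have hint: "locally_integrable (chart_image c) h" using h unfolding has_weak_derivative_def by blast
  have cm: "converges_in_measure_on (chart_image c) (pullback_seq us Dus f c)
    (\<lambda>p. pullback_covector A B f c (hom_section w \<upsilon> (chart_inv c p)))"
    using pullback_in_measure_chart[OF hconv usb bw f c]
    unfolding pullback_seq_def[OF bui us_bundle_morphism us_measurable f, abs_def] .
  have "AE p in lebesgue. p \<in> chart_image c \<longrightarrow> h p = pullback_covector A B f c (hom_section w \<upsilon> (chart_inv c p))"
  proof (rule weak_limit_eq_limit_in_measure_vec[OF M.chart_openD(2)[OF c]
        pullback_seq_locally_uniformly_integrable[OF bui us_bundle_morphism us_measurable f c] int hint F lim cm])
    show "(\<lambda>p. pullback_covector A B f c (hom_section w \<upsilon> (chart_inv c p))) \<in> borel_measurable (lebesgue_on K)"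
      if "compact K" "K \<subseteq> chart_image c" for K
      by (rule pullback_measurable[OF hm bw f c that(2)]) (use that(1) in \<open>simp add: lmeasurable_compact fmeasurableD\<close>)
  qed
  moreover have "AE p in lebesgue. p \<in> chart_image c \<longrightarrow> weak_derivative (chart_image c) (f \<circ> u \<circ> chart_inv c) p = h p"
    by (rule has_weak_derivative_unique[OF M.chart_openD(2)[OF c] limit_weak_derivative_works[OF f c] h])
  ultimately show ?thesis by eventually_elim simp
qed

lemma zero_in_tangent_hom: "(\<lambda>t\<in>tangent_space A x. (\<lambda>_. 0)) \<in> tangent_hom A B x y"
proof -
  have "(\<lambda>t\<in>tangent_space A x. (\<lambda>_. 0)) \<in> tangent_space A x \<rightarrow>\<^sub>E tangent_space B y"
    using N.zero_in_tangent_space by auto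
  then show ?thesis
    unfolding tangent_hom_def using M.tangent_space_linear by (simp add: restrict_def)
qed

text \<open>\<open>\<upsilon> x\<close> takes values in the tangent space at \<open>w x\<close>, so
  it can serve as derivative only where \<open>u x = w x\<close>. On the remaining negligible set
  the zero map over \<open>u x\<close> is used, since a bundle morphism must have a fibre map at
  every point.\<close>

lemma limit_colocal_weak_derivative_exists: "\<exists>Du. colocal_weak_derivative A B u Du"
proof -
  define Du where "Du x = (if u x = w x then \<upsilon> x else (\<lambda>t\<in>tangent_space A x. (\<lambda>_. 0)))" for x
  have bm: "Du x \<in> tangent_hom A B x (u x)" for x
    using bw zero_in_tangent_hom by (simp add: Du_def bundle_morphism_def)
  have hm: "manifold_measurable A (hom_bundle A B) (hom_section w \<upsilon>)"
    using hconv unfolding converges_locally_in_measure_def by blast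
  have "manifold_measurable A (hom_bundle A B) (hom_section u Du)"
    unfolding manifold_measurable_def
  proof (intro conjI allI impI)
    show "range (hom_section u Du) \<subseteq> topspace (hom_bundle A B)"
      unfolding topspace_hom_bundle using bm by (auto simp: hom_section_def)
    fix W assume W: "openin (hom_bundle A B) W"
    show "manifold_measurable_set A (hom_section u Du -` W)"
      unfolding manifold_measurable_set_def
    proof
      fix c assume c: "c \<in> charts A"
      let ?S = "{p \<in> chart_image c. hom_section w \<upsilon> (chart_inv c p) \<in> W}"
      let ?T = "{p \<in> chart_image c. hom_section u Du (chart_inv c p) \<in> W}"
      let ?N = "{p. \<not> (p \<in> chart_image c \<longrightarrow> u (chart_inv c p) = w (chart_inv c p))}"
      have S: "?S \<in> sets lebesgue" by (rule M.chart_measurable_preimage[OF c hm W])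
      have N: "negligible ?N"
        using u_eq_w[OF c] by (intro negligible_if_AE_not_in) simp
      have eq: "hom_section u Du (chart_inv c p) = hom_section w \<upsilon> (chart_inv c p)" if "u (chart_inv c p) = w (chart_inv c p)" for p
        using that by (simp add: hom_section_def Du_def)
      have "negligible (?S - ?T)" "negligible (?T - ?S)"
        by (rule negligible_subset[OF N], use eq in auto)+
      \<comment> \<open>\<open>?T\<close> is obtained from the measurable set \<open>?S\<close> by
        removing and adding negligible sets, which are Lebesgue measurable.\<close>
      then have "(?S - (?S - ?T)) \<union> (?T - ?S) \<in> sets lebesgue"
        by (intro sets.Un sets.Diff S negligible_imp_sets)
      moreover have "(?S - (?S - ?T)) \<union> (?T - ?S) = ?T" by blast
      ultimately have "?T \<in> sets lebesgue" by (simp only:)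
      moreover have "chart_map c ` (hom_section u Du -` W \<inter> chart_dom c) = ?T"
        unfolding M.chart_map_image_eq[OF c Int_lower2] using M.chart_inv_in[of _ c] by blast
      ultimately show "chart_map c ` (hom_section u Du -` W \<inter> chart_dom c) \<in> sets lebesgue" by simp
    qed
  qed
  then have mb: "measurable_bundle_morphism A B u Du"
    unfolding measurable_bundle_morphism_def bundle_morphism_def using bm by blast
  have "AE p in lebesgue_on (chart_image c). \<forall>v. weak_derivative (chart_image c) (f \<circ> u \<circ> chart_inv c) p \<bullet> v =
            manifold_deriv B f (u (chart_inv c p)) (Du (chart_inv c p) (chart_inv_deriv A c (chart_inv c p) v))"
    if f: "f \<in> C1c_manifold B" and c: "c \<in> charts A" for f c
    unfolding AE_lebesgue_on_iff[OF chart_image_lebesgue[OF c]]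
    using limit_weak_derivative_eq_pullback[OF f c] u_eq_w[OF c]
  proof eventually_elim
    fix p assume a: "p \<in> chart_image c \<longrightarrow> weak_derivative (chart_image c) (f \<circ> u \<circ> chart_inv c) p =
         pullback_covector A B f c (hom_section w \<upsilon> (chart_inv c p))"
      and b: "p \<in> chart_image c \<longrightarrow> u (chart_inv c p) = w (chart_inv c p)"
    show "p \<in> chart_image c \<longrightarrow> (\<forall>v. weak_derivative (chart_image c) (f \<circ> u \<circ> chart_inv c) p \<bullet> v =
            manifold_deriv B f (u (chart_inv c p)) (Du (chart_inv c p) (chart_inv_deriv A c (chart_inv c p) v)))"
    proof (intro impI allI)
      fix v assume p: "p \<in> chart_image c"
      have cx: "c \<in> charts_at A (chart_inv c p)" using c M.chart_inv_in[OF p] by (simp add: charts_at_def)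
      have "weak_derivative (chart_image c) (f \<circ> u \<circ> chart_inv c) p =
         pullback_covector A B f c (chart_inv c p, u (chart_inv c p), Du (chart_inv c p))"
        using a b p by (simp add: hom_section_def Du_def)
      then show "weak_derivative (chart_image c) (f \<circ> u \<circ> chart_inv c) p \<bullet> v =
            manifold_deriv B f (u (chart_inv c p)) (Du (chart_inv c p) (chart_inv_deriv A c (chart_inv c p) v))"
        using pullback_covector_inner[OF f bm cx, of v] by simp
    qed
  qed
  then have "colocal_weak_derivative A B u Du"
    unfolding colocal_weak_derivative_def using limit_colocally_weakly_differentiable mb by blast
  then show ?thesis by (intro exI[of _ Du])
qed

text \<open>Outside one null set the covectors of \<open>Du\<close> and \<open>\<upsilon>\<close>
  agree for all of the countably many local coordinate functions. At such a point the functions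
  belonging to a patch around \<open>u x\<close> read off every coordinate of the image of a tangent
  vector, so the two fibre maps are equal.\<close>

lemma limit_colocal_weak_derivative_unique:
  assumes Du: "colocal_weak_derivative A B u Du"
  shows "manifold_AE A (\<lambda>x. u x = w x \<and> Du x = \<upsilon> x)"
  unfolding manifold_AE_def manifold_negligible_def
proof
  fix c assume c: "c \<in> charts A"
  obtain T :: "'b set" and d V g where T: "countable T" "(\<Union>y\<in>T. V y) = UNIV"
    and d: "\<And>y. d y \<in> charts B" "\<And>y. V y \<subseteq> chart_dom (d y)" and g: "\<And>y j. g y j \<in> C1c_manifold B"
    and gd: "\<And>y z j t. z \<in> V y \<Longrightarrow> t \<in> tangent_space B z \<Longrightarrow> manifold_deriv B (g y j) z t = t (d y) $ (j :: 'n)"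
    by (rule N.coordinate_functions_exist) (rule that)
  have Dux: "Du x \<in> tangent_hom A B x (u x)" for x
    using Du unfolding colocal_weak_derivative_def measurable_bundle_morphism_def bundle_morphism_def by blast
  have \<upsilon>x: "\<upsilon> x \<in> tangent_hom A B x (w x)" for x using bw unfolding bundle_morphism_def by blast
  have ae1: "AE p in lebesgue. \<forall>y\<in>T. \<forall>j. p \<in> chart_image c \<longrightarrow>
     pullback_covector A B (g y j) c (hom_section u Du (chart_inv c p)) =
     pullback_covector A B (g y j) c (hom_section w \<upsilon> (chart_inv c p))"
    unfolding AE_ball_countable[OF T(1)] AE_all_countable
  proof (intro ballI allI)
    fix y j
    show "AE p in lebesgue. p \<in> chart_image c \<longrightarrow>
     pullback_covector A B (g y j) c (hom_section u Du (chart_inv c p)) =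
     pullback_covector A B (g y j) c (hom_section w \<upsilon> (chart_inv c p))"
      using limit_weak_derivative_eq_pullback[OF g c, of y j] colocal_weak_derivative_pullback[OF Du g c, of y j]
      by eventually_elim auto
  qed
  have "AE p in lebesgue. p \<notin> chart_map c ` ({x. \<not> (u x = w x \<and> Du x = \<upsilon> x)} \<inter> chart_dom c)"
    using ae1 u_eq_w[OF c]
  proof eventually_elim
    fix p assume pb: "\<forall>y\<in>T. \<forall>j. p \<in> chart_image c \<longrightarrow>
     pullback_covector A B (g y j) c (hom_section u Du (chart_inv c p)) =
     pullback_covector A B (g y j) c (hom_section w \<upsilon> (chart_inv c p))"
      and uw: "p \<in> chart_image c \<longrightarrow> u (chart_inv c p) = w (chart_inv c p)"
    show "p \<notin> chart_map c ` ({x. \<not> (u x = w x \<and> Du x = \<upsilon> x)} \<inter> chart_dom c)"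
    proof
      assume "p \<in> chart_map c ` ({x. \<not> (u x = w x \<and> Du x = \<upsilon> x)} \<inter> chart_dom c)"
      then obtain x where x: "x \<in> chart_dom c" "p = chart_map c x" and ne: "\<not> (u x = w x \<and> Du x = \<upsilon> x)" by blast
      have p: "p \<in> chart_image c" and xi: "chart_inv c p = x" using x M.chart_inv_map[OF c] by auto
      have cx: "c \<in> charts_at A x" using c x by (simp add: charts_at_def)
      have uwx: "u x = w x" using uw p xi by simp
      obtain y where y: "y \<in> T" "u x \<in> V y" using T(2) by blast
      have dy: "d y \<in> charts_at B (u x)" using d y(2) by (auto simp: charts_at_def)
      have "Du x t = \<upsilon> x t" if t: "t \<in> tangent_space A x" for t
      proof -
        have Dt: "Du x t \<in> tangent_space B (u x)" by (rule tangent_hom_in[OF Dux t])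
        have Ut: "\<upsilon> x t \<in> tangent_space B (u x)" unfolding uwx by (rule tangent_hom_in[OF \<upsilon>x t])
        have "Du x t (d y) $ j = \<upsilon> x t (d y) $ j" for j
        proof -
          have pe: "pullback_covector A B (g y j) c (x, u x, Du x) = pullback_covector A B (g y j) c (x, w x, \<upsilon> x)"
            using pb y(1) p unfolding hom_section_def xi by blast
          have "manifold_deriv B (g y j) (u x) (Du x (chart_inv_deriv A c x (t c))) =
              manifold_deriv B (g y j) (w x) (\<upsilon> x (chart_inv_deriv A c x (t c)))"
            using pullback_covector_inner[OF g Dux cx, of y j "t c"] pullback_covector_inner[OF g \<upsilon>x cx, of y j "t c"] pe
            by simp
          then have "manifold_deriv B (g y j) (u x) (Du x t) = manifold_deriv B (g y j) (u x) (\<upsilon> x t)"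
            unfolding M.chart_inv_deriv_eq[OF cx t] uwx .
          then show ?thesis unfolding gd[OF y(2) Dt] gd[OF y(2) Ut] .
        qed
        then have "Du x t (d y) = \<upsilon> x t (d y)" by (simp add: vec_eq_iff)
        then show ?thesis by (rule N.tangent_space_eqI[OF dy Dt Ut])
      qed
      \<comment> \<open>Elements of \<open>tangent_hom\<close> are normalised outside the tangent
        space, so agreement on tangent vectors is equality of functions.\<close>
      then have "Du x = \<upsilon> x"
        by (rule PiE_ext[OF Dux[of x, unfolded tangent_hom_def uwx, THEN CollectD, THEN conjunct1]
              \<upsilon>x[of x, unfolded tangent_hom_def, THEN CollectD, THEN conjunct1]])
      with ne uwx show False by blast
    qed
  qed
  then show "negligible (chart_map c ` ({x. \<not> (u x = w x \<and> Du x = \<upsilon> x)} \<inter> chart_dom c))"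
    by (rule negligible_if_AE_not_in)
qed

end

end

end

text \<open>The last clause lets the limit cover an arbitrary \<open>w\<close>, because convergence
  of the sections determines the base map only up to a null set; the equality of derivatives
  therefore includes the equality of base points. Existence of a \<open>Du\<close> is asserted
  separately, so that the statement about every \<open>Du\<close> is not vacuous.\<close>

theorem proposition3p2:
  fixes AM :: "('a::{t2_space, second_countable_topology}, 'm::finite) chart set"
    and AN :: "('b::{t2_space, second_countable_topology}, 'n::finite) chart set"
    and us :: "nat \<Rightarrow> 'a \<Rightarrow> 'b"
    and u :: "'a \<Rightarrow> 'b"
    and Dus :: "nat \<Rightarrow> 'a \<Rightarrow> ('a, 'm) tangent \<Rightarrow> ('b, 'n) tangent"
  assumes "C1_atlas AM" and "C1_atlas AN"
    and "\<And>l. colocally_weakly_differentiable AM AN (us l)"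
    and "\<And>l. colocal_weak_derivative AM AN (us l) (Dus l)"
    and "converges_locally_in_measure AM euclidean us u"
    and "bilocally_uniformly_integrable AM AN us Dus"
  shows "colocally_weakly_differentiable AM AN u \<and>
    (\<forall>f\<in>C1c_manifold AN. \<forall>c\<in>charts AM. \<forall>v\<in>C1c_vector_fields (chart_image c).
       (\<lambda>l. LINT p:chart_image c|lebesgue.
              weak_derivative (chart_image c) (f \<circ> us l \<circ> chart_inv c) p \<bullet> v p)
         \<longlonglongrightarrow> (LINT p:chart_image c|lebesgue.
              weak_derivative (chart_image c) (f \<circ> u \<circ> chart_inv c) p \<bullet> v p)) \<and>
    (\<forall>w \<upsilon>. bundle_morphism AM AN w \<upsilon> \<and>
       converges_locally_in_measure AM (hom_bundle AM AN)
         (\<lambda>l. hom_section (us l) (Dus l)) (hom_section w \<upsilon>) \<longrightarrow>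
       (\<exists>Du. colocal_weak_derivative AM AN u Du) \<and>
       (\<forall>Du. colocal_weak_derivative AM AN u Du \<longrightarrow>
          manifold_AE AM (\<lambda>x. u x = w x \<and> Du x = \<upsilon> x)))"
proof -
  interpret C1_manifold_pair AM AN
    using assms(1,2) by (simp add: C1_manifold_pair_def C1_manifold_def)
  note lim = assms(4,5,6)
  show ?thesis
  proof (intro conjI ballI allI impI; (elim conjE)?)
    show "colocally_weakly_differentiable AM AN u"
      by (rule limit_colocally_weakly_differentiable[OF lim])
    show "(\<lambda>l. LINT p:chart_image c|lebesgue. weak_derivative (chart_image c) (f \<circ> us l \<circ> chart_inv c) p \<bullet> v p)
       \<longlonglongrightarrow> (LINT p:chart_image c|lebesgue. weak_derivative (chart_image c) (f \<circ> u \<circ> chart_inv c) p \<bullet> v p)"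
      if "f \<in> C1c_manifold AN" "c \<in> charts AM" "v \<in> C1c_vector_fields (chart_image c)" for f c v
      by (rule weak_derivative_integral_limit[OF lim that])
    show "\<exists>Du. colocal_weak_derivative AM AN u Du"
      if "bundle_morphism AM AN w \<upsilon>"
        "converges_locally_in_measure AM (hom_bundle AM AN) (\<lambda>l. hom_section (us l) (Dus l)) (hom_section w \<upsilon>)" for w \<upsilon>
      by (rule limit_colocal_weak_derivative_exists[OF lim that])
    show "manifold_AE AM (\<lambda>x. u x = w x \<and> Du x = \<upsilon> x)"
      if "bundle_morphism AM AN w \<upsilon>"
        "converges_locally_in_measure AM (hom_bundle AM AN) (\<lambda>l. hom_section (us l) (Dus l)) (hom_section w \<upsilon>)"
        "colocal_weak_derivative AM AN u Du" for w \<upsilon> Du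
      by (rule limit_colocal_weak_derivative_unique[OF lim that])
  qed
qed

end
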